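(* Let $f,g:\mathbb{R}^d\to\mathbb{R}^d$ satisfy the linear growth, one-sided dissipative Lipschitz and integrability conditions recalled in the context, let $a_1,a_2\in\mathbb{R}\setminus\{0\}$ and $b_1,b_2\in\mathbb{R}^d$. For $\kappa\ge1$ let $(\bar U_\kappa(t,\omega),\bar V_\kappa(t,\omega))$ be the stationary solution, given by the singleton random attractor, of the coupled random differential equations $$\frac{dU}{dt}=e^{-a_1O^1_t}f\Big(Ue^{a_1O^1_t}+\frac{b_1}{a_1}(e^{a_1O^1_t}-1)\Big)+(a_1U+b_1)O^1_t+\kappa(V-U),$$ $$\frac{dV}{dt}=e^{-a_2O^2_t}g\Big(Ve^{a_2O^2_t}+\frac{b_2}{a_2}(e^{a_2O^2_t}-1)\Big)+(a_2V+b_2)O^2_t+\kappa(U-V),$$ and let $\bar W(t,\omega)$ be the unique stationary solution of the averaged equation $$\frac{dW}{dt}=\frac12\Big[e^{-a_1O^1_t}f\Big(e^{a_1O^1_t}W+\frac{b_1}{a_1}(e^{a_1O^1_t}-1)\Big)+e^{-a_2O^2_t}g\Big(e^{a_2O^2_t}W+\frac{b_2}{a_2}(e^{a_2O^2_t}-1)\Big)\Big]+\frac12\big[(a_1W+b_1)O^1_t+(a_2W+b_2)O^2_t\big].$$ Then $$\big(\bar U_{\kappa}(t,\omega),\bar V_{\kappa}(t,\omega)\big)\to\big(\bar W(t,\omega),\bar W(t,\omega)\big)\quad\text{as }\kappa\to\infty,$$ pathwise, uniformly on bounded time intervals $[T_1,T_2]\subset\mathbb{R}$.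
   Context: Norm and inner product are Euclidean on $\mathbb{R}^d$. Conditions on $f,g$: for each $h\in\{f,g\}$: (linear growth) $\|h(x)\|\le l\|x\|+M$ for all $x$, with constants $l,M>0$; (one-sided dissipative Lipschitz) $\langle x-y,h(x)-h(y)\rangle\le -L\|x-y\|^2$ for all $x,y$, with a constant $L>0$; (integrability) there is $m_0>0$ such that $\int_{-\infty}^0 e^{ms}(\|f(u(s))\|^2+\|g(u(s))\|^2)ds<\infty$ for every $m\in(0,m_0]$ and every continuous $u:\mathbb{R}\to\mathbb{R}^d$ of sub-exponential growth (for every $\epsilon>0$ there are $C>0$, $t_0$ with $\|u(t)\|\le Ce^{\epsilon|t|}$ for $|t|\ge t_0$). Noise: $B^{H_1},B^{H_2}$ are independent two-sided one-dimensional fractional Brownian motions with Hurst parameters $H_1,H_2\in(\frac12,1)$ (continuous centered Gaussian, covariance $\frac12(|t|^{2H}+|s|^{2H}-|t-s|^{2H})$ with $H=H_1$, $H_2$ respectively), realized canonically on path space $C_0(\mathbb{R},\mathbb{R}^2)$ (continuous paths vanishing at $0$) with the law $\mathbb{P}$ of $(B^{H_1},B^{H_2})$ and the shift $\theta_t\omega(\cdot)=\omega(\cdot+t)-\omega(t)$. $O^i_t=e^{-t}\int_{-\infty}^te^s\,dB^{H_i}_s$ is the stationary fractional Ornstein–Uhlenbeck process, solving $dO^i_t=-O^i_t\,dt+dB^{H_i}_t$, $i=1,2$. The sample space $\Omega$ is restricted once and for all to a $\theta$-invariant set of full measure of paths on which the almost sure path properties used (local Hölder continuity, growth bounds, ergodic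 averages) hold; "pathwise" means for every $\omega$ in this set. A stationary solution is a solution of the form $t\mapsto x(\theta_t\omega)$ for a random variable $x$. For $\kappa\ge1$, $\bar U_\kappa(t,\omega)=\bar U_\kappa(\theta_t\omega)$ and $\bar V_\kappa(t,\omega)=\bar V_\kappa(\theta_t\omega)$, where $\mathcal{A}_\kappa(\omega)=\{(\bar U_\kappa(\omega),\bar V_\kappa(\omega))\}$ is the random attractor of the random dynamical system $\phi$ on $\mathbb{R}^{2d}$ generated by the coupled equations ($\phi(t,\omega,\cdot)$ maps the initial value at time $0$ to the value of the solution at time $t$). Random attractor: a compact tempered random set $\mathcal{A}$ with $\phi(t,\omega,\mathcal{A}(\omega))=\mathcal{A}(\theta_t\omega)$ for $t>0$ and $\lim_{t\to\infty}\sup_{x\in\phi(t,\theta_{-t}\omega,D(\theta_{-t}\omega))}\inf_{y\in\mathcal{A}(\omega)}\|x-y\|=0$ for every tempered closed random set $D$; a random set $D$ is tempered if $\log^+\big(\sup_{x\in D(\theta_t\omega)}\|x\|\big)/|t|\to0$ as $t\to\pm\infty$. *)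

theory Defs
  imports "HOL-Probability.Probability"
begin

type_synonym path = "real \<Rightarrow> real \<times> real"

definition C0 :: "path set" where
  "C0 = {\<omega>. continuous_on UNIV \<omega> \<and> \<omega> 0 = 0}"

text \<open>The trace on \<^term>\<open>C0\<close> of the product \<open>\<sigma>\<close>-algebra, i.e. the \<open>\<sigma>\<close>-algebra generated by the
  evaluations; it is the Borel \<open>\<sigma>\<close>-algebra of locally uniform convergence.\<close>

definition path_algebra :: "path measure" where
  "path_algebra = restrict_space (PiM UNIV (\<lambda>_. borel)) C0"

definition shift :: "real \<Rightarrow> path \<Rightarrow> path" where
  "shift t \<omega> = (\<lambda>s. \<omega> (s + t) - \<omega> t)"

definition centered_gaussian :: "'w measure \<Rightarrow> ('w \<Rightarrow> real) \<Rightarrow> bool" where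
  "centered_gaussian M X \<longleftrightarrow> X \<in> borel_measurable M \<and>
     (distr M borel X = return borel 0 \<or>
      (\<exists>\<sigma>>0. distr M borel X = density lborel (\<lambda>x. ennreal (normal_density 0 \<sigma> x))))"

definition fractional_brownian_motion :: "real \<Rightarrow> 'w measure \<Rightarrow> (real \<Rightarrow> 'w \<Rightarrow> real) \<Rightarrow> bool" where
  "fractional_brownian_motion H M B \<longleftrightarrow>
     (\<forall>\<omega>\<in>space M. continuous_on UNIV (\<lambda>t. B t \<omega>)) \<and>
     (\<forall>J c. finite J \<longrightarrow> centered_gaussian M (\<lambda>\<omega>. \<Sum>t\<in>J. c t * B t \<omega>)) \<and>
     (\<forall>s t. (\<integral>\<omega>. B s \<omega> * B t \<omega> \<partial>M) =
        1/2 * (\<bar>t\<bar> powr (2 * H) + \<bar>s\<bar> powr (2 * H) - \<bar>t - s\<bar> powr (2 * H)))"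

definition fbm_pair_law :: "real \<Rightarrow> real \<Rightarrow> path measure \<Rightarrow> bool" where
  "fbm_pair_law H1 H2 P \<longleftrightarrow>
     prob_space P \<and> space P = C0 \<and> sets P = sets path_algebra \<and>
     fractional_brownian_motion H1 P (\<lambda>t \<omega>. fst (\<omega> t)) \<and>
     fractional_brownian_motion H2 P (\<lambda>t \<omega>. snd (\<omega> t)) \<and>
     prob_space.indep_var P
       (PiM UNIV (\<lambda>_. borel)) (\<lambda>\<omega> t. fst (\<omega> t))
       (PiM UNIV (\<lambda>_. borel)) (\<lambda>\<omega> t. snd (\<omega> t))"

definition invariant_full :: "path measure \<Rightarrow> path set \<Rightarrow> bool" where
  "invariant_full P \<Omega> \<longleftrightarrow> \<Omega> \<in> sets P \<and> measure P \<Omega> = 1 \<and> (\<forall>t. shift t ` \<Omega> = \<Omega>)"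

text \<open>Riemann--Stieltjes integrals \<open>\<integral>\<^sub>a\<^sup>b f dg\<close>: the constant gauge makes \<open>d\<close> a bound on the mesh.\<close>

definition has_rs_integral ::
  "(real \<Rightarrow> real) \<Rightarrow> (real \<Rightarrow> real) \<Rightarrow> real \<Rightarrow> real \<Rightarrow> real \<Rightarrow> bool" where
  "has_rs_integral f g a b I \<longleftrightarrow>
     (\<forall>e>0. \<exists>d>0. \<forall>p. p tagged_division_of {a..b} \<and> (\<lambda>x. ball x d) fine p \<longrightarrow>
        \<bar>(\<Sum>(x, k)\<in>p. f x * (g (Sup k) - g (Inf k))) - I\<bar> < e)"

definition rs_integral :: "(real \<Rightarrow> real) \<Rightarrow> (real \<Rightarrow> real) \<Rightarrow> real \<Rightarrow> real \<Rightarrow> real" where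
  "rs_integral f g a b = (THE I. has_rs_integral f g a b I)"

text \<open>\<open>O\<^sub>t = e\<^sup>-\<^sup>t \<integral>\<^sub>-\<^sub>\<infinity>\<^sup>t e\<^sup>s dB\<^sub>s\<close>, taken pathwise as an improper Riemann--Stieltjes
  integral (the integrand has locally bounded variation and the paths are continuous). \<^term>\<open>Lim\<close> and
  the definite description are meaningful on paths of subexponential growth, hence almost surely.\<close>

definition ou :: "(real \<Rightarrow> real) \<Rightarrow> real \<Rightarrow> real" where
  "ou B t = exp (- t) * Lim at_bot (\<lambda>a. rs_integral exp B a t)"

definition ou1 :: "path \<Rightarrow> real \<Rightarrow> real" where
  "ou1 \<omega> = ou (\<lambda>s. fst (\<omega> s))"

definition ou2 :: "path \<Rightarrow> real \<Rightarrow> real" where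
  "ou2 \<omega> = ou (\<lambda>s. snd (\<omega> s))"

definition linear_growth :: "('a::euclidean_space \<Rightarrow> 'a) \<Rightarrow> bool" where
  "linear_growth h \<longleftrightarrow> (\<exists>l>0. \<exists>M>0. \<forall>x. norm (h x) \<le> l * norm x + M)"

definition dissipative_lipschitz :: "('a::euclidean_space \<Rightarrow> 'a) \<Rightarrow> bool" where
  "dissipative_lipschitz h \<longleftrightarrow>
     (\<exists>L>0. \<forall>x y. (x - y) \<bullet> (h x - h y) \<le> - L * (norm (x - y))\<^sup>2)"

definition subexponential :: "(real \<Rightarrow> 'a::euclidean_space) \<Rightarrow> bool" where
  "subexponential u \<longleftrightarrow>
     (\<forall>\<epsilon>>0. \<exists>C>0. \<exists>t0. \<forall>t. \<bar>t\<bar> \<ge> t0 \<longrightarrow> norm (u t) \<le> C * exp (\<epsilon> * \<bar>t\<bar>))"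

definition integrability_condition ::
  "('a::euclidean_space \<Rightarrow> 'a) \<Rightarrow> ('a \<Rightarrow> 'a) \<Rightarrow> bool" where
  "integrability_condition f g \<longleftrightarrow>
     (\<exists>m0>0. \<forall>m u. 0 < m \<and> m \<le> m0 \<and> continuous_on UNIV u \<and> subexponential u \<longrightarrow>
        (\<lambda>s. exp (m * s) * ((norm (f (u s)))\<^sup>2 + (norm (g (u s)))\<^sup>2))
          absolutely_integrable_on {..0})"

definition transformed_drift ::
  "('a::euclidean_space \<Rightarrow> 'a) \<Rightarrow> real \<Rightarrow> 'a \<Rightarrow> real \<Rightarrow> 'a \<Rightarrow> 'a" where
  "transformed_drift h a b z x =
     exp (- (a * z)) *\<^sub>R h (exp (a * z) *\<^sub>R x + (exp (a * z) - 1) *\<^sub>R (b /\<^sub>R a))"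

definition coupled_field ::
  "('a::euclidean_space \<Rightarrow> 'a) \<Rightarrow> ('a \<Rightarrow> 'a) \<Rightarrow> real \<Rightarrow> real \<Rightarrow> 'a \<Rightarrow> 'a \<Rightarrow> real
     \<Rightarrow> path \<Rightarrow> real \<Rightarrow> 'a \<times> 'a \<Rightarrow> 'a \<times> 'a" where
  "coupled_field f g a1 a2 b1 b2 \<kappa> \<omega> t = (\<lambda>(u, v).
     (transformed_drift f a1 b1 (ou1 \<omega> t) u + ou1 \<omega> t *\<^sub>R (a1 *\<^sub>R u + b1) + \<kappa> *\<^sub>R (v - u),
      transformed_drift g a2 b2 (ou2 \<omega> t) v + ou2 \<omega> t *\<^sub>R (a2 *\<^sub>R v + b2) + \<kappa> *\<^sub>R (u - v)))"

definition averaged_field ::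
  "('a::euclidean_space \<Rightarrow> 'a) \<Rightarrow> ('a \<Rightarrow> 'a) \<Rightarrow> real \<Rightarrow> real \<Rightarrow> 'a \<Rightarrow> 'a
     \<Rightarrow> path \<Rightarrow> real \<Rightarrow> 'a \<Rightarrow> 'a" where
  "averaged_field f g a1 a2 b1 b2 \<omega> t w =
     (1/2) *\<^sub>R (transformed_drift f a1 b1 (ou1 \<omega> t) w + transformed_drift g a2 b2 (ou2 \<omega> t) w) +
     (1/2) *\<^sub>R (ou1 \<omega> t *\<^sub>R (a1 *\<^sub>R w + b1) + ou2 \<omega> t *\<^sub>R (a2 *\<^sub>R w + b2))"

text \<open>Temperedness is not part of the notion. Without it a stationary solution is determined only
  almost surely, since it may be altered along the orbit of a single path.\<close>

definition stationary_solution ::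
  "path measure \<Rightarrow> path set \<Rightarrow> (path \<Rightarrow> real \<Rightarrow> 'a::euclidean_space \<Rightarrow> 'a) \<Rightarrow> (path \<Rightarrow> 'a) \<Rightarrow> bool" where
  "stationary_solution P \<Omega> F x \<longleftrightarrow>
     x \<in> borel_measurable (restrict_space P \<Omega>) \<and>
     (\<forall>\<omega>\<in>\<Omega>. \<forall>t. ((\<lambda>t. x (shift t \<omega>)) has_vector_derivative F \<omega> t (x (shift t \<omega>))) (at t))"

definition random_dynamical_system ::
  "path measure \<Rightarrow> path set \<Rightarrow> (real \<Rightarrow> path \<Rightarrow> 'a::euclidean_space \<Rightarrow> 'a) \<Rightarrow> bool" where
  "random_dynamical_system P \<Omega> \<phi> \<longleftrightarrow>
     (\<lambda>(t, \<omega>, x). \<phi> t \<omega> x) \<in> borel_measurable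
        (restrict_space borel {0..} \<Otimes>\<^sub>M (restrict_space P \<Omega> \<Otimes>\<^sub>M borel)) \<and>
     (\<forall>\<omega>\<in>\<Omega>. \<forall>t\<ge>0. continuous_on UNIV (\<phi> t \<omega>)) \<and>
     (\<forall>\<omega>\<in>\<Omega>. \<forall>x. \<phi> 0 \<omega> x = x) \<and>
     (\<forall>\<omega>\<in>\<Omega>. \<forall>s\<ge>0. \<forall>t\<ge>0. \<forall>x. \<phi> (t + s) \<omega> x = \<phi> t (shift s \<omega>) (\<phi> s \<omega> x))"

definition generated_by ::
  "path set \<Rightarrow> (path \<Rightarrow> real \<Rightarrow> 'a::euclidean_space \<Rightarrow> 'a) \<Rightarrow> (real \<Rightarrow> path \<Rightarrow> 'a \<Rightarrow> 'a) \<Rightarrow> bool" where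
  "generated_by \<Omega> F \<phi> \<longleftrightarrow>
     (\<forall>\<omega>\<in>\<Omega>. \<forall>x. \<phi> 0 \<omega> x = x \<and>
        (\<forall>t\<ge>0. ((\<lambda>t. \<phi> t \<omega> x) has_vector_derivative F \<omega> t (\<phi> t \<omega> x)) (at t within {0..})))"

definition random_set ::
  "path measure \<Rightarrow> path set \<Rightarrow> (path \<Rightarrow> 'a::euclidean_space set) \<Rightarrow> bool" where
  "random_set P \<Omega> D \<longleftrightarrow> (\<forall>\<omega>\<in>\<Omega>. D \<omega> \<noteq> {}) \<and>
     (\<forall>x. (\<lambda>\<omega>. infdist x (D \<omega>)) \<in> borel_measurable (restrict_space P \<Omega>))"

text \<open>Boundedness is explicit because the real-valued supremum of an unbounded set is meaningless.
  Here \<open>log\<^sup>+ r = ln (max 1 r)\<close>.\<close>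

definition tempered :: "path set \<Rightarrow> (path \<Rightarrow> 'a::euclidean_space set) \<Rightarrow> bool" where
  "tempered \<Omega> D \<longleftrightarrow> (\<forall>\<omega>\<in>\<Omega>. bounded (D \<omega>) \<and>
     (\<forall>F\<in>{at_top, at_bot}.
        ((\<lambda>t. ln (max 1 (SUP x\<in>D (shift t \<omega>). norm x)) / \<bar>t\<bar>) \<longlongrightarrow> 0) F))"

text \<open>For sets \<open>D\<close> as quantified here the supremum below is over a bounded set, because \<open>\<phi> t \<omega>\<close> is
  continuous and \<open>D \<omega>\<close> is closed and bounded.\<close>

definition random_attractor ::
  "path measure \<Rightarrow> path set \<Rightarrow> (real \<Rightarrow> path \<Rightarrow> 'a::euclidean_space \<Rightarrow> 'a)
     \<Rightarrow> (path \<Rightarrow> 'a set) \<Rightarrow> bool" where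
  "random_attractor P \<Omega> \<phi> A \<longleftrightarrow>
     random_set P \<Omega> A \<and> (\<forall>\<omega>\<in>\<Omega>. compact (A \<omega>)) \<and> tempered \<Omega> A \<and>
     (\<forall>\<omega>\<in>\<Omega>. \<forall>t>0. \<phi> t \<omega> ` A \<omega> = A (shift t \<omega>)) \<and>
     (\<forall>D. random_set P \<Omega> D \<and> (\<forall>\<omega>\<in>\<Omega>. closed (D \<omega>)) \<and> tempered \<Omega> D \<longrightarrow>
        (\<forall>\<omega>\<in>\<Omega>. ((\<lambda>t. SUP x\<in>\<phi> t (shift (- t) \<omega>) ` D (shift (- t) \<omega>). infdist x (A \<omega>))
                    \<longlongrightarrow> 0) at_top))"

definition synchronizes ::
  "(real \<Rightarrow> path \<Rightarrow> 'a::euclidean_space) \<Rightarrow> (real \<Rightarrow> path \<Rightarrow> 'a) \<Rightarrow> (path \<Rightarrow> 'a) \<Rightarrow> path \<Rightarrow> bool" where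
  "synchronizes U V W \<omega> \<longleftrightarrow>
     (\<forall>T1 T2. uniform_limit {T1..T2}
        (\<lambda>\<kappa> t. (U \<kappa> (shift t \<omega>), V \<kappa> (shift t \<omega>)))
        (\<lambda>t. (W (shift t \<omega>), W (shift t \<omega>))) at_top)"

end

theory Submission
  imports Defs "HOL-Real_Asymp.Real_Asymp"
begin

text \<open>
  Write \<open>F\<^sub>i\<close> for the two uncoupled fields, \<open>O\<^sub>i\<close> for the two stationary Ornstein--Uhlenbeck paths and
  \<open>L\<close> for a common dissipativity constant. Conjugation by the exponential change of variables leaves
  the constant of the drift unchanged, so \<open>F\<^sub>i\<close> is one-sided Lipschitz with constant
  \<open>- L + a\<^sub>i O\<^sub>i(t)\<close> (\<open>component_field_dissipative\<close>). This constant may be positive at times; only its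
  time average is under control.

  Compare \<open>(U, V)\<close> directly with \<open>(W, W)\<close>. With \<open>u = U - W\<close>, \<open>v = V - W\<close> and
  \<open>E = \<parallel>u\<parallel>\<^sup>2 + \<parallel>v\<parallel>\<^sup>2\<close>, the average of the two constants acts on \<open>E\<close>, whereas both their difference
  \<open>d = a\<^sub>1 O\<^sub>1 - a\<^sub>2 O\<^sub>2\<close> and the defect \<open>G = (F\<^sub>1(W) - F\<^sub>2(W)) / 2\<close> are paired with \<open>u - v\<close> and are
  absorbed by the coupling term \<open>- 2 \<kappa> \<parallel>u - v\<parallel>\<^sup>2\<close> (\<open>error_dissipation\<close>):
  \<open>E' \<le> (- 2 L + a\<^sub>1 O\<^sub>1 + a\<^sub>2 O\<^sub>2 + d\<^sup>2 / (2 \<kappa>)) E + \<parallel>G\<parallel>\<^sup>2 / \<kappa>\<close>.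
  Hence \<open>E\<close> is of order \<open>1 / \<kappa>\<close> on bounded intervals, provided that, looking back into the past,
  the exponential rate is negative and nothing else grows exponentially. Three facts about a path
  suffice for that: \<open>O\<^sub>i\<close> is sublinear, its time averages vanish, and the time averages of \<open>O\<^sub>i\<^sup>2\<close> stay
  bounded (the last one makes the term \<open>d\<^sup>2 / (2 \<kappa>)\<close> harmless for large \<open>\<kappa>\<close>). The resulting estimate is
  \<open>synchronization_rate\<close>. Besides the equations, it uses of \<open>(U, V)\<close> only temperedness, and of \<open>W\<close> only the
  existence of arbitrarily early times at which \<open>W\<close> is small on the exponential scale.

  The first two facts follow from sublinearity of the driving path, because
  \<open>O = B - N\<close>, where \<open>N\<close> is the exponentially weighted past average of \<open>B\<close> and at the same time an
  antiderivative of \<open>O\<close> (\<open>ou_decomposition\<close>). Since \<open>H > 1/2\<close>, second moments of dyadic increments are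
  summable, and chaining bounds the expected square of the maximum of the path over an interval of
  length \<open>T\<close> by a multiple of \<open>T\<^bsup>2H\<^esup>\<close> (\<open>chaining\<close>). As \<open>H < 1\<close>, summation over the intervals
  with end points \<open>2\<^sup>k\<close> gives sublinearity. For the third fact, \<open>O\<^sup>2\<close> on a unit
  interval is bounded by a weighted supremum of the shifted path, an integrable functional by the same chaining bound; the maximal ergodic
  inequality bounds its averages along the orbit of the shift (\<open>AE_bounded_averages\<close>).

  Invariance of the law under the shift (\<open>shift_preserves_law\<close>) comes from the covariance, because a
  Gaussian law is determined by its second moment and a family of random variables by its linear
  combinations (\<open>joint_law_eq\<close>). Invariance also serves the solution \<open>W\<close> that is not assumed to be
  tempered: by recurrence, almost every path has \<open>W\<close> bounded along a sequence of times tending to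
  \<open>-\<infinity>\<close> (\<open>invariant_full_recurrent_paths\<close>).
\<close>

section \<open>Comparison through derivatives\<close>

lemma antiderivative_exists:
  fixes f :: "real \<Rightarrow> real"
  assumes "continuous_on UNIV f"
  shows "\<exists>F. \<forall>t. (F has_real_derivative f t) (at t)"
  using einterval_antiderivative[of "-\<infinity>" "\<infinity>" f] assms
  by (auto simp: continuous_on_eq_continuous_at has_real_derivative_iff_has_vector_derivative)

lemma increment_le_of_derivative_le:
  fixes f g :: "real \<Rightarrow> real"
  assumes "a \<le> b"
    and f: "\<And>t. a \<le> t \<Longrightarrow> t \<le> b \<Longrightarrow> (f has_real_derivative f' t) (at t)"
    and g: "\<And>t. a \<le> t \<Longrightarrow> t \<le> b \<Longrightarrow> (g has_real_derivative g' t) (at t)"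
    and le: "\<And>t. a \<le> t \<Longrightarrow> t \<le> b \<Longrightarrow> f' t \<le> g' t"
  shows "f b - f a \<le> g b - g a"
proof -
  have "g a - f a \<le> g b - f b"
    by (rule DERIV_nonneg_imp_nondecreasing[OF \<open>a \<le> b\<close>])
      (use f g le in \<open>auto intro!: exI[of _ "g' _ - f' _"] derivative_intros\<close>)
  then show ?thesis by simp
qed

lemma abs_increment_le_of_abs_derivative_le:
  fixes f g :: "real \<Rightarrow> real"
  assumes "a \<le> b"
    and f: "\<And>t. a \<le> t \<Longrightarrow> t \<le> b \<Longrightarrow> (f has_real_derivative f' t) (at t)"
    and g: "\<And>t. a \<le> t \<Longrightarrow> t \<le> b \<Longrightarrow> (g has_real_derivative g' t) (at t)"
    and le: "\<And>t. a \<le> t \<Longrightarrow> t \<le> b \<Longrightarrow> \<bar>f' t\<bar> \<le> g' t"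
  shows "\<bar>f b - f a\<bar> \<le> g b - g a"
proof -
  have "f b - f a \<le> g b - g a"
    using le by (intro increment_le_of_derivative_le[OF \<open>a \<le> b\<close> f g]) (auto simp: abs_le_iff)
  moreover have "- f b - - f a \<le> g b - g a"
    using le by (intro increment_le_of_derivative_le[OF \<open>a \<le> b\<close> _ g, of "\<lambda>t. - f t" "\<lambda>t. - f' t"])
      (auto simp: abs_le_iff intro!: derivative_intros f)
  ultimately show ?thesis by linarith
qed

section \<open>The pathwise Ornstein--Uhlenbeck process\<close>

text \<open>Integration by parts: \<open>t \<mapsto> exp t * g t - A t\<close> is the candidate for the indefinite integral. Its increments
telescope over any tagged division, and on a small interval they differ from the Riemann--Stieltjes
term by at most the oscillation of \<open>g\<close> times the increment of \<open>exp\<close>.\<close>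

lemma has_rs_integral_exp:
  fixes g A :: "real \<Rightarrow> real"
  assumes "a \<le> b" and cont: "continuous_on UNIV g"
    and A: "\<And>t. (A has_real_derivative exp t * g t) (at t)"
  shows "has_rs_integral exp g a b ((exp b * g b - A b) - (exp a * g a - A a))"
  unfolding has_rs_integral_def
proof (intro allI impI)
  fix e :: real assume "e > 0"
  \<comment> \<open>The summand 1 keeps the denominator positive when \<open>a = b\<close>.\<close>
  define c where "c = e / (exp b - exp a + 1)"
  have ab: "exp a \<le> exp b" using \<open>a \<le> b\<close> by simp
  have "c > 0" using \<open>e > 0\<close> ab unfolding c_def by (intro divide_pos_pos) linarith+
  have ce: "c * (exp b - exp a) < e"
  proof -
    have "c * (exp b - exp a + 1) = e"
    proof -
      have "exp b - exp a + 1 \<noteq> 0" using ab by linarith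
      then show ?thesis by (simp add: c_def)
    qed
    then show ?thesis using \<open>c > 0\<close> by (simp add: algebra_simps)
  qed
  have "uniformly_continuous_on {a..b} g"
    using cont by (intro compact_uniformly_continuous) (auto intro: continuous_on_subset)
  then obtain d where "d > 0" and d: "\<And>x y. x \<in> {a..b} \<Longrightarrow> y \<in> {a..b} \<Longrightarrow> dist y x < d \<Longrightarrow> dist (g y) (g x) < c"
    unfolding uniformly_continuous_on_def using \<open>c > 0\<close> by metis
  define \<Phi> where "\<Phi> t = exp t * g t - A t" for t
  have "\<bar>(\<Sum>(x, k)\<in>p. exp x * (g (Sup k) - g (Inf k))) - (\<Phi> b - \<Phi> a)\<bar> < e"
    if p: "p tagged_division_of {a..b}" and fine: "(\<lambda>x. ball x (d/2)) fine p" for p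
  proof -
    have fin: "finite p" using p by (auto simp: tagged_division_of)
    have tel: "(\<Sum>(x, k)\<in>p. h (Sup k) - h (Inf k)) = h b - h a" for h :: "real \<Rightarrow> real"
      using additive_tagged_division_1[OF \<open>a \<le> b\<close> p, of h] .
    have small: "\<bar>exp x * (g (Sup k) - g (Inf k)) - (\<Phi> (Sup k) - \<Phi> (Inf k))\<bar>
        \<le> c * exp (Sup k) - c * exp (Inf k)" if xk: "(x, k) \<in> p" for x k
    proof -
      obtain u v where k: "k = cbox u v" using p xk by (metis tagged_division_ofD(4))
      have xin: "x \<in> k" using p xk by (metis tagged_division_ofD(2))
      have kab: "k \<subseteq> {a..b}" using p xk by (metis tagged_division_ofD(3))
      have uv: "u \<le> x" "x \<le> v" using xin k by auto
      have kball: "k \<subseteq> ball x (d/2)" using fine xk by (auto simp: fine_def)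
      have SI: "Sup k = v" "Inf k = u" using k uv by auto
      have close: "\<bar>g s - g r\<bar> \<le> c" if "s \<in> k" "r \<in> k" for s r
      proof -
        have "dist x s < d/2" "dist x r < d/2" using kball that by auto
        then have "dist s r < d" using dist_triangle[of s r x] by (simp add: dist_commute)
        then have "dist (g s) (g r) < c" using d kab that by blast
        then show ?thesis by (simp add: dist_real_def)
      qed
      have piece: "\<bar>(A z - exp z * g r) - (A y - exp y * g r)\<bar> \<le> c * exp z - c * exp y"
        if "y \<le> z" "{y..z} \<subseteq> k" "r \<in> k" for y z r
      proof (rule abs_increment_le_of_abs_derivative_le
          [where f = "\<lambda>t. A t - exp t * g r" and g = "\<lambda>t. c * exp t"
            and f' = "\<lambda>t. exp t * g t - exp t * g r" and g' = "\<lambda>t. c * exp t", OF that(1)])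
        fix t assume "y \<le> t" "t \<le> z"
        then have "\<bar>g t - g r\<bar> \<le> c" using close that by auto
        then have "exp t * \<bar>g t - g r\<bar> \<le> exp t * c" by (intro mult_left_mono) auto
        then show "\<bar>exp t * g t - exp t * g r\<bar> \<le> c * exp t"
          by (simp add: abs_mult mult.commute flip: right_diff_distrib)
      qed (auto intro!: derivative_eq_intros A)
      have "\<bar>(A v - exp v * g v) - (A x - exp x * g v)\<bar> \<le> c * exp v - c * exp x"
        using uv k by (intro piece) auto
      moreover have "\<bar>(A x - exp x * g u) - (A u - exp u * g u)\<bar> \<le> c * exp x - c * exp u"
        using uv k by (intro piece) auto
      ultimately show ?thesis unfolding SI \<Phi>_def
        by (simp add: algebra_simps)
    qed
    have "(\<Sum>(x, k)\<in>p. exp x * (g (Sup k) - g (Inf k))) - (\<Phi> b - \<Phi> a)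
        = (\<Sum>(x, k)\<in>p. exp x * (g (Sup k) - g (Inf k)) - (\<Phi> (Sup k) - \<Phi> (Inf k)))"
      unfolding tel[of \<Phi>, symmetric] by (simp add: sum_subtractf[symmetric] case_prod_unfold)
    also have "\<bar>\<dots>\<bar> \<le> (\<Sum>(x, k)\<in>p. c * exp (Sup k) - c * exp (Inf k))"
      by (rule order_trans[OF sum_abs sum_mono]) (use small in auto)
    also have "\<dots> = c * (exp b - exp a)"
      using tel[of "\<lambda>t. c * exp t"] by (simp add: algebra_simps)
    finally show ?thesis using ce by linarith
  qed
  then show "\<exists>d>0. \<forall>p. p tagged_division_of {a..b} \<and> (\<lambda>x. ball x d) fine p \<longrightarrow>
     \<bar>(\<Sum>(x, k)\<in>p. exp x * (g (Sup k) - g (Inf k))) - ((exp b * g b - A b) - (exp a * g a - A a))\<bar> < e"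
    using \<open>d > 0\<close> unfolding \<Phi>_def by (intro exI[of _ "d/2"]) auto
qed

lemma has_rs_integral_unique:
  assumes I: "has_rs_integral f g a b I" and J: "has_rs_integral f g a b J"
  shows "I = J"
proof (rule ccontr)
  assume "I \<noteq> J"
  then have e: "\<bar>I - J\<bar> / 2 > 0" by simp
  obtain d1 where d1: "d1 > 0" "\<And>p. p tagged_division_of {a..b} \<Longrightarrow> (\<lambda>x. ball x d1) fine p \<Longrightarrow>
      \<bar>(\<Sum>(x, k)\<in>p. f x * (g (Sup k) - g (Inf k))) - I\<bar> < \<bar>I - J\<bar> / 2"
    using I[unfolded has_rs_integral_def, rule_format, OF e] by auto
  obtain d2 where d2: "d2 > 0" "\<And>p. p tagged_division_of {a..b} \<Longrightarrow> (\<lambda>x. ball x d2) fine p \<Longrightarrow>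
      \<bar>(\<Sum>(x, k)\<in>p. f x * (g (Sup k) - g (Inf k))) - J\<bar> < \<bar>I - J\<bar> / 2"
    using J[unfolded has_rs_integral_def, rule_format, OF e] by auto
  have "gauge (\<lambda>x::real. ball x (min d1 d2))" using d1 d2 by (auto simp: gauge_def)
  then obtain p where p: "p tagged_division_of {a..b}" "(\<lambda>x. ball x (min d1 d2)) fine p"
    using fine_division_exists_real by blast
  then have fine: "(\<lambda>x. ball x d1) fine p" "(\<lambda>x. ball x d2) fine p" 
    unfolding fine_def by (auto dest!: bspec simp: subset_iff)
  have "\<not> (\<bar>x - I\<bar> < \<bar>I - J\<bar> / 2 \<and> \<bar>x - J\<bar> < \<bar>I - J\<bar> / 2)" for x by argo
  then show False using d1(2)[OF p(1) fine(1)] d2(2)[OF p(1) fine(2)] by blast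
qed

lemma rs_integral_exp:
  assumes "a \<le> b" "continuous_on UNIV g" "\<And>t. (A has_real_derivative exp t * g t) (at t)"
  shows "rs_integral exp g a b = (exp b * g b - A b) - (exp a * g a - A a)"
  unfolding rs_integral_def
  using has_rs_integral_exp[OF assms] has_rs_integral_unique by (intro the_equality) blast+

text \<open>A Cauchy criterion at \<open>-\<infinity>\<close>: adding the dominating function makes the values along an arithmetic
progression monotone.\<close>

lemma tendsto_at_bot_of_dominated_increments:
  fixes A h :: "real \<Rightarrow> real"
  assumes inc: "\<And>a b. a \<le> b \<Longrightarrow> b \<le> t0 \<Longrightarrow> \<bar>A b - A a\<bar> \<le> h b - h a"
    and h: "(h \<longlongrightarrow> 0) at_bot"
  shows "\<exists>l. (A \<longlongrightarrow> l) at_bot"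
proof -
  define u where "u n = t0 - real n" for n :: nat
  have u: "filterlim u at_bot sequentially" unfolding u_def by real_asymp
  have hu: "(\<lambda>n. h (u n)) \<longlonglongrightarrow> 0" by (rule filterlim_compose[OF h u])
  have h_nonneg: "0 \<le> h b" if "b \<le> t0" for b
  proof (rule tendsto_upperbound[OF h])
    show "\<forall>\<^sub>F a in at_bot. h a \<le> h b"
      using eventually_le_at_bot[of b] by eventually_elim (use inc that in force)
  qed simp
  have dec: "decseq (\<lambda>n. A (u n) + h (u n))"
  proof (rule decseq_SucI)
    fix n
    show "A (u (Suc n)) + h (u (Suc n)) \<le> A (u n) + h (u n)"
      using inc[of "u (Suc n)" "u n"] by (auto simp: u_def abs_le_iff)
  qed
  have low: "A t0 - h t0 \<le> A (u n) + h (u n)" for n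
    using inc[of "u n" t0] h_nonneg[of "u n"] by (auto simp: u_def abs_le_iff)
  obtain l where "(\<lambda>n. A (u n) + h (u n)) \<longlonglongrightarrow> l"
    using decseq_convergent[OF dec] low by blast
  from tendsto_diff[OF this hu] have l: "(\<lambda>n. A (u n)) \<longlonglongrightarrow> l" by simp
  have bound: "\<bar>A t - l\<bar> \<le> h t" if "t \<le> t0" for t
  proof (rule tendsto_le[OF sequentially_bot])
    show "(\<lambda>n. h t - h (u n)) \<longlonglongrightarrow> h t" using tendsto_diff[OF tendsto_const hu, of "h t"] by simp
    show "(\<lambda>n. \<bar>A t - A (u n)\<bar>) \<longlonglongrightarrow> \<bar>A t - l\<bar>" by (intro tendsto_intros l)
    show "\<forall>\<^sub>F n in sequentially. \<bar>A t - A (u n)\<bar> \<le> h t - h (u n)"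
      using filterlim_at_bot[THEN iffD1, OF u, rule_format, of t]
      by eventually_elim (use inc that in auto)
  qed
  have "((\<lambda>t. A t - l) \<longlongrightarrow> 0) at_bot"
    by (rule Lim_null_comparison[OF _ h])
      (use eventually_le_at_bot[of t0] in eventually_elim, use bound in auto)
  then have "(A \<longlongrightarrow> l) at_bot" using Lim_null by blast
  then show ?thesis ..
qed

lemma abs_le_of_abs_derivative_le_at_bot:
  fixes f g :: "real \<Rightarrow> real"
  assumes f: "\<And>s. s \<le> t \<Longrightarrow> (f has_real_derivative f' s) (at s)"
    and g: "\<And>s. s \<le> t \<Longrightarrow> (g has_real_derivative g' s) (at s)"
    and le: "\<And>s. s \<le> t \<Longrightarrow> \<bar>f' s\<bar> \<le> g' s"
    and f0: "(f \<longlongrightarrow> 0) at_bot" and g0: "(g \<longlongrightarrow> 0) at_bot"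
  shows "\<bar>f t\<bar> \<le> g t"
proof (rule tendsto_le[OF trivial_limit_at_bot_linorder])
  show "((\<lambda>a. \<bar>f t - f a\<bar>) \<longlongrightarrow> \<bar>f t\<bar>) at_bot"
    using tendsto_rabs[OF tendsto_diff[OF tendsto_const f0, of "f t"]] by simp
  show "((\<lambda>a. g t - g a) \<longlongrightarrow> g t) at_bot"
    using tendsto_diff[OF tendsto_const g0, of "g t"] by simp
  show "\<forall>\<^sub>F a in at_bot. \<bar>f t - f a\<bar> \<le> g t - g a"
    using eventually_le_at_bot[of t]
    by eventually_elim (intro abs_increment_le_of_abs_derivative_le[OF _ f g le], auto)
qed

lemma sublinear_at_bot_bound:
  fixes f :: "real \<Rightarrow> real"
  assumes "((\<lambda>t. f t / t) \<longlongrightarrow> 0) at_bot" "e > 0"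
  shows "\<exists>T. T < -1 \<and> (\<forall>t\<le>T. \<bar>f t\<bar> \<le> e * \<bar>t\<bar>)"
proof -
  have "\<forall>\<^sub>F t in at_bot. \<bar>f t / t\<bar> < e"
    using tendstoD[OF assms] by (simp add: dist_real_def)
  then obtain T0 where T0: "\<And>t. t \<le> T0 \<Longrightarrow> \<bar>f t / t\<bar> < e"
    by (auto simp: eventually_at_bot_linorder)
  show ?thesis
  proof (intro exI[of _ "min T0 (-2)"] conjI allI impI)
    fix t assume "t \<le> min T0 (-2)"
    then have "\<bar>f t\<bar> / \<bar>t\<bar> < e" "0 < \<bar>t\<bar>" using T0[of t] by auto
    then show "\<bar>f t\<bar> \<le> e * \<bar>t\<bar>" by (simp only: pos_divide_less_eq less_imp_le)
  qed auto
qed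

text \<open>Integrating by parts in the definition of \<^const>\<open>ou\<close> leaves \<open>O\<^sub>t = B\<^sub>t - N\<^sub>t\<close> with
\<open>N\<^sub>t = e\<^sup>-\<^sup>t \<integral>\<^sub>-\<^sub>\<infinity>\<^sup>t e\<^sup>s B\<^sub>s ds\<close>. Then \<open>N' = B - N = O\<close>, so every time integral of \<open>O\<close> is an increment of \<open>N\<close>.
The limit statement singles out this \<open>N\<close> among the antiderivatives.\<close>

lemma ou_decomposition:
  fixes B :: "real \<Rightarrow> real"
  assumes cont: "continuous_on UNIV B" and sub: "((\<lambda>t. B t / t) \<longlongrightarrow> 0) at_bot"
  shows "\<exists>N. (\<forall>t. (N has_real_derivative ou B t) (at t)) \<and> (\<forall>t. ou B t = B t - N t)
     \<and> ((\<lambda>t. exp t * N t) \<longlongrightarrow> 0) at_bot"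
proof -
  have "continuous_on UNIV (\<lambda>t. exp t * B t)" by (intro continuous_intros cont)
  then obtain A where A: "\<And>t. (A has_real_derivative exp t * B t) (at t)"
    using antiderivative_exists by blast
  obtain t0 where t0: "t0 < -1" "\<And>t. t \<le> t0 \<Longrightarrow> \<bar>B t\<bar> \<le> \<bar>t\<bar>"
    using sublinear_at_bot_bound[OF sub, of 1] by auto
  have "\<exists>l. (A \<longlongrightarrow> l) at_bot"
  proof (rule tendsto_at_bot_of_dominated_increments)
    fix a b assume ab: "a \<le> b" "b \<le> t0"
    show "\<bar>A b - A a\<bar> \<le> 4 * exp (b/2) - 4 * exp (a/2)"
    proof (rule abs_increment_le_of_abs_derivative_le[OF ab(1) A])
      fix t assume t: "a \<le> t" "t \<le> b"
      \<comment> \<open>Half of the weight \<open>exp t\<close> is spent on the linear growth of the path.\<close>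
      have "\<bar>t\<bar> \<le> 2 * exp (- t/2)" using exp_ge_add_one_self[of "- t/2"] t ab t0 by auto
      then have "\<bar>B t\<bar> \<le> 2 * exp (-t/2)" using t0(2)[of t] t ab by auto
      then have "exp t * \<bar>B t\<bar> \<le> exp t * (2 * exp (-t/2))" by (intro mult_left_mono) auto
      also have "\<dots> = 2 * exp (t/2)" by (simp flip: exp_add)
      finally show "\<bar>exp t * B t\<bar> \<le> 2 * exp (t/2)" by (simp add: abs_mult)
    qed (auto intro!: derivative_eq_intros)
  next
    show "((\<lambda>x::real. 4 * exp (x/2)) \<longlongrightarrow> 0) at_bot" by real_asymp
  qed
  then obtain l where l: "(A \<longlongrightarrow> l) at_bot" ..
  define N where "N t = exp (- t) * (A t - l)" for t
  have expB: "((\<lambda>t. exp t * B t) \<longlongrightarrow> 0) at_bot"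
  proof -
    have "((\<lambda>t::real. exp t * t) \<longlongrightarrow> 0) at_bot" by real_asymp
    from tendsto_mult[OF sub this] have "((\<lambda>t. B t / t * (exp t * t)) \<longlongrightarrow> 0) at_bot" by simp
    moreover have "\<forall>\<^sub>F t::real in at_bot. B t / t * (exp t * t) = exp t * B t"
      using eventually_le_at_bot[of "-1"] by eventually_elim auto
    ultimately show ?thesis by (rule Lim_transform_eventually)
  qed
  have ou: "ou B t = B t - N t" for t
  proof -
    have "((\<lambda>a. (exp t * B t - A t) - (exp a * B a - A a)) \<longlongrightarrow> (exp t * B t - A t) - (0 - l)) at_bot"
      by (intro tendsto_intros expB l)
    moreover have "\<forall>\<^sub>F a in at_bot. (exp t * B t - A t) - (exp a * B a - A a) = rs_integral exp B a t"
      using eventually_le_at_bot[of t] by eventually_elim (simp add: rs_integral_exp[OF _ cont A])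
    ultimately have "((\<lambda>a. rs_integral exp B a t) \<longlongrightarrow> (exp t * B t - A t) - (0 - l)) at_bot"
      by (rule Lim_transform_eventually)
    then have "Lim at_bot (\<lambda>a. rs_integral exp B a t) = (exp t * B t - A t) - (0 - l)"
      by (intro tendsto_Lim) auto
    then show ?thesis by (simp add: ou_def N_def exp_minus field_simps)
  qed
  moreover have "(N has_real_derivative ou B t) (at t)" for t
    unfolding N_def ou by (auto intro!: derivative_eq_intros A simp: exp_minus field_simps)
  moreover have "((\<lambda>t. exp t * N t) \<longlongrightarrow> 0) at_bot"
    using tendsto_diff[OF l tendsto_const, of l] by (simp add: N_def exp_minus flip: mult.assoc)
  ultimately show ?thesis by blast
qed

context
  fixes B N :: "real \<Rightarrow> real"
  assumes N': "\<And>t. (N has_real_derivative ou B t) (at t)"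
    and ou_eq: "\<And>t. ou B t = B t - N t"
    and expN: "((\<lambda>t. exp t * N t) \<longlongrightarrow> 0) at_bot"
begin

text \<open>Since \<open>e\<^sup>t (N\<^sub>t - c) = \<integral>\<^sub>-\<^sub>\<infinity>\<^sup>t e\<^sup>s (B\<^sub>s - c) ds\<close>, a bound on the integrand with an explicit
antiderivative that vanishes at \<open>-\<infinity>\<close> is a bound on \<open>N\<close>.\<close>

lemma ou_average_bound:
  assumes h: "\<And>s. s \<le> t \<Longrightarrow> (h has_real_derivative h' s) (at s)" "(h \<longlongrightarrow> 0) at_bot"
    and le: "\<And>s. s \<le> t \<Longrightarrow> exp s * \<bar>B s - c\<bar> \<le> h' s"
  shows "exp t * \<bar>N t - c\<bar> \<le> h t"
proof -
  have "\<bar>exp t * (N t - c)\<bar> \<le> h t"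
  proof (rule abs_le_of_abs_derivative_le_at_bot[where f = "\<lambda>s. exp s * (N s - c)" and g = h
        and f' = "\<lambda>s. exp s * (B s - c)" and g' = h'])
    fix s assume "s \<le> t"
    show "((\<lambda>s. exp s * (N s - c)) has_real_derivative exp s * (B s - c)) (at s)"
      by (auto intro!: derivative_eq_intros N' simp: ou_eq algebra_simps)
    show "\<bar>exp s * (B s - c)\<bar> \<le> h' s" using le[OF \<open>s \<le> t\<close>] by (simp add: abs_mult)
  next
    have "((\<lambda>s. exp s * c) \<longlongrightarrow> 0) at_bot" by real_asymp
    from tendsto_diff[OF expN this]
    show "((\<lambda>s. exp s * (N s - c)) \<longlongrightarrow> 0) at_bot" by (simp add: algebra_simps)
  qed (use h in auto)
  then show ?thesis by (simp add: abs_mult)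
qed

text \<open>The function \<open>\<epsilon> e\<^sup>s (1 - s)\<close> dominates: its derivative is \<open>\<epsilon> e\<^sup>s \<bar>s\<bar>\<close> for negative \<open>s\<close>.\<close>

lemma ou_average_sublinear:
  assumes sub: "((\<lambda>t. B t / t) \<longlongrightarrow> 0) at_bot"
  shows "((\<lambda>t. N t / t) \<longlongrightarrow> 0) at_bot"
proof (rule tendstoI)
  fix e :: real assume "e > 0"
  then obtain T where T: "T < -1" "\<And>t. t \<le> T \<Longrightarrow> \<bar>B t\<bar> \<le> e/4 * \<bar>t\<bar>"
    using sublinear_at_bot_bound[OF sub, of "e/4"] \<open>e > 0\<close> by (metis zero_less_divide_iff zero_less_numeral)
  show "\<forall>\<^sub>F t in at_bot. dist (N t / t) 0 < e"
    using eventually_le_at_bot[of T]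
  proof eventually_elim
    case (elim t)
    have "exp t * \<bar>N t - 0\<bar> \<le> e/4 * (exp t * (1 - t))"
    proof (rule ou_average_bound[where h' = "\<lambda>s. e/4 * (exp s * (- s))"])
      fix s assume "s \<le> t"
      show "((\<lambda>s. e/4 * (exp s * (1 - s))) has_real_derivative e/4 * (exp s * (- s))) (at s)"
        by (auto intro!: derivative_eq_intros simp: algebra_simps)
      have "exp s * \<bar>B s\<bar> \<le> exp s * (e/4 * \<bar>s\<bar>)"
        using T(2)[of s] \<open>s \<le> t\<close> elim by (intro mult_left_mono) auto
      then show "exp s * \<bar>B s - 0\<bar> \<le> e/4 * (exp s * (- s))"
        using \<open>s \<le> t\<close> elim T(1) by (simp add: algebra_simps)
    next
      show "((\<lambda>s. e/4 * (exp s * (1 - s))) \<longlongrightarrow> 0) at_bot" by real_asymp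
    qed
    then have "exp t * \<bar>N t\<bar> \<le> exp t * (e/4 * (1 - t))" by (simp add: algebra_simps)
    then have "\<bar>N t\<bar> \<le> e/4 * (1 - t)" by simp
    also have "\<dots> \<le> e/4 * (2 * \<bar>t\<bar>)"
      using elim T(1) \<open>e > 0\<close> by (intro mult_left_mono) auto
    also have "\<dots> < e * \<bar>t\<bar>" using elim T(1) \<open>e > 0\<close> by auto
    finally have "\<bar>N t\<bar> / \<bar>t\<bar> < e" using elim T(1) by (subst pos_divide_less_eq) auto
    then show ?case by (simp add: dist_real_def)
  qed
qed

text \<open>Centring the path at the right end point \<open>c\<close> of the interval gives
\<open>\<bar>N\<^sub>t - B\<^sub>c\<bar> \<le> 2 y e\<^bsup>(c - t)/2\<^esup>\<close>, and \<open>e\<^bsup>1/2\<^esup> \<le> 2\<close> turns the constants \<open>2 + 1\<close> into \<open>6\<close>.\<close>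

lemma ou_abs_le_weighted_sup:
  assumes y: "\<And>s. s \<le> 0 \<Longrightarrow> exp (s/2) * \<bar>B (s + c) - B c\<bar> \<le> y"
    and t: "c - 1 \<le> t" "t \<le> c"
  shows "\<bar>ou B t\<bar> \<le> 6 * y"
proof -
  have y0: "0 \<le> y" using y[of 0] by simp
  have Bs: "\<bar>B s - B c\<bar> \<le> y * exp ((c - s)/2)" if "s \<le> c" for s
  proof -
    have "exp ((s - c)/2) * \<bar>B s - B c\<bar> \<le> y" using y[of "s - c"] that by simp
    then have "exp ((c - s)/2) * (exp ((s - c)/2) * \<bar>B s - B c\<bar>) \<le> exp ((c - s)/2) * y"
      by (intro mult_left_mono) auto
    moreover have "exp ((c - s)/2) * exp ((s - c)/2) = 1" by (simp flip: exp_add add_divide_distrib)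
    ultimately show ?thesis by (simp only: mult.assoc[symmetric] mult_1) (simp add: mult.commute)
  qed
  have e2: "exp ((c - t)/2) \<le> 2"
  proof -
    have "(exp (1/2::real))^2 = exp 1" by (simp add: power2_eq_square flip: exp_add)
    then have "(exp (1/2::real))^2 \<le> 2^2" using exp_le by simp
    then have "exp (1/2::real) \<le> 2" by (rule power2_le_imp_le) simp
    moreover have "exp ((c - t)/2) \<le> exp (1/2)" using t by simp
    ultimately show ?thesis by (rule order_trans[rotated])
  qed
  have "exp t * \<bar>N t - B c\<bar> \<le> 2 * y * exp (c/2) * exp (t/2)"
  proof (rule ou_average_bound[where h' = "\<lambda>s. y * exp (c/2) * exp (s/2)"])
    fix s assume "s \<le> t"
    show "((\<lambda>s. 2 * y * exp (c/2) * exp (s/2)) has_real_derivative y * exp (c/2) * exp (s/2)) (at s)"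
      by (auto intro!: derivative_eq_intros)
    have "exp s * \<bar>B s - B c\<bar> \<le> exp s * (y * exp ((c - s)/2))"
      using Bs \<open>s \<le> t\<close> t by (intro mult_left_mono) auto
    also have "\<dots> = y * exp (c/2) * exp (s/2)"
      by (simp flip: exp_add add: field_simps)
    finally show "exp s * \<bar>B s - B c\<bar> \<le> y * exp (c/2) * exp (s/2)" .
  next
    show "((\<lambda>s. 2 * y * exp (c/2) * exp (s/2)) \<longlongrightarrow> 0) at_bot" by real_asymp
  qed
  also have "\<dots> = exp t * (2 * y * exp ((c - t)/2))"
    by (simp flip: exp_add add: field_simps)
  finally have "\<bar>N t - B c\<bar> \<le> 2 * y * exp ((c - t)/2)" by simp
  also have "\<dots> \<le> 2 * y * 2" using e2 y0 by (intro mult_left_mono) auto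
  finally have "\<bar>N t - B c\<bar> \<le> 4 * y" by simp
  moreover have "\<bar>B t - B c\<bar> \<le> y * 2"
    using Bs[OF t(2)] mult_left_mono[OF e2 y0] by linarith
  ultimately show ?thesis by (simp add: ou_eq)
qed

end

section \<open>Dissipativity and growth of the transformed fields\<close>

lemma has_real_derivative_norm_power2:
  fixes x :: "real \<Rightarrow> 'a::real_inner"
  assumes "(x has_vector_derivative x') (at t)"
  shows "((\<lambda>t. (norm (x t))\<^sup>2) has_real_derivative 2 * (x t \<bullet> x')) (at t)"
proof -
  have "((\<lambda>t. x t \<bullet> x t) has_derivative (\<lambda>h. x t \<bullet> (h *\<^sub>R x') + (h *\<^sub>R x') \<bullet> x t)) (at t)"
    using assms unfolding has_vector_derivative_def by (intro derivative_intros)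
  then show ?thesis
    unfolding has_field_derivative_def power2_norm_eq_inner
    by (rule has_derivative_eq_rhs) (auto simp: inner_commute algebra_simps)
qed

lemma inner_le_weighted_squares:
  fixes x y :: "'a::real_inner"
  assumes "c > 0"
  shows "x \<bullet> y \<le> c / 2 * (norm x)\<^sup>2 + (norm y)\<^sup>2 / (2 * c)"
proof -
  have "0 \<le> (norm (c *\<^sub>R x - y))\<^sup>2" by simp
  also have "\<dots> = c\<^sup>2 * (norm x)\<^sup>2 - 2 * c * (x \<bullet> y) + (norm y)\<^sup>2"
    unfolding power2_norm_eq_inner by (simp add: inner_diff inner_commute algebra_simps power2_eq_square)
  finally have "2 * c * (x \<bullet> y) \<le> c\<^sup>2 * (norm x)\<^sup>2 + (norm y)\<^sup>2" by simp
  then show ?thesis using assms by (simp add: field_simps power2_eq_square)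
qed

lemma norm_diff_power2_le:
  fixes x y :: "'a::real_inner"
  shows "(norm (x - y))\<^sup>2 \<le> 2 * (norm x)\<^sup>2 + 2 * (norm y)\<^sup>2"
proof -
  have "0 \<le> (norm (x + y))\<^sup>2" by simp
  then show ?thesis unfolding power2_norm_eq_inner by (simp add: inner_diff inner_add inner_commute)
qed

text \<open>The right-hand side of one transformed equation without coupling.\<close>

definition component_field ::
  "('a::euclidean_space \<Rightarrow> 'a) \<Rightarrow> real \<Rightarrow> 'a \<Rightarrow> real \<Rightarrow> 'a \<Rightarrow> 'a" where
  "component_field h a b z x = transformed_drift h a b z x + z *\<^sub>R (a *\<^sub>R x + b)"

text \<open>The drift is \<open>h\<close> conjugated by the affine map \<open>x \<mapsto> e\<^bsup>az\<^esup> x + v\<close>. A similarity multiplies both sides of the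
one-sided Lipschitz inequality by the same factor, hence the constant of \<open>h\<close> survives.\<close>

lemma component_field_dissipative:
  assumes h: "\<And>x y. (x - y) \<bullet> (h x - h y) \<le> - L * (norm (x - y))\<^sup>2"
  shows "(x - y) \<bullet> (component_field h a b z x - component_field h a b z y)
     \<le> (- L + a * z) * (norm (x - y))\<^sup>2"
proof -
  define e where "e = exp (a * z)"
  define v where "v = (e - 1) *\<^sub>R (b /\<^sub>R a)"
  have e: "e > 0" "exp (- (a * z)) = 1 / e" by (auto simp: e_def exp_minus field_simps)
  define X Y where "X = e *\<^sub>R x + v" and "Y = e *\<^sub>R y + v"
  have XY: "X - Y = e *\<^sub>R (x - y)" by (simp add: X_def Y_def algebra_simps)
  have "(x - y) \<bullet> (h X - h Y) * e = (X - Y) \<bullet> (h X - h Y)" by (simp add: XY)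
  also have "\<dots> \<le> - L * (norm (X - Y))\<^sup>2" by (rule h)
  also have "\<dots> = (- L * e * (norm (x - y))\<^sup>2) * e"
    using e by (simp add: XY power_mult_distrib power2_eq_square)
  finally have "(x - y) \<bullet> (h X - h Y) \<le> - L * e * (norm (x - y))\<^sup>2"
    using e by (simp only: mult_le_cancel_right_pos)
  then have *: "(x - y) \<bullet> (h X - h Y) / e \<le> - L * (norm (x - y))\<^sup>2"
    using e by (simp add: pos_divide_le_eq algebra_simps)
  have "component_field h a b z x - component_field h a b z y
      = (1 / e) *\<^sub>R (h X - h Y) + (z * a) *\<^sub>R (x - y)"
    unfolding component_field_def transformed_drift_def e(2) X_def Y_def v_def e_def[symmetric]
    by (simp add: algebra_simps)
  then have "(x - y) \<bullet> (component_field h a b z x - component_field h a b z y)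
     = (x - y) \<bullet> (h X - h Y) / e + a * z * (norm (x - y))\<^sup>2"
    by (simp add: inner_add_right power2_norm_eq_inner)
  with * show ?thesis by (simp add: algebra_simps)
qed

lemma component_field_growth:
  fixes h :: "'a::euclidean_space \<Rightarrow> 'a"
  assumes "linear_growth h"
  shows "\<exists>C\<ge>0. \<exists>c\<ge>0. \<forall>z x. (norm (component_field h a b z x))\<^sup>2 \<le> C * (1 + (norm x)\<^sup>2) * exp (c * \<bar>z\<bar>)"
proof -
  obtain l M where l: "l > 0" "M > 0" "\<And>x. norm (h x) \<le> l * norm x + M"
    using assms unfolding linear_growth_def by blast
  define \<beta> where "\<beta> = norm (b /\<^sub>R a)"
  \<comment> \<open>Every coefficient that occurs below is at most \<open>D\<close>; one unit of \<open>c\<close> pays for the factor \<open>\<bar>z\<bar>\<close>.\<close>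
  define D where "D = l + 2 * l * \<beta> + M + \<bar>a\<bar> + norm b"
  define c where "c = \<bar>a\<bar> + 1"
  have \<beta>: "\<beta> \<ge> 0" by (simp add: \<beta>_def)
  have D0: "D \<ge> 0" using l \<beta> by (simp add: D_def)
  have bound: "norm (component_field h a b z x) \<le> D * (1 + norm x) * exp (c * \<bar>z\<bar>)" for z x
  proof -
    define e where "e = exp (c * \<bar>z\<bar>)"
    have e1: "1 \<le> e" by (simp add: e_def c_def)
    have "- (a * z) \<le> \<bar>a\<bar> * \<bar>z\<bar>" by (simp add: abs_le_D2 flip: abs_mult)
    also have "\<dots> \<le> c * \<bar>z\<bar>" by (simp add: c_def mult_right_mono)
    finally have ee: "exp (- (a * z)) \<le> e" by (simp add: e_def)
    have "\<bar>z\<bar> \<le> exp \<bar>z\<bar>" using exp_ge_add_one_self[of "\<bar>z\<bar>"] by linarith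
    also have "\<dots> \<le> e" by (simp add: e_def c_def algebra_simps)
    finally have ez: "\<bar>z\<bar> \<le> e" .
    have "norm (exp (a * z) *\<^sub>R x + (exp (a * z) - 1) *\<^sub>R (b /\<^sub>R a))
        \<le> exp (a * z) * norm x + (exp (a * z) + 1) * \<beta>"
    proof -
      have "norm ((exp (a * z) - 1) *\<^sub>R (b /\<^sub>R a)) = \<bar>exp (a * z) - 1\<bar> * \<beta>"
        unfolding \<beta>_def by (simp only: norm_scaleR)
      also have "\<dots> \<le> (exp (a * z) + 1) * \<beta>" using \<beta> by (intro mult_right_mono) (auto simp: abs_le_iff)
      finally have *: "norm ((exp (a * z) - 1) *\<^sub>R (b /\<^sub>R a)) \<le> (exp (a * z) + 1) * \<beta>" .
      show ?thesis by (rule norm_triangle_le, rule add_mono[OF _ *]) simp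
    qed
    then have "norm (h (exp (a * z) *\<^sub>R x + (exp (a * z) - 1) *\<^sub>R (b /\<^sub>R a)))
        \<le> l * (exp (a * z) * norm x + (exp (a * z) + 1) * \<beta>) + M"
      using l(1) by (intro order_trans[OF l(3)] add_mono mult_left_mono) auto
    then have "norm (transformed_drift h a b z x)
        \<le> exp (- (a * z)) * (l * (exp (a * z) * norm x + (exp (a * z) + 1) * \<beta>) + M)"
      unfolding transformed_drift_def by simp
    also have "\<dots> = l * norm x + l * \<beta> + exp (- (a * z)) * (l * \<beta> + M)"
      by (simp add: exp_minus field_simps)
    also have "\<dots> \<le> l * norm x * e + l * \<beta> * e + e * (l * \<beta> + M)"
    proof (intro add_mono)
      show "l * norm x \<le> l * norm x * e" "l * \<beta> \<le> l * \<beta> * e"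
        using l \<beta> mult_left_mono[OF e1, of "l * norm x"] mult_left_mono[OF e1, of "l * \<beta>"] by simp_all
      show "exp (- (a * z)) * (l * \<beta> + M) \<le> e * (l * \<beta> + M)"
        using l \<beta> ee by (intro mult_right_mono) auto
    qed
    also have "\<dots> = (l * norm x + 2 * l * \<beta> + M) * e" by (simp add: algebra_simps)
    finally have 1: "norm (transformed_drift h a b z x) \<le> (l * norm x + 2 * l * \<beta> + M) * e" .
    have "norm (z *\<^sub>R (a *\<^sub>R x + b)) \<le> \<bar>z\<bar> * (\<bar>a\<bar> * norm x + norm b)"
      using norm_triangle_ineq[of "a *\<^sub>R x" b] by (auto intro!: mult_left_mono)
    also have "\<dots> \<le> e * (\<bar>a\<bar> * norm x + norm b)" using ez by (intro mult_right_mono) auto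
    finally have "norm (component_field h a b z x)
        \<le> (l * norm x + 2 * l * \<beta> + M) * e + e * (\<bar>a\<bar> * norm x + norm b)"
      unfolding component_field_def using 1 norm_triangle_mono by blast
    also have "\<dots> = (l * norm x + 2 * l * \<beta> + M + \<bar>a\<bar> * norm x + norm b) * e" by (simp add: algebra_simps)
    also have "\<dots> \<le> D * (1 + norm x) * e"
    proof (rule mult_right_mono)
      have "0 \<le> (2 * l * \<beta> + M + norm b) * norm x + (l + \<bar>a\<bar>)" using l \<beta> by simp
      then show "l * norm x + 2 * l * \<beta> + M + \<bar>a\<bar> * norm x + norm b \<le> D * (1 + norm x)"
        by (simp add: D_def algebra_simps)
    qed (use e1 in auto)
    finally show ?thesis by (simp add: e_def)
  qed
  have "(norm (component_field h a b z x))\<^sup>2 \<le> 2 * D\<^sup>2 * (1 + (norm x)\<^sup>2) * exp (2 * c * \<bar>z\<bar>)" for z x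
  proof -
    have "(norm (component_field h a b z x))\<^sup>2 \<le> (D * (1 + norm x) * exp (c * \<bar>z\<bar>))\<^sup>2"
      using bound by (intro power_mono) auto
    also have "\<dots> = D\<^sup>2 * (1 + norm x)\<^sup>2 * exp (2 * c * \<bar>z\<bar>)"
      by (simp add: power_mult_distrib power2_eq_square mult_ac flip: exp_add)
    also have "\<dots> \<le> D\<^sup>2 * (2 * (1 + (norm x)\<^sup>2)) * exp (2 * c * \<bar>z\<bar>)"
    proof (intro mult_right_mono mult_left_mono)
      have "0 \<le> (1 - norm x)\<^sup>2" by simp
      then show "(1 + norm x)\<^sup>2 \<le> 2 * (1 + (norm x)\<^sup>2)" by (simp add: power2_eq_square algebra_simps)
    qed auto
    finally show ?thesis by (simp add: algebra_simps)
  qed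
  moreover have "0 \<le> 2 * D\<^sup>2" "0 \<le> 2 * c" by (auto simp: c_def)
  ultimately show ?thesis by blast
qed

text \<open>Gronwall's inequality with initial time \<open>-\<infinity>\<close>. The initial value only has to be small, after
discounting by \<open>exp (- \<Lambda>)\<close>, at some arbitrarily early times; this weak form is what a solution that is
merely recurrent provides.\<close>

lemma gronwall_from_minus_infinity:
  fixes E \<Lambda> q :: "real \<Rightarrow> real"
  assumes E: "\<And>t. t \<le> T \<Longrightarrow> (E has_real_derivative E' t) (at t)"
    and \<Lambda>: "\<And>t. t \<le> T \<Longrightarrow> (\<Lambda> has_real_derivative \<mu> t) (at t)"
    and le: "\<And>t. t \<le> T \<Longrightarrow> E' t \<le> \<mu> t * E t + q t"
    and q: "\<And>t. t \<le> T \<Longrightarrow> q t * exp (- \<Lambda> t) \<le> A * exp (\<gamma> * t)"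
    and \<gamma>: "\<gamma> > 0" and "A \<ge> 0"
    and small: "\<And>\<delta>. \<delta> > 0 \<Longrightarrow> \<exists>\<^sub>F s in at_bot. E s * exp (- \<Lambda> s) \<le> \<delta>"
    and "t \<le> T"
  shows "E t \<le> A / \<gamma> * exp (\<gamma> * t + \<Lambda> t)"
proof -
  define Y where "Y s = E s * exp (- \<Lambda> s)" for s
  have "Y t \<le> A / \<gamma> * exp (\<gamma> * t) + \<delta>" if "\<delta> > 0" for \<delta>
  proof -
    from small[OF that] obtain s where s: "s \<le> t" "Y s \<le> \<delta>"
      unfolding Y_def by (auto simp: frequently_def eventually_at_bot_linorder)
    have "Y t - Y s \<le> A / \<gamma> * exp (\<gamma> * t) - A / \<gamma> * exp (\<gamma> * s)"
    proof (rule increment_le_of_derivative_le[OF s(1)])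
      fix r assume r: "s \<le> r" "r \<le> t"
      then have "r \<le> T" using \<open>t \<le> T\<close> by simp
      show "(Y has_real_derivative (E' r - \<mu> r * E r) * exp (- \<Lambda> r)) (at r)"
        unfolding Y_def using E \<Lambda> \<open>r \<le> T\<close> by (auto intro!: derivative_eq_intros simp: algebra_simps)
      show "((\<lambda>s. A / \<gamma> * exp (\<gamma> * s)) has_real_derivative A * exp (\<gamma> * r)) (at r)"
        using \<gamma> by (auto intro!: derivative_eq_intros)
      have "(E' r - \<mu> r * E r) * exp (- \<Lambda> r) \<le> q r * exp (- \<Lambda> r)"
        using le[OF \<open>r \<le> T\<close>] by (intro mult_right_mono) auto
      also have "\<dots> \<le> A * exp (\<gamma> * r)" by (rule q[OF \<open>r \<le> T\<close>])
      finally show "(E' r - \<mu> r * E r) * exp (- \<Lambda> r) \<le> A * exp (\<gamma> * r)" .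
    qed
    moreover have "0 \<le> A / \<gamma> * exp (\<gamma> * s)" using \<gamma> \<open>A \<ge> 0\<close> by simp
    ultimately show ?thesis using s by linarith
  qed
  then have "Y t \<le> A / \<gamma> * exp (\<gamma> * t)" by (rule field_le_epsilon)
  then have "Y t * exp (\<Lambda> t) \<le> A / \<gamma> * exp (\<gamma> * t) * exp (\<Lambda> t)" by (intro mult_right_mono) auto
  then show ?thesis by (simp add: Y_def mult.assoc flip: exp_add)
qed

section \<open>Synchronization along a single noise path\<close>

text \<open>Sublinear growth towards \<open>-\<infinity>\<close>, uniform on each half line \<open>(-\<infinity>, T]\<close>. For negative \<open>t\<close> the bound is
\<open>C + \<epsilon> \<bar>t\<bar>\<close>; writing \<open>- \<epsilon> * t\<close> avoids a case distinction at \<open>0\<close>, at the price of the constant \<open>C\<close> that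
depends on \<open>T\<close>.\<close>

definition slowly_growing :: "(real \<Rightarrow> real) \<Rightarrow> bool" where
  "slowly_growing f \<longleftrightarrow> (\<forall>\<epsilon>>0. \<forall>T. \<exists>C. \<forall>t\<le>T. \<bar>f t\<bar> \<le> C - \<epsilon> * t)"

lemma slowly_growing_of_sublinear:
  assumes cont: "continuous_on UNIV f" and sub: "((\<lambda>t. f t / t) \<longlongrightarrow> 0) at_bot"
  shows "slowly_growing f"
  unfolding slowly_growing_def
proof (intro allI impI)
  fix \<epsilon> T :: real assume "\<epsilon> > 0"
  obtain S where S: "S < -1" "\<And>t. t \<le> S \<Longrightarrow> \<bar>f t\<bar> \<le> \<epsilon> * \<bar>t\<bar>"
    using sublinear_at_bot_bound[OF sub \<open>\<epsilon> > 0\<close>] by auto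
  have "bounded (f ` {S..T})"
    by (intro compact_imp_bounded compact_continuous_image continuous_on_subset[OF cont]) auto
  then obtain K where K: "\<forall>t\<in>{S..T}. \<bar>f t\<bar> \<le> K" by (auto simp: bounded_iff)
  show "\<exists>C. \<forall>t\<le>T. \<bar>f t\<bar> \<le> C - \<epsilon> * t"
  proof (intro exI[of _ "\<bar>K\<bar> + \<epsilon> * \<bar>T\<bar>"] allI impI)
    fix t assume "t \<le> T"
    then have "\<epsilon> * t \<le> \<epsilon> * \<bar>T\<bar>" using \<open>\<epsilon> > 0\<close> by (intro mult_left_mono) auto
    moreover have "\<bar>f t\<bar> \<le> \<bar>K\<bar> \<or> \<bar>f t\<bar> \<le> - (\<epsilon> * t)"
    proof (cases "t \<le> S")
      case True then show ?thesis using S(2)[of t] S(1) by auto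
    next
      case False then show ?thesis using K[rule_format, of t] \<open>t \<le> T\<close> by auto
    qed
    moreover have "0 \<le> \<epsilon> * \<bar>T\<bar>" using \<open>\<epsilon> > 0\<close> by simp
    ultimately show "\<bar>f t\<bar> \<le> \<bar>K\<bar> + \<epsilon> * \<bar>T\<bar> - \<epsilon> * t" by linarith
  qed
qed

lemma slowly_growingD:
  assumes "slowly_growing f" "\<epsilon> > 0"
  obtains C where "\<And>t. t \<le> T \<Longrightarrow> \<bar>f t\<bar> \<le> C - \<epsilon> * t"
  using assms unfolding slowly_growing_def by blast

lemma slowly_growing_cmult: "slowly_growing f \<Longrightarrow> slowly_growing (\<lambda>t. c * f t)"
  unfolding slowly_growing_def
proof (intro allI impI)
  fix \<epsilon> T :: real
  assume f: "\<forall>\<epsilon>>0. \<forall>T. \<exists>C. \<forall>t\<le>T. \<bar>f t\<bar> \<le> C - \<epsilon> * t" and "\<epsilon> > 0"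
  define e where "e = \<epsilon> / (\<bar>c\<bar> + 1)"
  have "e > 0" using \<open>\<epsilon> > 0\<close> unfolding e_def by (intro divide_pos_pos) auto
  then obtain C where C: "\<And>t. t \<le> T \<Longrightarrow> \<bar>f t\<bar> \<le> C - e * t" using f by blast
  show "\<exists>C. \<forall>t\<le>T. \<bar>c * f t\<bar> \<le> C - \<epsilon> * t"
  proof (intro exI allI impI)
    fix t assume "t \<le> T"
    have "\<bar>c * f t\<bar> \<le> (\<bar>c\<bar> + 1) * \<bar>f t\<bar>" by (simp add: abs_mult mult_right_mono)
    also have "\<dots> \<le> (\<bar>c\<bar> + 1) * (C - e * t)" using C[OF \<open>t \<le> T\<close>] by (intro mult_left_mono) auto
    also have "\<dots> = (\<bar>c\<bar> + 1) * C - (\<bar>c\<bar> + 1) * e * t" by (simp only: right_diff_distrib mult.assoc)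
    also have "(\<bar>c\<bar> + 1) * e = \<epsilon>" by (simp add: e_def add_nonneg_eq_0_iff)
    finally show "\<bar>c * f t\<bar> \<le> (\<bar>c\<bar> + 1) * C - \<epsilon> * t" .
  qed
qed

lemma slowly_growing_add: "slowly_growing f \<Longrightarrow> slowly_growing g \<Longrightarrow> slowly_growing (\<lambda>t. f t + g t)"
  unfolding slowly_growing_def
proof (intro allI impI)
  fix \<epsilon> T :: real
  assume f: "\<forall>\<epsilon>>0. \<forall>T. \<exists>C. \<forall>t\<le>T. \<bar>f t\<bar> \<le> C - \<epsilon> * t"
    and g: "\<forall>\<epsilon>>0. \<forall>T. \<exists>C. \<forall>t\<le>T. \<bar>g t\<bar> \<le> C - \<epsilon> * t" and "\<epsilon> > 0"
  from \<open>\<epsilon> > 0\<close> have "\<epsilon>/2 > 0" by simp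
  obtain C where C: "\<And>t. t \<le> T \<Longrightarrow> \<bar>f t\<bar> \<le> C - \<epsilon>/2 * t" using f \<open>\<epsilon>/2 > 0\<close> by blast
  obtain D where D: "\<And>t. t \<le> T \<Longrightarrow> \<bar>g t\<bar> \<le> D - \<epsilon>/2 * t" using g \<open>\<epsilon>/2 > 0\<close> by blast
  show "\<exists>C. \<forall>t\<le>T. \<bar>f t + g t\<bar> \<le> C - \<epsilon> * t"
  proof (intro exI allI impI)
    fix t assume "t \<le> T"
    then show "\<bar>f t + g t\<bar> \<le> C + D - \<epsilon> * t" using C[of t] D[of t] abs_triangle_ineq[of "f t" "g t"] by argo
  qed
qed

lemma eventually_exp_le_at_bot:
  fixes c C \<delta> :: real
  assumes "c > 0" "\<delta> > 0"
  shows "\<forall>\<^sub>F s in at_bot. C * exp (c * s) \<le> \<delta>"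
proof -
  have "((\<lambda>s. C * exp (c * s)) \<longlongrightarrow> 0) at_bot" using \<open>c > 0\<close> by real_asymp
  from order_tendstoD(2)[OF this \<open>\<delta> > 0\<close>] show ?thesis by eventually_elim simp
qed

text \<open>What the comparison of \<open>(U, V)\<close> with \<open>(W, W)\<close> needs to know about the two fields and about one noise
path. \<open>N1\<close> and \<open>N2\<close> encode the vanishing time averages of the noise, \<open>Q\<close> and \<open>K\<close> the bounded time
averages of the squared difference of the rates.\<close>

locale synchronization_data =
  fixes F1 F2 :: "real \<Rightarrow> 'a::euclidean_space \<Rightarrow> 'a" and O1 O2 N1 N2 Q :: "real \<Rightarrow> real"
    and a1 a2 L C c K :: real
  assumes L: "L > 0"
    and diss1: "\<And>z x y. (x - y) \<bullet> (F1 z x - F1 z y) \<le> (- L + a1 * z) * (norm (x - y))\<^sup>2"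
    and diss2: "\<And>z x y. (x - y) \<bullet> (F2 z x - F2 z y) \<le> (- L + a2 * z) * (norm (x - y))\<^sup>2"
    and C: "C \<ge> 0"
    and growth1: "\<And>z x. (norm (F1 z x))\<^sup>2 \<le> C * (1 + (norm x)\<^sup>2) * exp (c * \<bar>z\<bar>)"
    and growth2: "\<And>z x. (norm (F2 z x))\<^sup>2 \<le> C * (1 + (norm x)\<^sup>2) * exp (c * \<bar>z\<bar>)"
    and N1: "\<And>t. (N1 has_real_derivative O1 t) (at t)"
    and N2: "\<And>t. (N2 has_real_derivative O2 t) (at t)"
    and slow: "slowly_growing O1" "slowly_growing O2" "slowly_growing N1" "slowly_growing N2"
    and Q: "\<And>t. (Q has_real_derivative (a1 * O1 t - a2 * O2 t)\<^sup>2) (at t)"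
    and Q_bound: "\<And>t. t \<le> 0 \<Longrightarrow> Q 0 - Q t \<le> K * (1 - t)"
begin

lemma field_growth_along_noise:
  assumes "\<eta> > 0"
  obtains D where "D \<ge> 0" "\<And>t x. t \<le> T \<Longrightarrow>
    (norm (F1 (O1 t) x))\<^sup>2 + (norm (F2 (O2 t) x))\<^sup>2 \<le> D * (1 + (norm x)\<^sup>2) * exp (- \<eta> * t)"
proof -
  obtain C1 where C1: "\<And>t. t \<le> T \<Longrightarrow> \<bar>c * O1 t\<bar> \<le> C1 - \<eta> * t"
    using slowly_growingD[OF slowly_growing_cmult[OF slow(1)] assms] by blast
  obtain C2 where C2: "\<And>t. t \<le> T \<Longrightarrow> \<bar>c * O2 t\<bar> \<le> C2 - \<eta> * t"
    using slowly_growingD[OF slowly_growing_cmult[OF slow(2)] assms] by blast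
  have e: "exp (c * \<bar>z\<bar>) \<le> exp K * exp (- \<eta> * t)" if "\<bar>c * z\<bar> \<le> K - \<eta> * t" for z K t
  proof -
    have "c * \<bar>z\<bar> \<le> \<bar>c * z\<bar>" by (simp add: abs_mult mult_right_mono)
    with that show ?thesis by (simp flip: exp_add)
  qed
  show ?thesis
  proof
    show "0 \<le> C * (exp C1 + exp C2)" using C by simp
    fix t x assume t: "t \<le> T"
    have "(norm (F1 (O1 t) x))\<^sup>2 + (norm (F2 (O2 t) x))\<^sup>2
      \<le> C * (1 + (norm x)\<^sup>2) * exp (c * \<bar>O1 t\<bar>) + C * (1 + (norm x)\<^sup>2) * exp (c * \<bar>O2 t\<bar>)"
      by (intro add_mono growth1 growth2)
    also have "\<dots> \<le> C * (1 + (norm x)\<^sup>2) * (exp C1 * exp (- \<eta> * t)) + C * (1 + (norm x)\<^sup>2) * (exp C2 * exp (- \<eta> * t))"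
      using C by (intro add_mono mult_left_mono e C1 C2 t mult_nonneg_nonneg) auto
    also have "\<dots> = C * (exp C1 + exp C2) * (1 + (norm x)\<^sup>2) * exp (- \<eta> * t)" by (simp add: algebra_simps)
    finally show "(norm (F1 (O1 t) x))\<^sup>2 + (norm (F2 (O2 t) x))\<^sup>2
      \<le> C * (exp C1 + exp C2) * (1 + (norm x)\<^sup>2) * exp (- \<eta> * t)" .
  qed
qed

lemma noise_potential_bound:
  assumes "\<eta> > 0"
  obtains D where "\<And>t. t \<le> T \<Longrightarrow> \<bar>a1 * N1 t + a2 * N2 t\<bar> \<le> D - \<eta> * t"
  using slowly_growingD[OF slowly_growing_add[OF slowly_growing_cmult[OF slow(3)] slowly_growing_cmult[OF slow(4)]] assms]
  by blast

context
  fixes W :: "real \<Rightarrow> 'a"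
  assumes W: "\<And>t. (W has_vector_derivative (1/2) *\<^sub>R (F1 (O1 t) (W t) + F2 (O2 t) (W t))) (at t)"
    and W_recurrent: "\<And>\<epsilon>. \<epsilon> > 0 \<Longrightarrow> \<exists>\<^sub>F s in at_bot. norm (W s) \<le> exp (- \<epsilon> * s)"
begin

text \<open>The averaged field has rate \<open>- L + (a1 * O1 + a2 * O2) / 2\<close>, whose antiderivative is \<open>- L * t\<close> up to slow
growth. A Gronwall estimate from \<open>-\<infinity>\<close> therefore upgrades smallness at some early times to
exponential growth at an arbitrarily small rate.\<close>

lemma averaged_solution_growth:
  assumes "0 < \<epsilon>" "\<epsilon> \<le> L"
  obtains D where "D \<ge> 0" "\<And>t. t \<le> T \<Longrightarrow> (norm (W t))\<^sup>2 \<le> D * exp (- \<epsilon> * t)"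
proof -
  \<comment> \<open>Slow growth is spent three times: in the inhomogeneity and in both directions of \<open>\<Lambda>\<close>.\<close>
  define \<eta> where "\<eta> = \<epsilon> / 3"
  have \<eta>: "\<eta> > 0" "3 * \<eta> \<le> L" using assms by (auto simp: \<eta>_def)
  obtain D where D: "D \<ge> 0" "\<And>t x. t \<le> T \<Longrightarrow>
      (norm (F1 (O1 t) x))\<^sup>2 + (norm (F2 (O2 t) x))\<^sup>2 \<le> D * (1 + (norm x)\<^sup>2) * exp (- \<eta> * t)"
    using field_growth_along_noise[OF \<eta>(1), of T] by blast
  obtain B where B: "\<And>t. t \<le> T \<Longrightarrow> \<bar>a1 * N1 t + a2 * N2 t\<bar> \<le> B - \<eta> * t"
    using noise_potential_bound[OF \<eta>(1), of T] by blast
  define \<Lambda> where "\<Lambda> t = - L * t + (a1 * N1 t + a2 * N2 t)" for t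
  define q where "q t = ((norm (F1 (O1 t) 0))\<^sup>2 + (norm (F2 (O2 t) 0))\<^sup>2) / (2 * L)" for t
  \<comment> \<open>Here \<open>E'\<close> is the derivative of the squared norm: the factor 2 cancels against the mean of the two fields.\<close>
  define E' where "E' t = W t \<bullet> F1 (O1 t) (W t) + W t \<bullet> F2 (O2 t) (W t)" for t
  have \<Lambda>_low: "exp (- \<Lambda> t) \<le> exp B * exp ((L - \<eta>) * t)" if "t \<le> T" for t
    using B[OF that] by (simp add: \<Lambda>_def algebra_simps flip: exp_add)
  have main: "(norm (W t))\<^sup>2 \<le> D * exp B / (2 * L) / (L - 2 * \<eta>) * exp ((L - 2 * \<eta>) * t + \<Lambda> t)"
    if "t \<le> T" for t
  proof (rule gronwall_from_minus_infinity[where E' = E' and q = q and T = T and \<mu> = "\<lambda>t. - L + (a1 * O1 t + a2 * O2 t)"])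
    fix t assume t: "t \<le> T"
    show "((\<lambda>t. (norm (W t))\<^sup>2) has_real_derivative E' t) (at t)"
      using has_real_derivative_norm_power2[OF W[of t]] by (simp add: E'_def inner_add_right add_divide_distrib)
    show "(\<Lambda> has_real_derivative - L + (a1 * O1 t + a2 * O2 t)) (at t)"
      unfolding \<Lambda>_def by (auto intro!: derivative_eq_intros N1 N2)
    have "W t \<bullet> F (W t) \<le> (- L / 2 + z) * (norm (W t))\<^sup>2 + (norm (F 0))\<^sup>2 / (2 * L)"
      if "(W t - 0) \<bullet> (F (W t) - F 0) \<le> (- L + z) * (norm (W t - 0))\<^sup>2" for F :: "'a \<Rightarrow> 'a" and z
      using that inner_le_weighted_squares[OF L, of "W t" "F 0"] by (simp add: inner_diff_right algebra_simps)
    from this[OF diss1[of "W t" 0 "O1 t"]] this[OF diss2[of "W t" 0 "O2 t"]]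
    show "E' t \<le> (- L + (a1 * O1 t + a2 * O2 t)) * (norm (W t))\<^sup>2 + q t"
      by (simp add: E'_def q_def algebra_simps add_divide_distrib)
    have "q t \<le> D * exp (- \<eta> * t) / (2 * L)"
      unfolding q_def using D(2)[OF t, of 0] L by (intro divide_right_mono) auto
    then have "q t * exp (- \<Lambda> t) \<le> D * exp (- \<eta> * t) / (2 * L) * (exp B * exp ((L - \<eta>) * t))"
      using \<Lambda>_low[OF t] D(1) L by (intro mult_mono) auto
    also have "\<dots> = D * exp B / (2 * L) * exp ((L - 2 * \<eta>) * t)"
      by (simp add: algebra_simps flip: exp_add)
    finally show "q t * exp (- \<Lambda> t) \<le> D * exp B / (2 * L) * exp ((L - 2 * \<eta>) * t)" .
  next
    fix \<delta> :: real assume "\<delta> > 0"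
    have "L / 4 > 0" "L - \<eta> - L / 2 > 0" using L \<eta> by auto
    from eventually_exp_le_at_bot[OF this(2) \<open>\<delta> > 0\<close>]
    have "\<forall>\<^sub>F s in at_bot. exp B * exp ((L - \<eta> - L / 2) * s) \<le> \<delta>" .
    from frequently_eventually_conj[OF W_recurrent[OF \<open>L/4 > 0\<close>]
        eventually_conj[OF this eventually_le_at_bot[of T]]]
    show "\<exists>\<^sub>F s in at_bot. (norm (W s))\<^sup>2 * exp (- \<Lambda> s) \<le> \<delta>"
    proof (rule frequently_elim1)
      fix s assume s: "(exp B * exp ((L - \<eta> - L / 2) * s) \<le> \<delta> \<and> s \<le> T) \<and> norm (W s) \<le> exp (- (L / 4) * s)"
      have "(norm (W s))\<^sup>2 \<le> (exp (- (L / 4) * s))\<^sup>2" using s by (intro power_mono) auto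
      also have "\<dots> = exp (- L / 2 * s)" by (simp add: power2_eq_square flip: exp_add)
      finally have "(norm (W s))\<^sup>2 * exp (- \<Lambda> s) \<le> exp (- L / 2 * s) * (exp B * exp ((L - \<eta>) * s))"
        using \<Lambda>_low s by (intro mult_mono) auto
      also have "\<dots> = exp B * exp ((L - \<eta> - L / 2) * s)" by (simp add: algebra_simps flip: exp_add)
      finally show "(norm (W s))\<^sup>2 * exp (- \<Lambda> s) \<le> \<delta>" using s by linarith
    qed
  qed (use that L \<eta> D in auto)
  define A where "A = D * exp B / (2 * L) / (L - 2 * \<eta>)"
  have A: "A \<ge> 0" unfolding A_def using D L \<eta> by auto
  show ?thesis
  proof
    show "A * exp B \<ge> 0" using A by simp
    fix t assume t: "t \<le> T"
    have "(norm (W t))\<^sup>2 \<le> A * exp ((L - 2 * \<eta>) * t + \<Lambda> t)" unfolding A_def by (rule main[OF t])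
    also have "\<dots> \<le> A * exp (B - \<epsilon> * t)"
    proof (intro mult_left_mono A)
      have "\<Lambda> t \<le> - L * t + (B - \<eta> * t)" using B[OF t] by (simp add: \<Lambda>_def)
      then have "(L - 2 * \<eta>) * t + \<Lambda> t \<le> B - (3 * \<eta>) * t" by (simp add: algebra_simps)
      then show "exp ((L - 2 * \<eta>) * t + \<Lambda> t) \<le> exp (B - \<epsilon> * t)" by (simp add: \<eta>_def)
    qed
    also have "\<dots> = A * exp B * exp (- \<epsilon> * t)" by (simp flip: exp_add)
    finally show "(norm (W t))\<^sup>2 \<le> A * exp B * exp (- \<epsilon> * t)" .
  qed
qed

text \<open>The heart of the argument. With \<open>d = a1 * z1 - a2 * z2\<close> the weighted sum of squares splits as
\<open>a1 z1 \<parallel>u\<parallel>\<^sup>2 + a2 z2 \<parallel>v\<parallel>\<^sup>2 = (a1 z1 + a2 z2) / 2 (\<parallel>u\<parallel>\<^sup>2 + \<parallel>v\<parallel>\<^sup>2) + (u - v) \<bullet> (d / 2) (u + v)\<close>, and the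
defects of \<open>W\<close> in the two equations are opposite, so that they too are paired with \<open>u - v\<close>. In half of the derivative of the error,
the coupling contributes \<open>- \<kappa> \<parallel>u - v\<parallel>\<^sup>2\<close>, of which each of the two pairings takes one half by Young's inequality.\<close>

lemma error_dissipation:
  fixes \<kappa> z1 z2 :: real and U V w :: 'a
  assumes "\<kappa> > 0"
  defines "w' \<equiv> (1/2) *\<^sub>R (F1 z1 w + F2 z2 w)"
  shows "2 * ((U - w) \<bullet> (F1 z1 U + \<kappa> *\<^sub>R (V - U) - w')) + 2 * ((V - w) \<bullet> (F2 z2 V + \<kappa> *\<^sub>R (U - V) - w'))
    \<le> (- 2 * L + (a1 * z1 + a2 * z2) + (a1 * z1 - a2 * z2)\<^sup>2 / (2 * \<kappa>)) * ((norm (U - w))\<^sup>2 + (norm (V - w))\<^sup>2)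
      + ((norm (F1 z1 w))\<^sup>2 + (norm (F2 z2 w))\<^sup>2) / (2 * \<kappa>)"
proof -
  define u v where "u = U - w" and "v = V - w"
  define G where "G = (1/2) *\<^sub>R (F1 z1 w - F2 z2 w)"
  define d where "d = a1 * z1 - a2 * z2"
  define E where "E = (norm u)\<^sup>2 + (norm v)\<^sup>2"
  have UV: "V - U = v - u" "U - V = u - v" by (simp_all add: u_def v_def)
  have G1: "F1 z1 w - w' = G" and G2: "F2 z2 w - w' = - G"
    unfolding G_def w'_def by (simp_all add: algebra_simps flip: scaleR_2)
  have "u \<bullet> (F1 z1 U + \<kappa> *\<^sub>R (V - U) - w') + v \<bullet> (F2 z2 V + \<kappa> *\<^sub>R (U - V) - w')
    = u \<bullet> (F1 z1 U - F1 z1 w) + v \<bullet> (F2 z2 V - F2 z2 w)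
      + u \<bullet> (F1 z1 w - w') + v \<bullet> (F2 z2 w - w') + \<kappa> * (u \<bullet> (v - u) + v \<bullet> (u - v))"
    unfolding UV by (simp add: inner_diff_right inner_add_right algebra_simps)
  also have "u \<bullet> (v - u) + v \<bullet> (u - v) = - (norm (u - v))\<^sup>2"
    unfolding power2_norm_eq_inner by (simp add: inner_diff inner_commute)
  also have "u \<bullet> (F1 z1 U - F1 z1 w) + v \<bullet> (F2 z2 V - F2 z2 w)
      + u \<bullet> (F1 z1 w - w') + v \<bullet> (F2 z2 w - w')
    = u \<bullet> (F1 z1 U - F1 z1 w) + v \<bullet> (F2 z2 V - F2 z2 w) + (u - v) \<bullet> G"
    unfolding G1 G2 by (simp add: inner_diff)
  also have "\<dots> + \<kappa> * - (norm (u - v))\<^sup>2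
    \<le> ((- L + a1 * z1) * (norm u)\<^sup>2 + (- L + a2 * z2) * (norm v)\<^sup>2) 
      + (\<kappa> / 2 * (norm (u - v))\<^sup>2 + (norm G)\<^sup>2 / (2 * \<kappa>)) - \<kappa> * (norm (u - v))\<^sup>2"
    using diss1[of U w z1] diss2[of V w z2] inner_le_weighted_squares[OF \<open>\<kappa> > 0\<close>, of "u - v" G]
    unfolding u_def v_def by linarith
  also have "\<dots> = (- L + (a1 * z1 + a2 * z2) / 2) * E + (u - v) \<bullet> ((d / 2) *\<^sub>R (u + v))
      + (norm G)\<^sup>2 / (2 * \<kappa>) - \<kappa> / 2 * (norm (u - v))\<^sup>2"
  proof -
    have "(u - v) \<bullet> ((d / 2) *\<^sub>R (u + v)) = d / 2 * ((norm u)\<^sup>2 - (norm v)\<^sup>2)"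
      unfolding power2_norm_eq_inner by (simp add: inner_diff inner_add inner_commute)
    then show ?thesis by (simp add: E_def d_def field_simps)
  qed
  also have "\<dots> \<le> (- L + (a1 * z1 + a2 * z2) / 2) * E
      + (norm ((d / 2) *\<^sub>R (u + v)))\<^sup>2 / (2 * \<kappa>) + (norm G)\<^sup>2 / (2 * \<kappa>)"
    using inner_le_weighted_squares[OF \<open>\<kappa> > 0\<close>, of "u - v" "(d / 2) *\<^sub>R (u + v)"] by linarith
  also have "\<dots> \<le> (- L + (a1 * z1 + a2 * z2) / 2) * E
      + (d\<^sup>2 / 2 * E) / (2 * \<kappa>) + (((norm (F1 z1 w))\<^sup>2 + (norm (F2 z2 w))\<^sup>2) / 2) / (2 * \<kappa>)"
  proof -
    have par: "(norm (x + y))\<^sup>2 \<le> 2 * ((norm x)\<^sup>2 + (norm y)\<^sup>2)" for x y :: 'a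
      using norm_diff_power2_le[of x "- y"] by simp
    have "(norm ((d / 2) *\<^sub>R (u + v)))\<^sup>2 = d\<^sup>2 / 4 * (norm (u + v))\<^sup>2"
      by (simp add: power_mult_distrib power_divide)
    also have "\<dots> \<le> d\<^sup>2 / 4 * (2 * E)" unfolding E_def by (intro mult_left_mono par) auto
    finally have 1: "(norm ((d / 2) *\<^sub>R (u + v)))\<^sup>2 \<le> d\<^sup>2 / 2 * E" by (simp only: times_divide_eq_left times_divide_eq_right)
    have "(norm G)\<^sup>2 = 1/4 * (norm (F1 z1 w + - F2 z2 w))\<^sup>2"
      unfolding G_def by (simp add: power_mult_distrib power_divide)
    also have "\<dots> \<le> 1/4 * (2 * ((norm (F1 z1 w))\<^sup>2 + (norm (- F2 z2 w))\<^sup>2))" by (intro mult_left_mono par) auto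
    finally have 2: "(norm G)\<^sup>2 \<le> ((norm (F1 z1 w))\<^sup>2 + (norm (F2 z2 w))\<^sup>2) / 2" by simp
    show ?thesis using 1 2 \<open>\<kappa> > 0\<close> by (intro add_mono divide_right_mono) auto
  qed
  finally have half: "u \<bullet> (F1 z1 U + \<kappa> *\<^sub>R (V - U) - w') + v \<bullet> (F2 z2 V + \<kappa> *\<^sub>R (U - V) - w')
    \<le> (- L + (a1 * z1 + a2 * z2) / 2) * E
      + (d\<^sup>2 / 2 * E) / (2 * \<kappa>) + (((norm (F1 z1 w))\<^sup>2 + (norm (F2 z2 w))\<^sup>2) / 2) / (2 * \<kappa>)" .
  have "2 * ((- L + s / 2) * E + (d\<^sup>2 / 2 * E) / (2 * \<kappa>) + (g / 2) / (2 * \<kappa>))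
    = (- 2 * L + s + d\<^sup>2 / (2 * \<kappa>)) * E + g / (2 * \<kappa>)" for s g
    by (simp add: algebra_simps)
  with half show ?thesis
    unfolding u_def[symmetric] v_def[symmetric] E_def[symmetric] d_def[symmetric]
    by (metis (no_types) distrib_left mult_left_mono zero_le_numeral)
qed

lemma Q_mono: "s \<le> t \<Longrightarrow> Q s \<le> Q t"
  by (rule DERIV_nonneg_imp_nondecreasing) (use Q zero_le_power2 in blast)+

lemma Q_bound_below:
  assumes "t \<le> T"
  shows "Q 0 - Q t \<le> \<bar>K\<bar> * (1 - t + 2 * \<bar>T\<bar>)"
proof (cases "t \<le> 0")
  case True
  then have "Q 0 - Q t \<le> K * (1 - t)" by (rule Q_bound)
  also have "\<dots> \<le> \<bar>K\<bar> * (1 - t)" using True by (intro mult_right_mono) auto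
  also have "\<dots> \<le> \<bar>K\<bar> * (1 - t + 2 * \<bar>T\<bar>)" by (intro mult_left_mono) auto
  finally show ?thesis .
next
  case False
  then have "Q 0 \<le> Q t"
    by (intro Q_mono) simp
  moreover have "0 \<le> \<bar>K\<bar> * (1 - t + 2 * \<bar>T\<bar>)" using assms by (intro mult_nonneg_nonneg) auto
  ultimately show ?thesis by linarith
qed

text \<open>For \<open>\<kappa> \<ge> \<bar>K\<bar> / L\<close> the term \<open>d\<^sup>2 / (2 \<kappa>)\<close> costs at most \<open>L / 2\<close> of the averaged rate \<open>2 L\<close>. The choice
\<open>\<eta> = L / 6\<close> leaves the rate \<open>3 L / 2 - 3 \<eta> = L\<close> after the growth of the noise, at rate \<open>\<eta>\<close>, and of
the defect, at rate \<open>2 \<eta>\<close>, has been paid for. The constants do not depend on \<open>\<kappa>\<close>, and the defect carries the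
factor \<open>1 / \<kappa>\<close>.\<close>

lemma synchronization_rate:
  fixes U V :: "real \<Rightarrow> real \<Rightarrow> 'a"
  assumes U: "\<And>\<kappa> t. \<kappa> \<ge> 1 \<Longrightarrow>
      (U \<kappa> has_vector_derivative F1 (O1 t) (U \<kappa> t) + \<kappa> *\<^sub>R (V \<kappa> t - U \<kappa> t)) (at t)"
    and V: "\<And>\<kappa> t. \<kappa> \<ge> 1 \<Longrightarrow>
      (V \<kappa> has_vector_derivative F2 (O2 t) (V \<kappa> t) + \<kappa> *\<^sub>R (U \<kappa> t - V \<kappa> t)) (at t)"
    and tempered: "\<And>\<kappa> \<epsilon>. \<kappa> \<ge> 1 \<Longrightarrow> \<epsilon> > 0 \<Longrightarrow>
      \<forall>\<^sub>F s in at_bot. norm (U \<kappa> s, V \<kappa> s) \<le> exp (- \<epsilon> * s)"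
  shows "\<exists>M \<kappa>0. \<forall>\<kappa>\<ge>\<kappa>0. \<forall>t\<in>{T0..T}.
      (norm (U \<kappa> t - W t))\<^sup>2 + (norm (V \<kappa> t - W t))\<^sup>2 \<le> M / \<kappa>"
proof -
  define \<eta> where "\<eta> = L / 6"
  have \<eta>: "\<eta> > 0" "\<eta> \<le> L" using L by (auto simp: \<eta>_def)
  obtain D where D: "D \<ge> 0" "\<And>t x. t \<le> T \<Longrightarrow>
      (norm (F1 (O1 t) x))\<^sup>2 + (norm (F2 (O2 t) x))\<^sup>2 \<le> D * (1 + (norm x)\<^sup>2) * exp (- \<eta> * t)"
    using field_growth_along_noise[OF \<eta>(1), of T] by blast
  obtain B where B: "\<And>t. t \<le> T \<Longrightarrow> \<bar>a1 * N1 t + a2 * N2 t\<bar> \<le> B - \<eta> * t"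
    using noise_potential_bound[OF \<eta>(1), of T] by blast
  obtain w where w: "w \<ge> 0" "\<And>t. t \<le> T \<Longrightarrow> (norm (W t))\<^sup>2 \<le> w * exp (- \<eta> * t)"
    using averaged_solution_growth[OF \<eta>, of T] by blast
  define G where "G = D * (exp (\<eta> * T) + w)"
  have G: "G \<ge> 0" using D w by (simp add: G_def)
  have G_bound: "(norm (F1 (O1 t) (W t)))\<^sup>2 + (norm (F2 (O2 t) (W t)))\<^sup>2 \<le> G * exp (- 2 * \<eta> * t)"
    if t: "t \<le> T" for t
  proof -
    have "1 \<le> exp (\<eta> * T) * exp (- \<eta> * t)" using t \<eta> by (simp flip: exp_add)
    then have "1 + (norm (W t))\<^sup>2 \<le> (exp (\<eta> * T) + w) * exp (- \<eta> * t)"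
      using w(2)[OF t] by (simp add: algebra_simps)
    then have "D * (1 + (norm (W t))\<^sup>2) * exp (- \<eta> * t) \<le> D * ((exp (\<eta> * T) + w) * exp (- \<eta> * t)) * exp (- \<eta> * t)"
      using D(1) by (intro mult_right_mono mult_left_mono) auto
    also have "\<dots> = G * (exp (- \<eta> * t) * exp (- \<eta> * t))" by (simp add: G_def mult_ac)
    also have "exp (- \<eta> * t) * exp (- \<eta> * t) = exp (- 2 * \<eta> * t)" by (simp flip: exp_add)
    finally show ?thesis using D(2)[OF t, of "W t"] by linarith
  qed
  define \<kappa>0 where "\<kappa>0 = max 1 (\<bar>K\<bar> / L)"
  define R where "R = B + L / 2 * (1 + 2 * \<bar>T\<bar>)"
  define S where "S = 2 * L * \<bar>T0\<bar> + B + \<eta> * \<bar>T0\<bar> + \<bar>Q T - Q 0\<bar>"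
  define M where "M = G * exp R / 2 / L * exp (L * T + S)"
  have "(norm (U \<kappa> t - W t))\<^sup>2 + (norm (V \<kappa> t - W t))\<^sup>2 \<le> M / \<kappa>"
    if \<kappa>: "\<kappa> \<ge> \<kappa>0" and t: "t \<in> {T0..T}" for \<kappa> t
  proof -
    have \<kappa>1: "\<kappa> \<ge> 1" and \<kappa>K: "\<bar>K\<bar> / (2 * \<kappa>) \<le> L / 2" and \<kappa>pos: "\<kappa> > 0"
      using \<kappa> L by (auto simp: \<kappa>0_def field_simps)
    define E where "E t = (norm (U \<kappa> t - W t))\<^sup>2 + (norm (V \<kappa> t - W t))\<^sup>2" for t
    define \<Lambda> where "\<Lambda> t = - 2 * L * t + (a1 * N1 t + a2 * N2 t) + (Q t - Q 0) / (2 * \<kappa>)" for t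
    define \<mu> where "\<mu> t = - 2 * L + (a1 * O1 t + a2 * O2 t) + (a1 * O1 t - a2 * O2 t)\<^sup>2 / (2 * \<kappa>)" for t
    define q where "q t = ((norm (F1 (O1 t) (W t)))\<^sup>2 + (norm (F2 (O2 t) (W t)))\<^sup>2) / (2 * \<kappa>)" for t
    define w' where "w' t = (1/2) *\<^sub>R (F1 (O1 t) (W t) + F2 (O2 t) (W t))" for t
    define E' where "E' t = 2 * ((U \<kappa> t - W t) \<bullet> (F1 (O1 t) (U \<kappa> t) + \<kappa> *\<^sub>R (V \<kappa> t - U \<kappa> t) - w' t))
          + 2 * ((V \<kappa> t - W t) \<bullet> (F2 (O2 t) (V \<kappa> t) + \<kappa> *\<^sub>R (U \<kappa> t - V \<kappa> t) - w' t))" for t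
    have \<Lambda>_low: "exp (- \<Lambda> s) \<le> exp R * exp ((3 / 2 * L - \<eta>) * s)" if "s \<le> T" for s
    proof -
      have "(Q 0 - Q s) / (2 * \<kappa>) \<le> \<bar>K\<bar> * (1 - s + 2 * \<bar>T\<bar>) / (2 * \<kappa>)"
        using Q_bound_below[OF that] \<kappa>1 by (intro divide_right_mono) auto
      also have "\<dots> = \<bar>K\<bar> / (2 * \<kappa>) * (1 - s + 2 * \<bar>T\<bar>)" by simp
      also have "\<dots> \<le> L / 2 * (1 - s + 2 * \<bar>T\<bar>)" using that \<kappa>K by (intro mult_right_mono) auto
      finally have "- \<Lambda> s \<le> 2 * L * s + (B - \<eta> * s) + L / 2 * (1 - s + 2 * \<bar>T\<bar>)"
        using B[OF that] \<kappa>1 by (simp add: \<Lambda>_def diff_divide_distrib)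
      also have "\<dots> = R + (3 / 2 * L - \<eta>) * s" by (simp add: R_def algebra_simps)
      finally show ?thesis by (simp flip: exp_add)
    qed
    have "E t \<le> G * exp R / (2 * \<kappa>) / L * exp (L * t + \<Lambda> t)"
    proof (rule gronwall_from_minus_infinity[where q = q and T = T and \<mu> = \<mu> and E' = E'])
      fix t assume t: "t \<le> T"
      show "(E has_real_derivative E' t) (at t)"
        unfolding E_def E'_def w'_def
        by (intro DERIV_add has_real_derivative_norm_power2 has_vector_derivative_diff U V W \<kappa>1)
      show "(\<Lambda> has_real_derivative \<mu> t) (at t)"
        unfolding \<Lambda>_def \<mu>_def using \<kappa>1 by (auto intro!: derivative_eq_intros N1 N2 Q)
      show "E' t \<le> \<mu> t * E t + q t"
        unfolding E'_def \<mu>_def E_def q_def w'_def by (rule error_dissipation[OF \<kappa>pos])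
      have "q t \<le> G * exp (- 2 * \<eta> * t) / (2 * \<kappa>)"
        unfolding q_def using G_bound[OF t] \<kappa>1 by (intro divide_right_mono) auto
      then have "q t * exp (- \<Lambda> t) \<le> G * exp (- 2 * \<eta> * t) / (2 * \<kappa>) * (exp R * exp ((3 / 2 * L - \<eta>) * t))"
        using \<Lambda>_low[OF t] G \<kappa>1 by (intro mult_mono) auto
      also have "\<dots> = G * exp R / (2 * \<kappa>) * (exp (- 2 * \<eta> * t) * exp ((3 / 2 * L - \<eta>) * t))" by simp
      also have "exp (- 2 * \<eta> * t) * exp ((3 / 2 * L - \<eta>) * t) = exp (L * t)"
        unfolding exp_add[symmetric] by (simp add: \<eta>_def algebra_simps)
      finally show "q t * exp (- \<Lambda> t) \<le> G * exp R / (2 * \<kappa>) * exp (L * t)" .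
    next
      fix \<delta> :: real assume "\<delta> > 0"
      define e where "e = 2 + 4 * (w + 1)"
      have "L / 4 > 0" "3 / 2 * L - \<eta> - L / 2 > 0" using L by (auto simp: \<eta>_def)
      from eventually_exp_le_at_bot[OF this(2) \<open>\<delta> > 0\<close>]
      have "\<forall>\<^sub>F s in at_bot. e * exp R * exp ((3 / 2 * L - \<eta> - L / 2) * s) \<le> \<delta>" .
      then have "\<forall>\<^sub>F s in at_bot. E s * exp (- \<Lambda> s) \<le> \<delta>"
        using tempered[OF \<kappa>1 \<open>L / 4 > 0\<close>] eventually_le_at_bot[of "min 0 T"]
      proof eventually_elim
        case (elim s)
        then have s: "s \<le> 0" "s \<le> T" by auto
        have "E s \<le> 2 * ((norm (U \<kappa> s))\<^sup>2 + (norm (V \<kappa> s))\<^sup>2) + 4 * (norm (W s))\<^sup>2"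
          unfolding E_def using add_mono[OF norm_diff_power2_le[of "U \<kappa> s" "W s"] norm_diff_power2_le[of "V \<kappa> s" "W s"]] by (simp add: algebra_simps)
        also have "(norm (U \<kappa> s))\<^sup>2 + (norm (V \<kappa> s))\<^sup>2 = (norm (U \<kappa> s, V \<kappa> s))\<^sup>2" by (simp add: norm_Pair)
        also have "\<dots> \<le> (exp (- (L / 4) * s))\<^sup>2" using elim by (intro power_mono) auto
        also have "\<dots> = exp (- L / 2 * s)" by (simp add: power2_eq_square flip: exp_add)
        also have "(norm (W s))\<^sup>2 \<le> (w + 1) * exp (- L / 2 * s)"
        proof -
          have "(norm (W s))\<^sup>2 \<le> w * exp (- \<eta> * s)" by (rule w(2)[OF s(2)])
          also have "\<dots> \<le> (w + 1) * exp (- L / 2 * s)"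
            using w(1) s L unfolding \<eta>_def by (intro mult_mono) (auto simp: mult_right_mono_neg divide_le_cancel)
          finally show ?thesis .
        qed
        finally have "E s \<le> e * exp (- L / 2 * s)" by (simp add: e_def algebra_simps)
        then have "E s * exp (- \<Lambda> s) \<le> e * exp (- L / 2 * s) * (exp R * exp ((3 / 2 * L - \<eta>) * s))"
          using \<Lambda>_low[OF s(2)] w(1) by (intro mult_mono) (auto simp: e_def)
        also have "\<dots> = e * exp R * (exp (- L / 2 * s) * exp ((3 / 2 * L - \<eta>) * s))" by simp
        also have "exp (- L / 2 * s) * exp ((3 / 2 * L - \<eta>) * s) = exp ((3 / 2 * L - \<eta> - L / 2) * s)"
          unfolding exp_add[symmetric] by (simp add: algebra_simps)
        finally show ?case using elim by linarith
      qed
      then show "\<exists>\<^sub>F s in at_bot. E s * exp (- \<Lambda> s) \<le> \<delta>" by (intro eventually_frequently) auto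
    qed (use L G \<kappa>pos t in auto)
    also have "\<dots> \<le> G * exp R / (2 * \<kappa>) / L * exp (L * T + S)"
    proof (intro mult_left_mono)
      have "Q t \<le> Q T"
        using t by (intro Q_mono) simp
      then have "(Q t - Q 0) / (2 * \<kappa>) \<le> \<bar>Q T - Q 0\<bar> / (2 * \<kappa>)" using \<kappa>1 by (intro divide_right_mono) auto
      also have "\<dots> \<le> \<bar>Q T - Q 0\<bar> / 1" using \<kappa>1 by (intro divide_left_mono) auto
      finally have 1: "(Q t - Q 0) / (2 * \<kappa>) \<le> \<bar>Q T - Q 0\<bar>" by simp
      have "- t \<le> \<bar>T0\<bar>" "t \<le> T" using t by auto
      then have "2 * L * (- t) \<le> 2 * L * \<bar>T0\<bar>" "\<eta> * (- t) \<le> \<eta> * \<bar>T0\<bar>" "L * t \<le> L * T"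
        by (intro mult_left_mono; use L \<eta> in simp)+
      with 1 B[OF \<open>t \<le> T\<close>] have "L * t + \<Lambda> t \<le> L * T + S" by (simp add: \<Lambda>_def S_def)
      then show "exp (L * t + \<Lambda> t) \<le> exp (L * T + S)" by simp
    qed (use G \<kappa>1 L in auto)
    also have "\<dots> = M / \<kappa>" by (simp add: M_def)
    finally show ?thesis by (simp add: E_def)
  qed
  then show ?thesis by blast
qed

end

end

section \<open>Joint laws and linear combinations\<close>

abbreviation weighted_distr :: "'a measure \<Rightarrow> ('a \<Rightarrow> real) \<Rightarrow> real \<Rightarrow> ('a \<Rightarrow> real) \<Rightarrow> real measure" where
  "weighted_distr M r m X \<equiv> distr (density M (\<lambda>\<omega>. ennreal (r \<omega> / m))) borel X"

text \<open>Real and imaginary part of the characteristic function are both cosine integrals, since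
\<open>sin x = cos (x - pi / 2)\<close>; phases thus replace complex numbers below.\<close>

lemma weighted_law:
  fixes X r :: "'a \<Rightarrow> real" and m :: real
  assumes [measurable]: "X \<in> borel_measurable M" "r \<in> borel_measurable M"
    and r: "integrable M r" "\<And>\<omega>. 0 \<le> r \<omega>" "(\<integral>\<omega>. r \<omega> \<partial>M) = m" and m: "m > 0"
  shows "real_distribution (weighted_distr M r m X)"
    and "char (weighted_distr M r m X) t =
        complex_of_real ((\<integral>\<omega>. r \<omega> * cos (t * X \<omega> + 0) \<partial>M) / m) +
        \<i> * complex_of_real ((\<integral>\<omega>. r \<omega> * cos (t * X \<omega> + - pi / 2) \<partial>M) / m)"
    and "A \<in> sets borel \<Longrightarrow> measure (weighted_distr M r m X) A
        = (\<integral>\<omega>. r \<omega> * indicator A (X \<omega>) \<partial>M) / m"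
proof -
  have "(\<integral>\<^sup>+ \<omega>. ennreal (r \<omega> / m) \<partial>M) = ennreal (\<integral>\<omega>. r \<omega> / m \<partial>M)"
    using r m by (intro nn_integral_eq_integral) auto
  also have "\<dots> = 1" using r m by simp
  finally interpret D: prob_space "density M (\<lambda>\<omega>. ennreal (r \<omega> / m))"
    by (intro prob_spaceI) (simp add: emeasure_density cong: nn_integral_cong)
  show "real_distribution (weighted_distr M r m X)"
    by (rule D.real_distribution_distr) simp
  have bound: "integrable M (\<lambda>\<omega>. r \<omega> * b \<omega>)" if [measurable]: "b \<in> borel_measurable M"
    and "\<And>\<omega>. \<bar>b \<omega>\<bar> \<le> 1" for b
    by (rule Bochner_Integration.integrable_bound[OF r(1)])
      (use that r(2) in \<open>auto simp: abs_mult intro!: mult_left_le\<close>)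
  have "char (weighted_distr M r m X) t
      = (\<integral>\<omega>. (r \<omega> / m) *\<^sub>R iexp (t * X \<omega>) \<partial>M)"
    unfolding char_def by (subst integral_distr) (use r m in \<open>auto intro!: integral_density\<close>)
  also have "\<dots> = (\<integral>\<omega>. complex_of_real ((r \<omega> * cos (t * X \<omega>)) / m)
      + \<i> * complex_of_real ((r \<omega> * sin (t * X \<omega>)) / m) \<partial>M)"
    by (intro Bochner_Integration.integral_cong refl)
      (auto simp: scaleR_conv_of_real exp_Euler cos_of_real[symmetric] sin_of_real[symmetric] algebra_simps add_divide_distrib)
  also have "\<dots> = complex_of_real ((\<integral>\<omega>. r \<omega> * cos (t * X \<omega>) \<partial>M) / m) +
    \<i> * complex_of_real ((\<integral>\<omega>. r \<omega> * sin (t * X \<omega>) \<partial>M) / m)"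
  proof (subst Bochner_Integration.integral_add)
    show "integrable M (\<lambda>\<omega>. complex_of_real ((r \<omega> * cos (t * X \<omega>)) / m))"
      by (intro integrable_of_real Bochner_Integration.integrable_divide bound) auto
    show "integrable M (\<lambda>\<omega>. \<i> * complex_of_real ((r \<omega> * sin (t * X \<omega>)) / m))"
      by (intro integrable_mult_right integrable_of_real Bochner_Integration.integrable_divide bound) auto
  qed (simp only: integral_mult_right_zero integral_complex_of_real integral_divide_zero)
  also have "(\<lambda>\<omega>. r \<omega> * sin (t * X \<omega>)) = (\<lambda>\<omega>. r \<omega> * cos (t * X \<omega> + - pi / 2))"
    by (simp add: cos_diff)
  finally show "char (weighted_distr M r m X) t =
    complex_of_real ((\<integral>\<omega>. r \<omega> * cos (t * X \<omega> + 0) \<partial>M) / m) +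
    \<i> * complex_of_real ((\<integral>\<omega>. r \<omega> * cos (t * X \<omega> + - pi / 2) \<partial>M) / m)" by simp
  show "measure (weighted_distr M r m X) A
    = (\<integral>\<omega>. r \<omega> * indicator A (X \<omega>) \<partial>M) / m" if A[measurable]: "A \<in> sets borel"
  proof -
    have "measure (weighted_distr M r m X) A
      = (\<integral>x. indicator A x \<partial>weighted_distr M r m X)"
      by simp
    also have "\<dots> = (\<integral>\<omega>. (r \<omega> / m) *\<^sub>R indicator A (X \<omega>) \<partial>M)"
      by (subst integral_distr, simp, simp, rule integral_density) (use r m in auto)
    also have "\<dots> = (\<integral>\<omega>. r \<omega> * indicator A (X \<omega>) \<partial>M) / m" by simp
    finally show ?thesis .
  qed
qed

text \<open>After division by the common total mass this is Levy's uniqueness theorem. Weights are what make the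
one-dimensional theorem usable for joint laws.\<close>

lemma weighted_levy_uniqueness:
  fixes X :: "'a \<Rightarrow> real" and Y :: "'b \<Rightarrow> real" and r :: "'a \<Rightarrow> real" and q :: "'b \<Rightarrow> real"
  assumes [measurable]: "X \<in> borel_measurable M" "r \<in> borel_measurable M"
    "Y \<in> borel_measurable N" "q \<in> borel_measurable N"
    and r: "integrable M r" "\<And>\<omega>. 0 \<le> r \<omega>" and q: "integrable N q" "\<And>\<omega>. 0 \<le> q \<omega>"
    and eq: "\<And>s \<alpha>. (\<integral>\<omega>. r \<omega> * cos (s * X \<omega> + \<alpha>) \<partial>M) = (\<integral>\<omega>. q \<omega> * cos (s * Y \<omega> + \<alpha>) \<partial>N)"
    and A[measurable]: "A \<in> sets borel"
  shows "(\<integral>\<omega>. r \<omega> * indicator A (X \<omega>) \<partial>M) = (\<integral>\<omega>. q \<omega> * indicator A (Y \<omega>) \<partial>N)"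
proof -
  define m where "m = (\<integral>\<omega>. r \<omega> \<partial>M)"
  have mq: "m = (\<integral>\<omega>. q \<omega> \<partial>N)" using eq[of 0 0] by (simp add: m_def)
  show ?thesis
  proof (cases "m = 0")
    case True
    have "AE \<omega> in M. r \<omega> = 0"
      using integral_nonneg_eq_0_iff_AE[OF r(1)] r(2) True by (auto simp: m_def)
    then have "(\<integral>\<omega>. r \<omega> * indicator A (X \<omega>) \<partial>M) = 0" by (intro integral_eq_zero_AE) auto
    moreover have "AE \<omega> in N. q \<omega> = 0"
      using integral_nonneg_eq_0_iff_AE[OF q(1)] q(2) True by (auto simp: mq)
    then have "(\<integral>\<omega>. q \<omega> * indicator A (Y \<omega>) \<partial>N) = 0" by (intro integral_eq_zero_AE) auto
    ultimately show ?thesis by simp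
  next
    case False
    then have m: "m > 0" using r(2) by (simp add: m_def less_le)
    have rm: "(\<integral>\<omega>. r \<omega> \<partial>M) = m" and qm: "(\<integral>\<omega>. q \<omega> \<partial>N) = m" by (simp_all add: m_def mq[symmetric])
    note lawX = weighted_law[OF assms(1,2) r rm m] and lawY = weighted_law[OF assms(3,4) q qm m]
    have "weighted_distr M r m X = weighted_distr N q m Y"
    proof (intro Levy_uniqueness lawX(1) lawY(1) ext)
      show "char (weighted_distr M r m X) t
        = char (weighted_distr N q m Y) t" for t
        by (simp only: lawX(2) lawY(2) eq)
    qed
    then have "(\<integral>\<omega>. r \<omega> * indicator A (X \<omega>) \<partial>M) / m = (\<integral>\<omega>. q \<omega> * indicator A (Y \<omega>) \<partial>N) / m"
      unfolding lawX(3)[OF A, symmetric] lawY(3)[OF A, symmetric] by simp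
    then show ?thesis using m by simp
  qed
qed

lemma linear_combination_insert:
  fixes c :: "'i \<Rightarrow> real"
  assumes "finite K"
  shows "\<exists>K' c'. finite K' \<and> (\<forall>Z. (\<Sum>k\<in>K'. c' k * Z k) = (\<Sum>k\<in>K. c k * Z k) + s * (Z j :: real))"
proof (intro exI conjI allI)
  show "finite (insert j K)" using assms by simp
  fix Z :: "'i \<Rightarrow> real"
  have "(\<Sum>k\<in>insert j K. ((if k \<in> K then c k else 0) + (if k = j then s else 0)) * Z k)
    = (\<Sum>k\<in>insert j K. if k \<in> K then c k * Z k else 0) + (\<Sum>k\<in>insert j K. if k = j then s * Z k else 0)"
    unfolding sum.distrib[symmetric] by (intro sum.cong) (auto simp: algebra_simps)
  also have "(\<Sum>k\<in>insert j K. if k \<in> K then c k * Z k else 0) = (\<Sum>k\<in>K. c k * Z k)"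
    using assms by (subst sum.inter_restrict[symmetric]) (auto intro!: sum.cong simp: Int_absorb1 subset_insertI)
  also have "(\<Sum>k\<in>insert j K. if k = j then s * Z k else 0) = s * Z j"
    using assms by (simp add: sum.delta)
  finally show "(\<Sum>k\<in>insert j K. ((if k \<in> K then c k else 0) + (if k = j then s else 0)) * Z k)
    = (\<Sum>k\<in>K. c k * Z k) + s * Z j" .
qed

lemma cosine_product_integral:
  fixes p \<theta> X :: "'a \<Rightarrow> real"
  assumes "prob_space M" and [measurable]: "p \<in> borel_measurable M" "\<theta> \<in> borel_measurable M" "X \<in> borel_measurable M"
    and p: "\<And>\<omega>. 0 \<le> p \<omega>" "\<And>\<omega>. p \<omega> \<le> 1"
  shows "(\<integral>\<omega>. p \<omega> * (1 + cos (\<theta> \<omega> + \<alpha>)) * cos (X \<omega> + \<beta>) \<partial>M) = (\<integral>\<omega>. p \<omega> * cos (0 + X \<omega> + \<beta>) \<partial>M)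
    + (\<integral>\<omega>. p \<omega> * cos (\<theta> \<omega> + X \<omega> + (\<alpha> + \<beta>)) \<partial>M) / 2 + (\<integral>\<omega>. p \<omega> * cos (\<theta> \<omega> + - X \<omega> + (\<alpha> - \<beta>)) \<partial>M) / 2"
proof -
  interpret prob_space M by fact
  have int: "integrable M (\<lambda>\<omega>. p \<omega> * cos (y \<omega>))" if [measurable]: "y \<in> borel_measurable M" for y
  proof (rule integrable_const_bound[of _ 1])
    have "\<bar>p \<omega> * cos (y \<omega>)\<bar> \<le> 1 * 1" for \<omega>
      unfolding abs_mult using p[of \<omega>] by (intro mult_mono) auto
    then show "AE \<omega> in M. norm (p \<omega> * cos (y \<omega>)) \<le> 1" by simp
  qed measurable
  have "x * (1 + cos (t + \<alpha>)) * cos (y + \<beta>) = x * cos (0 + y + \<beta>)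
     + x * cos (t + y + (\<alpha> + \<beta>)) / 2 + x * cos (t + - y + (\<alpha> - \<beta>)) / 2" for x t y :: real
  proof -
    have "cos (t + \<alpha>) * cos (y + \<beta>) = cos (t + y + (\<alpha> + \<beta>)) / 2 + cos (t + - y + (\<alpha> - \<beta>)) / 2"
      using cos_times_cos[of "t + \<alpha>" "y + \<beta>"] by (simp add: algebra_simps add_divide_distrib)
    then show ?thesis by (simp add: algebra_simps)
  qed
  note split = this
  have i: "integrable M (\<lambda>\<omega>. p \<omega> * cos (0 + X \<omega> + \<beta>))"
    "integrable M (\<lambda>\<omega>. p \<omega> * cos (\<theta> \<omega> + X \<omega> + (\<alpha> + \<beta>)))"
    "integrable M (\<lambda>\<omega>. p \<omega> * cos (\<theta> \<omega> + - X \<omega> + (\<alpha> - \<beta>)))"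
    by (intro int; measurable)+
  show ?thesis unfolding split
    by (simp only: Bochner_Integration.integral_add Bochner_Integration.integrable_add
        Bochner_Integration.integrable_divide integral_divide_zero i)
qed

context
  fixes M :: "'a measure" and N :: "'b measure" and X :: "'i \<Rightarrow> 'a \<Rightarrow> real" and Y :: "'i \<Rightarrow> 'b \<Rightarrow> real"
  assumes M: "prob_space M" and N: "prob_space N"
    and X[measurable]: "\<And>i. X i \<in> borel_measurable M" and Y[measurable]: "\<And>i. Y i \<in> borel_measurable N"
    and lin: "\<And>J c. finite J \<Longrightarrow> distr M borel (\<lambda>\<omega>. \<Sum>i\<in>J. c i * X i \<omega>) = distr N borel (\<lambda>\<omega>. \<Sum>i\<in>J. c i * Y i \<omega>)"
begin

text \<open>The Cramer--Wold device by induction on the number of box constraints: one coordinate after the other is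
moved from the cosine into the box. In a step, Levy's theorem is applied to \<open>X j\<close> under the density
\<open>(\<Prod>j\<in>J. indicator (A j) (X j)) * (1 + cos (\<dots>))\<close>. The summand \<open>1\<close> makes it nonnegative, and products of
cosines are sums of cosines, which the induction hypothesis covers.\<close>

lemma box_cosine_expectation_eq:
  assumes "finite J" "\<And>i. A i \<in> sets borel" "finite K"
  shows "(\<integral>\<omega>. (\<Prod>j\<in>J. indicator (A j) (X j \<omega>)) * cos ((\<Sum>k\<in>K. c k * X k \<omega>) + \<alpha>) \<partial>M)
    = (\<integral>\<omega>. (\<Prod>j\<in>J. indicator (A j) (Y j \<omega>)) * cos ((\<Sum>k\<in>K. c k * Y k \<omega>) + \<alpha>) \<partial>N)"
  using assms(1,3)
proof (induction J arbitrary: K c \<alpha>)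
  case empty
  have "(\<integral>\<omega>. cos ((\<Sum>k\<in>K. c k * X k \<omega>) + \<alpha>) \<partial>M) = (\<integral>x. cos (x + \<alpha>) \<partial>distr M borel (\<lambda>\<omega>. \<Sum>i\<in>K. c i * X i \<omega>))"
    by (subst integral_distr) auto
  also have "\<dots> = (\<integral>\<omega>. cos ((\<Sum>k\<in>K. c k * Y k \<omega>) + \<alpha>) \<partial>N)"
    unfolding lin[OF empty] by (subst integral_distr) auto
  finally show ?case by simp
next
  case (insert j J)
  interpret M: prob_space M by (rule M)
  interpret N: prob_space N by (rule N)
  note A[measurable] = assms(2)
  define p where "p \<omega> = (\<Prod>j\<in>J. indicator (A j) (X j \<omega>) :: real)" for \<omega>
  define q where "q \<omega> = (\<Prod>j\<in>J. indicator (A j) (Y j \<omega>) :: real)" for \<omega>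
  have [measurable]: "p \<in> borel_measurable M" "q \<in> borel_measurable N"
    unfolding p_def q_def by measurable
  have p: "0 \<le> p \<omega>" "p \<omega> \<le> 1" and q: "0 \<le> q \<omega>'" "q \<omega>' \<le> 1" for \<omega> \<omega>'
    unfolding p_def q_def by (auto intro!: prod_nonneg prod_le_1)
  have p2: "p \<omega> \<le> 2" "q \<omega>' \<le> 2" for \<omega> \<omega>' using p(2)[of \<omega>] q(2)[of \<omega>'] by auto
  have intM: "integrable M b" if "b \<in> borel_measurable M" "\<And>\<omega>. \<bar>b \<omega>\<bar> \<le> 2" for b :: "_ \<Rightarrow> real"
    using that by (intro M.integrable_const_bound[of _ 2]) auto
  have intN: "integrable N b" if "b \<in> borel_measurable N" "\<And>\<omega>. \<bar>b \<omega>\<bar> \<le> 2" for b :: "_ \<Rightarrow> real"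
    using that by (intro N.integrable_const_bound[of _ 2]) auto
  have bnd: "\<bar>x * y\<bar> \<le> 2" if "0 \<le> x" "x \<le> 1" "\<bar>y\<bar> \<le> 2" for x y :: real
    using mult_mono[of "\<bar>x\<bar>" 1 "\<bar>y\<bar>" 2] that by (simp add: abs_mult)
  have bnd1: "\<bar>x * cos y\<bar> \<le> 2" "\<bar>x * (1 + cos y)\<bar> \<le> 2" "0 \<le> x * (1 + cos y)"
    if "0 \<le> x" "x \<le> 1" for x y :: real
  proof -
    have "\<bar>cos y\<bar> \<le> 1" by (rule abs_cos_le_one)
    then have "\<bar>cos y\<bar> \<le> 2" "\<bar>1 + cos y\<bar> \<le> 2" "0 \<le> 1 + cos y" by linarith+
    then show "\<bar>x * cos y\<bar> \<le> 2" "\<bar>x * (1 + cos y)\<bar> \<le> 2" "0 \<le> x * (1 + cos y)"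
      using that bnd[OF that] by (blast intro: mult_nonneg_nonneg)+
  qed
  have IH: "(\<integral>\<omega>. p \<omega> * cos ((\<Sum>k\<in>K. c k * X k \<omega>) + \<alpha>) \<partial>M) = (\<integral>\<omega>. q \<omega> * cos ((\<Sum>k\<in>K. c k * Y k \<omega>) + \<alpha>) \<partial>N)"
    if "finite K" for K c \<alpha> using insert.IH[OF that] unfolding p_def q_def .
  \<comment> \<open>The coordinate \<open>X j\<close> may be added to the linear combination inside the cosine.\<close>
  have IH': "(\<integral>\<omega>. p \<omega> * cos ((\<Sum>k\<in>K. c k * X k \<omega>) + s * X j \<omega> + \<alpha>) \<partial>M)
     = (\<integral>\<omega>. q \<omega> * cos ((\<Sum>k\<in>K. c k * Y k \<omega>) + s * Y j \<omega> + \<alpha>) \<partial>N)" if K: "finite K" for K c s \<alpha>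
  proof -
    obtain K' c' where *: "finite K'" "\<forall>Z. (\<Sum>k\<in>K'. c' k * Z k) = (\<Sum>k\<in>K. c k * Z k) + s * (Z j :: real)"
      using linear_combination_insert[OF K, of c s j] by blast
    from IH[OF *(1), of c' \<alpha>] show ?thesis unfolding *(2)[rule_format] .
  qed
  have key: "(\<integral>\<omega>. p \<omega> * (1 + cos ((\<Sum>k\<in>K0. cc k * X k \<omega>) + \<gamma>)) * indicator (A j) (X j \<omega>) \<partial>M)
    = (\<integral>\<omega>. q \<omega> * (1 + cos ((\<Sum>k\<in>K0. cc k * Y k \<omega>) + \<gamma>)) * indicator (A j) (Y j \<omega>) \<partial>N)"
    if K: "finite K0" for K0 cc \<gamma>
  proof (rule weighted_levy_uniqueness)
    fix s \<beta>
    have "(\<integral>\<omega>. p \<omega> * (1 + cos ((\<Sum>k\<in>K0. cc k * X k \<omega>) + \<gamma>)) * cos (s * X j \<omega> + \<beta>) \<partial>M)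
      = (\<integral>\<omega>. p \<omega> * cos ((\<Sum>k\<in>{}. cc k * X k \<omega>) + s * X j \<omega> + \<beta>) \<partial>M)
      + (\<integral>\<omega>. p \<omega> * cos ((\<Sum>k\<in>K0. cc k * X k \<omega>) + s * X j \<omega> + (\<gamma> + \<beta>)) \<partial>M) / 2
      + (\<integral>\<omega>. p \<omega> * cos ((\<Sum>k\<in>K0. cc k * X k \<omega>) + (- s) * X j \<omega> + (\<gamma> - \<beta>)) \<partial>M) / 2"
      unfolding sum.empty mult_minus_left by (intro cosine_product_integral M p) measurable
    also have "\<dots> = (\<integral>\<omega>. q \<omega> * cos ((\<Sum>k\<in>{}. cc k * Y k \<omega>) + s * Y j \<omega> + \<beta>) \<partial>N)
      + (\<integral>\<omega>. q \<omega> * cos ((\<Sum>k\<in>K0. cc k * Y k \<omega>) + s * Y j \<omega> + (\<gamma> + \<beta>)) \<partial>N) / 2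
      + (\<integral>\<omega>. q \<omega> * cos ((\<Sum>k\<in>K0. cc k * Y k \<omega>) + (- s) * Y j \<omega> + (\<gamma> - \<beta>)) \<partial>N) / 2"
      by (simp only: IH'[OF finite.emptyI] IH'[OF K])
    also have "\<dots> = (\<integral>\<omega>. q \<omega> * (1 + cos ((\<Sum>k\<in>K0. cc k * Y k \<omega>) + \<gamma>)) * cos (s * Y j \<omega> + \<beta>) \<partial>N)"
      unfolding sum.empty mult_minus_left by (intro cosine_product_integral[symmetric] N q) measurable
    finally show "(\<integral>\<omega>. p \<omega> * (1 + cos ((\<Sum>k\<in>K0. cc k * X k \<omega>) + \<gamma>)) * cos (s * X j \<omega> + \<beta>) \<partial>M)
      = (\<integral>\<omega>. q \<omega> * (1 + cos ((\<Sum>k\<in>K0. cc k * Y k \<omega>) + \<gamma>)) * cos (s * Y j \<omega> + \<beta>) \<partial>N)" .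
  qed (use p q bnd1 in \<open>auto intro!: intM intN\<close>)
  \<comment> \<open>For the phase \<open>pi / 2\<close> and the empty combination the cosine vanishes, and only the summand 1 is left.\<close>
  have base: "(\<integral>\<omega>. p \<omega> * indicator (A j) (X j \<omega>) \<partial>M) = (\<integral>\<omega>. q \<omega> * indicator (A j) (Y j \<omega>) \<partial>N)"
    using key[of "{}" "\<lambda>_. 0" "pi / 2"] by simp
  have expand: "(\<Prod>i\<in>insert j J. indicator (A i) (f i)) * cos t
     = (\<Prod>i\<in>J. indicator (A i) (f i)) * (1 + cos t) * indicator (A j) (f j)
      - (\<Prod>i\<in>J. indicator (A i) (f i)) * indicator (A j) (f j)" for f and t :: real
    using insert.hyps by (simp add: algebra_simps)
  have b: "\<bar>x * indicator S y\<bar> \<le> 2" if "\<bar>x\<bar> \<le> 2" for x :: real and S and y :: real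
    using that by (auto simp: indicator_def)
  have "(\<integral>\<omega>. (\<Prod>i\<in>insert j J. indicator (A i) (X i \<omega>)) * cos ((\<Sum>k\<in>K. c k * X k \<omega>) + \<alpha>) \<partial>M)
    = (\<integral>\<omega>. p \<omega> * (1 + cos ((\<Sum>k\<in>K. c k * X k \<omega>) + \<alpha>)) * indicator (A j) (X j \<omega>) \<partial>M)
      - (\<integral>\<omega>. p \<omega> * indicator (A j) (X j \<omega>) \<partial>M)"
    unfolding expand p_def[symmetric]
    by (subst Bochner_Integration.integral_diff) (use p p2 bnd1 bnd in \<open>auto intro!: intM b\<close>)
  also have "\<dots> = (\<integral>\<omega>. (\<Prod>i\<in>insert j J. indicator (A i) (Y i \<omega>)) * cos ((\<Sum>k\<in>K. c k * Y k \<omega>) + \<alpha>) \<partial>N)"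
    unfolding expand q_def[symmetric] key[OF insert.prems] base
    by (subst Bochner_Integration.integral_diff) (use q p2 bnd1 bnd in \<open>auto intro!: intN b\<close>)
  finally show ?case .
qed

lemma joint_law_eq:
  "distr M (PiM UNIV (\<lambda>_. borel)) (\<lambda>\<omega> i. X i \<omega>) = distr N (PiM UNIV (\<lambda>_. borel)) (\<lambda>\<omega> i. Y i \<omega>)"
proof (rule measure_eqI_PiM_infinite[where I = UNIV and M = "\<lambda>_. borel"])
  interpret M: prob_space M by (rule M)
  interpret N: prob_space N by (rule N)
  have [measurable]: "(\<lambda>\<omega> i. X i \<omega>) \<in> measurable M (PiM UNIV (\<lambda>_. borel))"
    "(\<lambda>\<omega> i. Y i \<omega>) \<in> measurable N (PiM UNIV (\<lambda>_. borel))"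
    by (auto intro!: measurable_PiM_single')
  show "finite_measure (distr M (PiM UNIV (\<lambda>_. borel)) (\<lambda>\<omega> i. X i \<omega>))"
    by (rule M.finite_measure_distr) simp
  fix A :: "'i \<Rightarrow> real set" and J :: "'i set"
  assume J: "finite J" and "\<And>i. i \<in> J \<Longrightarrow> A i \<in> sets borel"
  define A' where "A' i = (if i \<in> J then A i else UNIV)" for i
  have A'[measurable]: "A' i \<in> sets borel" for i using \<open>\<And>i. i \<in> J \<Longrightarrow> A i \<in> sets borel\<close> by (auto simp: A'_def)
  have set: "prod_emb UNIV (\<lambda>_. borel) J (Pi\<^sub>E J A) = {x. \<forall>j\<in>J. x j \<in> A' j}"
    by (auto simp: prod_emb_def A'_def PiE_iff)
  have [measurable]: "{x. \<forall>j\<in>J. x j \<in> A' j} \<in> sets (PiM UNIV (\<lambda>_. borel))"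
    unfolding set[symmetric] using J \<open>\<And>i. i \<in> J \<Longrightarrow> A i \<in> sets borel\<close> by (intro sets_PiM_I) auto
  have prod: "(\<Prod>j\<in>J. indicator (A' j) (f j)) = (indicator {x. \<forall>j\<in>J. x j \<in> A' j} f :: real)" for f
    using J by (auto simp: indicator_def)
  have "measure (distr M (PiM UNIV (\<lambda>_. borel)) (\<lambda>\<omega> i. X i \<omega>)) {x. \<forall>j\<in>J. x j \<in> A' j}
    = (\<integral>x. indicator {x. \<forall>j\<in>J. x j \<in> A' j} x \<partial>distr M (PiM UNIV (\<lambda>_. borel)) (\<lambda>\<omega> i. X i \<omega>))"
    by (simp add: space_PiM)
  also have "\<dots> = (\<integral>\<omega>. (\<Prod>j\<in>J. indicator (A' j) (X j \<omega>)) \<partial>M)"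
    by (subst integral_distr) (auto simp: prod)
  also have "\<dots> = (\<integral>\<omega>. (\<Prod>j\<in>J. indicator (A' j) (Y j \<omega>)) \<partial>N)"
    using box_cosine_expectation_eq[where \<alpha> = 0 and c = "\<lambda>_. 0", OF J A' finite.emptyI] by simp
  also have "\<dots> = (\<integral>x. indicator {x. \<forall>j\<in>J. x j \<in> A' j} x \<partial>distr N (PiM UNIV (\<lambda>_. borel)) (\<lambda>\<omega> i. Y i \<omega>))"
    by (subst integral_distr) (auto simp: prod)
  also have "\<dots> = measure (distr N (PiM UNIV (\<lambda>_. borel)) (\<lambda>\<omega> i. Y i \<omega>)) {x. \<forall>j\<in>J. x j \<in> A' j}"
    by (simp add: space_PiM)
  finally show "emeasure (distr M (PiM UNIV (\<lambda>_. borel)) (\<lambda>\<omega> i. X i \<omega>)) (prod_emb UNIV (\<lambda>_. borel) J (Pi\<^sub>E J A))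
    = emeasure (distr N (PiM UNIV (\<lambda>_. borel)) (\<lambda>\<omega> i. Y i \<omega>)) (prod_emb UNIV (\<lambda>_. borel) J (Pi\<^sub>E J A))"
    unfolding set
    by (subst (1 2) finite_measure.emeasure_eq_measure)
      (auto intro!: M.finite_measure_distr N.finite_measure_distr)
qed auto

end

text \<open>The degenerate case has variance \<open>0\<close>, so that the second moment alone decides which of the two cases
holds and with which parameter.\<close>

lemma centered_gaussian_law:
  assumes "centered_gaussian M X"
  shows "integrable M (\<lambda>\<omega>. (X \<omega>)\<^sup>2)"
    and "distr M borel X = (let v = (\<integral>\<omega>. (X \<omega>)\<^sup>2 \<partial>M) in
      if v = 0 then return borel 0 else density lborel (\<lambda>x. ennreal (normal_density 0 (sqrt v) x)))"
proof -
  have [measurable]: "X \<in> borel_measurable M" using assms by (simp add: centered_gaussian_def)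
  have int: "integrable M (\<lambda>\<omega>. (X \<omega>)\<^sup>2) \<longleftrightarrow> integrable (distr M borel X) (\<lambda>x. x\<^sup>2)"
    by (subst integrable_distr_eq) auto
  have mom: "(\<integral>\<omega>. (X \<omega>)\<^sup>2 \<partial>M) = (\<integral>x. x\<^sup>2 \<partial>distr M borel X)"
    by (subst integral_distr) auto
  consider (0) "distr M borel X = return borel 0"
    | (normal) \<sigma> where "\<sigma> > 0" "distr M borel X = density lborel (\<lambda>x. ennreal (normal_density 0 \<sigma> x))"
    using assms unfolding centered_gaussian_def by blast
  then have "integrable M (\<lambda>\<omega>. (X \<omega>)\<^sup>2) \<and> distr M borel X = (let v = (\<integral>\<omega>. (X \<omega>)\<^sup>2 \<partial>M) in
      if v = 0 then return borel 0 else density lborel (\<lambda>x. ennreal (normal_density 0 (sqrt v) x)))"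
  proof cases
    case 0
    have "AE x in return borel 0. (x::real)\<^sup>2 = 0" by (subst AE_return) auto
    then have "integrable (return borel 0) (\<lambda>x::real. x\<^sup>2)"
      by (subst integrable_cong_AE[where g = "\<lambda>_. 0"]) auto
    moreover have "(\<integral>x. x\<^sup>2 \<partial>return borel 0) = (0::real)" by (subst integral_return) auto
    ultimately show ?thesis unfolding int mom 0 by simp
  next
    case normal
    have "has_bochner_integral (density lborel (\<lambda>x. ennreal (normal_density 0 \<sigma> x))) (\<lambda>x. x\<^sup>2) (\<sigma>\<^sup>2)"
      using normal_moment_even[OF normal(1), of 0 1]
      by (intro has_bochner_integral_density) (auto simp: normal_density_nonneg numeral_2_eq_2)
    then show ?thesis unfolding int mom normal(2)
      using normal(1) by (auto simp: has_bochner_integral_iff)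
  qed
  then show "integrable M (\<lambda>\<omega>. (X \<omega>)\<^sup>2)"
    and "distr M borel X = (let v = (\<integral>\<omega>. (X \<omega>)\<^sup>2 \<partial>M) in
      if v = 0 then return borel 0 else density lborel (\<lambda>x. ennreal (normal_density 0 (sqrt v) x)))"
    by blast+
qed

section \<open>Shift invariance of fractional Brownian motion\<close>

lemma shift_shift: "shift s (shift t \<omega>) = shift (s + t) \<omega>"
  by (auto simp: shift_def add.assoc)

lemma shift_zero: "\<omega> \<in> C0 \<Longrightarrow> shift 0 \<omega> = \<omega>"
  by (auto simp: shift_def C0_def)

lemma funpow_shift: "\<omega> \<in> C0 \<Longrightarrow> (shift t ^^ k) \<omega> = shift (real k * t) \<omega>"
  by (induction k) (auto simp: shift_zero shift_shift algebra_simps)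

lemma shift_in_C0: "\<omega> \<in> C0 \<Longrightarrow> shift t \<omega> \<in> C0"
  by (auto simp: C0_def shift_def intro!: continuous_intros continuous_on_compose2[of UNIV \<omega>])

lemma centered_gaussian_distr_eq:
  assumes "centered_gaussian M X" "centered_gaussian N Y"
    and "(\<integral>\<omega>. (X \<omega>)\<^sup>2 \<partial>M) = (\<integral>\<omega>. (Y \<omega>)\<^sup>2 \<partial>N)"
  shows "distr M borel X = distr N borel Y"
  unfolding centered_gaussian_law(2)[OF assms(1)] centered_gaussian_law(2)[OF assms(2)] assms(3) ..

lemma integrable_mult_of_squares:
  fixes X Y :: "'a \<Rightarrow> real"
  assumes [measurable]: "X \<in> borel_measurable M" "Y \<in> borel_measurable M"
    and "integrable M (\<lambda>\<omega>. (X \<omega>)\<^sup>2)" "integrable M (\<lambda>\<omega>. (Y \<omega>)\<^sup>2)"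
  shows "integrable M (\<lambda>\<omega>. X \<omega> * Y \<omega>)"
proof (rule Bochner_Integration.integrable_bound)
  show "integrable M (\<lambda>\<omega>. (X \<omega>)\<^sup>2 + (Y \<omega>)\<^sup>2)" using assms by simp
  have "\<bar>x * y\<bar> \<le> x\<^sup>2 + y\<^sup>2" for x y :: real
    using sum_squares_bound[of "\<bar>x\<bar>" "\<bar>y\<bar>"] mult_nonneg_nonneg[of "\<bar>x\<bar>" "\<bar>y\<bar>"]
    by (simp only: abs_mult power2_abs mult.assoc) linarith
  then show "AE \<omega> in M. norm (X \<omega> * Y \<omega>) \<le> norm ((X \<omega>)\<^sup>2 + (Y \<omega>)\<^sup>2)" by simp
qed measurable

context
  fixes M :: "'w measure" and H :: real and B :: "real \<Rightarrow> 'w \<Rightarrow> real"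
  assumes fbm: "fractional_brownian_motion H M B"
begin

lemma fbm_linear_combination: "finite J \<Longrightarrow> centered_gaussian M (\<lambda>\<omega>. \<Sum>t\<in>J. c t * B t \<omega>)"
  using fbm by (auto simp: fractional_brownian_motion_def)

lemma fbm_gaussian: "centered_gaussian M (B t)"
  using fbm_linear_combination[of "{t}" "\<lambda>_. 1"] by simp

lemma fbm_measurable: "B t \<in> borel_measurable M"
  using fbm_gaussian unfolding centered_gaussian_def by blast

lemma fbm_integrable_mult: "integrable M (\<lambda>\<omega>. B s \<omega> * B t \<omega>)"
  by (intro integrable_mult_of_squares fbm_measurable centered_gaussian_law(1)[OF fbm_gaussian])

lemma fbm_covariance: "(\<integral>\<omega>. B s \<omega> * B t \<omega> \<partial>M) =
    1/2 * (\<bar>t\<bar> powr (2 * H) + \<bar>s\<bar> powr (2 * H) - \<bar>t - s\<bar> powr (2 * H))"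
  using fbm by (auto simp: fractional_brownian_motion_def)

text \<open>Expanding the product, all terms that involve a single time cancel. What remains depends on
differences of times only.\<close>

lemma fbm_increment_covariance:
  "integrable M (\<lambda>\<omega>. (B a \<omega> - B b \<omega>) * (B c \<omega> - B d \<omega>))" (is ?I)
  "(\<integral>\<omega>. (B a \<omega> - B b \<omega>) * (B c \<omega> - B d \<omega>) \<partial>M) = 1/2 *
    (\<bar>c - b\<bar> powr (2 * H) + \<bar>d - a\<bar> powr (2 * H) - \<bar>c - a\<bar> powr (2 * H) - \<bar>d - b\<bar> powr (2 * H))" (is ?E)
proof -
  have eq: "(\<lambda>\<omega>. (B a \<omega> - B b \<omega>) * (B c \<omega> - B d \<omega>))
      = (\<lambda>\<omega>. B a \<omega> * B c \<omega> - B a \<omega> * B d \<omega> - (B b \<omega> * B c \<omega> - B b \<omega> * B d \<omega>))"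
    by (simp add: algebra_simps)
  show ?I unfolding eq by (intro Bochner_Integration.integrable_diff fbm_integrable_mult)
  have "(\<integral>\<omega>. (B a \<omega> - B b \<omega>) * (B c \<omega> - B d \<omega>) \<partial>M)
    = (\<integral>\<omega>. B a \<omega> * B c \<omega> \<partial>M) - (\<integral>\<omega>. B a \<omega> * B d \<omega> \<partial>M)
      - ((\<integral>\<omega>. B b \<omega> * B c \<omega> \<partial>M) - (\<integral>\<omega>. B b \<omega> * B d \<omega> \<partial>M))"
    unfolding eq
    by (simp only: Bochner_Integration.integral_diff Bochner_Integration.integrable_diff fbm_integrable_mult)
  then show ?E unfolding fbm_covariance by (simp add: algebra_simps)
qed

lemma fbm_increment_variance:
  "(\<integral>\<^sup>+\<omega>. ennreal ((B t \<omega> - B s \<omega>)\<^sup>2) \<partial>M) = ennreal (\<bar>t - s\<bar> powr (2 * H))"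
proof -
  have "(\<integral>\<^sup>+\<omega>. ennreal ((B t \<omega> - B s \<omega>)\<^sup>2) \<partial>M) = ennreal (\<integral>\<omega>. (B t \<omega> - B s \<omega>)\<^sup>2 \<partial>M)"
    unfolding power2_eq_square by (intro nn_integral_eq_integral fbm_increment_covariance) auto
  also have "(\<integral>\<omega>. (B t \<omega> - B s \<omega>)\<^sup>2 \<partial>M) = \<bar>t - s\<bar> powr (2 * H)"
    unfolding power2_eq_square fbm_increment_covariance by (simp add: abs_minus_commute)
  finally show ?thesis .
qed

text \<open>Linear combinations of the shifted increments are again linear combinations of the process, hence
centred Gaussian, and the covariance formula shows that their variances do not depend on \<open>h\<close>.\<close>

lemma fbm_stationary_increments:
  assumes "prob_space M"
  shows "distr M (PiM UNIV (\<lambda>_. borel)) (\<lambda>\<omega> t. B (t + h) \<omega> - B h \<omega>) = distr M (PiM UNIV (\<lambda>_. borel)) (\<lambda>\<omega> t. B t \<omega>)"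
proof (rule joint_law_eq)
  note [measurable] = fbm_measurable
  show "(\<lambda>\<omega>. B (i + h) \<omega> - B h \<omega>) \<in> borel_measurable M" for i by measurable
  show "B i \<in> borel_measurable M" for i by measurable
  fix J :: "real set" and c :: "real \<Rightarrow> real" assume J: "finite J"
  show "distr M borel (\<lambda>\<omega>. \<Sum>t\<in>J. c t * (B (t + h) \<omega> - B h \<omega>)) = distr M borel (\<lambda>\<omega>. \<Sum>t\<in>J. c t * B t \<omega>)"
  proof (rule centered_gaussian_distr_eq)
    show "centered_gaussian M (\<lambda>\<omega>. \<Sum>t\<in>J. c t * B t \<omega>)" by (rule fbm_linear_combination[OF J])
    \<comment> \<open>The shifted combination is indexed by the translated times together with \<open>h\<close> itself.\<close>
    define J' where "J' = (\<lambda>t. t + h) ` J"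
    have J': "finite J'" using J by (simp add: J'_def)
    obtain K c' where K: "finite K" "\<And>Z. (\<Sum>k\<in>K. c' k * Z k) = (\<Sum>k\<in>J'. c (k - h) * Z k) + (- (\<Sum>t\<in>J. c t)) * (Z h :: real)"
      using linear_combination_insert[OF J', of "\<lambda>k. c (k - h)" "- (\<Sum>t\<in>J. c t)" h] by metis
    have "(\<lambda>\<omega>. \<Sum>t\<in>J. c t * (B (t + h) \<omega> - B h \<omega>)) = (\<lambda>\<omega>. \<Sum>k\<in>K. c' k * B k \<omega>)"
      unfolding K(2) J'_def
      by (subst sum.reindex) (auto simp: inj_on_def algebra_simps sum_subtractf sum_distrib_left)
    then show "centered_gaussian M (\<lambda>\<omega>. \<Sum>t\<in>J. c t * (B (t + h) \<omega> - B h \<omega>))"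
      using fbm_linear_combination[OF K(1), of c'] by simp
    have square: "(\<lambda>\<omega>. (\<Sum>t\<in>J. c t * D t \<omega>)\<^sup>2) = (\<lambda>\<omega>. \<Sum>s\<in>J. \<Sum>t\<in>J. c s * c t * (D s \<omega> * D t \<omega>))"
      for D :: "real \<Rightarrow> 'w \<Rightarrow> real"
      by (simp add: power2_eq_square sum_product mult_ac)
    have "(\<integral>\<omega>. (\<Sum>t\<in>J. c t * (B (t + h) \<omega> - B h \<omega>))\<^sup>2 \<partial>M)
      = (\<Sum>s\<in>J. \<Sum>t\<in>J. c s * c t * (\<integral>\<omega>. (B (s + h) \<omega> - B h \<omega>) * (B (t + h) \<omega> - B h \<omega>) \<partial>M))"
      unfolding square
      by (simp add: Bochner_Integration.integral_sum Bochner_Integration.integrable_sum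
          integrable_mult_right fbm_increment_covariance(1))
    also have "\<dots> = (\<Sum>s\<in>J. \<Sum>t\<in>J. c s * c t * (\<integral>\<omega>. B s \<omega> * B t \<omega> \<partial>M))"
      unfolding fbm_increment_covariance(2) fbm_covariance by (simp add: algebra_simps abs_minus_commute)
    also have "\<dots> = (\<integral>\<omega>. (\<Sum>t\<in>J. c t * B t \<omega>)\<^sup>2 \<partial>M)"
      unfolding square
      by (simp add: Bochner_Integration.integral_sum Bochner_Integration.integrable_sum
          integrable_mult_right fbm_integrable_mult)
    finally show "(\<integral>\<omega>. (\<Sum>t\<in>J. c t * (B (t + h) \<omega> - B h \<omega>))\<^sup>2 \<partial>M) = (\<integral>\<omega>. (\<Sum>t\<in>J. c t * B t \<omega>)\<^sup>2 \<partial>M)" .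
  qed
qed (use assms in auto)

end

context
  fixes P :: "path measure" and H1 H2 :: real
  assumes law: "fbm_pair_law H1 H2 P"
begin

lemma P_prob_space: "prob_space P" and space_P: "space P = C0"
  and sets_P: "sets P = sets path_algebra"
  and fbm_fst: "fractional_brownian_motion H1 P (\<lambda>t \<omega>. fst (\<omega> t))"
  and fbm_snd: "fractional_brownian_motion H2 P (\<lambda>t \<omega>. snd (\<omega> t))"
  using law by (auto simp: fbm_pair_law_def)

lemma eval_measurable: "(\<lambda>\<omega>. \<omega> t) \<in> borel_measurable P"
proof -
  have "(\<lambda>\<omega>. \<omega> t) \<in> borel_measurable path_algebra"
    unfolding path_algebra_def by (intro measurable_restrict_space1 measurable_component_singleton) auto
  then show ?thesis by (simp cong: measurable_cong_sets add: measurable_cong_sets[OF sets_P refl])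
qed

text \<open>The path \<open>\<sigma>\<close>-algebra is generated by the evaluations.\<close>

lemma measurable_into_P:
  assumes "\<And>\<omega>. \<omega> \<in> space N \<Longrightarrow> f \<omega> \<in> C0" "\<And>t. (\<lambda>\<omega>. f \<omega> t) \<in> borel_measurable N"
  shows "f \<in> measurable N P"
proof -
  have "f \<in> measurable N path_algebra"
    unfolding path_algebra_def
    by (intro measurable_restrict_space2 measurable_PiM_single') (use assms in \<open>auto simp: space_PiM\<close>)
  then show ?thesis by (simp add: measurable_cong_sets[OF refl sets_P])
qed

lemma shift_measurable: "shift t \<in> measurable P P"
proof (rule measurable_into_P)
  note [measurable] = eval_measurable
  show "(\<lambda>\<omega>. shift t \<omega> s) \<in> borel_measurable P" for s unfolding shift_def by measurable
qed (simp add: shift_in_C0 space_P)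

text \<open>By independence the joint law of the two coordinate processes is the product of its marginals, both
before and after the shift, and the marginals agree. Every event of the path \<open>\<sigma>\<close>-algebra is an event
about the pair of coordinate processes.\<close>

lemma shift_preserves_law: "distr P P (shift h) = P"
proof -
  interpret prob_space P by (rule P_prob_space)
  define R where "R = (PiM UNIV (\<lambda>_. borel) :: (real \<Rightarrow> real) measure)"
  \<comment> \<open>\<open>S\<close> is the shift on real-valued paths, and \<open>\<Phi>\<close> inverts the splitting \<open>J\<close> of a path into its coordinates.\<close>
  define S where "S x = (\<lambda>t. x (t + h) - x h)" for x :: "real \<Rightarrow> real"
  define J where "J \<omega> = (\<lambda>t. fst (\<omega> t), \<lambda>t. snd (\<omega> t))" for \<omega> :: path
  define \<Phi> where "\<Phi> x = (\<lambda>t. (fst x t, snd x t))" for x :: "(real \<Rightarrow> real) \<times> (real \<Rightarrow> real)"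
  have S[measurable]: "S \<in> measurable R R"
    unfolding S_def R_def by (intro measurable_PiM_single') (auto simp: space_PiM)
  have indep: "indep_var R (\<lambda>\<omega> t. fst (\<omega> t)) R (\<lambda>\<omega> t. snd (\<omega> t))"
    using law by (simp add: fbm_pair_law_def R_def)
  have [measurable]: "(\<lambda>\<omega> t. fst (\<omega> t)) \<in> measurable P R" "(\<lambda>\<omega> t. snd (\<omega> t)) \<in> measurable P R"
    using indep by (auto simp: indep_var_distribution_eq)
  have J[measurable]: "J \<in> measurable P (R \<Otimes>\<^sub>M R)" unfolding J_def by measurable
  have SS: "indep_var R (S \<circ> (\<lambda>\<omega> t. fst (\<omega> t))) R (S \<circ> (\<lambda>\<omega> t. snd (\<omega> t)))"
    by (rule indep_var_compose[OF indep S S])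
  have marg1: "distr P R (S \<circ> (\<lambda>\<omega> t. fst (\<omega> t))) = distr P R (\<lambda>\<omega> t. fst (\<omega> t))"
    using fbm_stationary_increments[OF fbm_fst P_prob_space, of h] by (simp add: S_def comp_def R_def)
  have marg2: "distr P R (S \<circ> (\<lambda>\<omega> t. snd (\<omega> t))) = distr P R (\<lambda>\<omega> t. snd (\<omega> t))"
    using fbm_stationary_increments[OF fbm_snd P_prob_space, of h] by (simp add: S_def comp_def R_def)
  have "distr P (R \<Otimes>\<^sub>M R) (J \<circ> shift h)
      = distr P R (S \<circ> (\<lambda>\<omega> t. fst (\<omega> t))) \<Otimes>\<^sub>M distr P R (S \<circ> (\<lambda>\<omega> t. snd (\<omega> t)))"
    using SS by (auto simp: indep_var_distribution_eq S_def J_def shift_def comp_def)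
  also have "\<dots> = distr P (R \<Otimes>\<^sub>M R) J"
    using indep unfolding marg1 marg2 by (auto simp: indep_var_distribution_eq J_def[abs_def])
  finally have joint: "distr P (R \<Otimes>\<^sub>M R) (J \<circ> shift h) = distr P (R \<Otimes>\<^sub>M R) J" .
  show ?thesis
  proof (rule measure_eqI)
    fix A assume "A \<in> sets (distr P P (shift h))"
    then have A: "A \<in> sets P" by simp
    then obtain E where E: "E \<in> sets (PiM UNIV (\<lambda>_. borel))" "A = C0 \<inter> E"
      unfolding sets_P path_algebra_def sets_restrict_space by auto
    have \<Phi>: "\<Phi> \<in> measurable (R \<Otimes>\<^sub>M R) (PiM UNIV (\<lambda>_. borel))"
    proof (rule measurable_PiM_single')
      have [measurable]: "(\<lambda>x. x t) \<in> borel_measurable R" for t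
        unfolding R_def by (intro measurable_component_singleton) auto
      show "(\<lambda>x. \<Phi> x t) \<in> borel_measurable (R \<Otimes>\<^sub>M R)" for t
        unfolding \<Phi>_def by measurable
    qed auto
    define E' where "E' = \<Phi> -` E \<inter> space (R \<Otimes>\<^sub>M R)"
    have E': "E' \<in> sets (R \<Otimes>\<^sub>M R)" unfolding E'_def by (rule measurable_sets[OF \<Phi> E(1)])
    have \<Phi>J: "\<Phi> (J \<omega>) = \<omega>" for \<omega> by (simp add: \<Phi>_def J_def)
    have JE: "J \<omega> \<in> E' \<longleftrightarrow> \<omega> \<in> A" if "\<omega> \<in> C0" for \<omega>
      using that E(2) by (auto simp: E'_def \<Phi>J space_pair_measure R_def space_PiM)
    have "emeasure (distr P P (shift h)) A = emeasure P (shift h -` A \<inter> space P)"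
      by (rule emeasure_distr[OF shift_measurable A])
    also have "shift h -` A \<inter> space P = (J \<circ> shift h) -` E' \<inter> space P"
      using JE[OF shift_in_C0] unfolding space_P comp_def by blast
    also have "emeasure P \<dots> = emeasure (distr P (R \<Otimes>\<^sub>M R) (J \<circ> shift h)) E'"
      by (rule emeasure_distr[OF measurable_comp[OF shift_measurable J] E', symmetric])
    also have "\<dots> = emeasure P (J -` E' \<inter> space P)"
      unfolding joint by (rule emeasure_distr[OF J E'])
    also have "J -` E' \<inter> space P = A"
      using JE E(2) unfolding space_P by blast
    finally show "emeasure (distr P P (shift h)) A = emeasure P A" .
  qed simp
qed

end

section \<open>Chaining\<close>

text \<open>A dyadic point of level \<open>n + 1\<close> either belongs to level \<open>n\<close> or has its left neighbour there. One term
of \<open>Q\<close> dominates the square of the maximal increment of its level.\<close>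

lemma dyadic_increment_bound:
  fixes b :: "real \<Rightarrow> real" and Q :: "nat \<Rightarrow> real"
  defines "Q n \<equiv> (\<Sum>k<2^n. (b (real (Suc k) / 2^n) - b (real k / 2^n))\<^sup>2)"
  shows "k \<le> 2^n \<Longrightarrow> \<bar>b (real k / 2^n) - b 0\<bar> \<le> (\<Sum>j\<le>n. sqrt (Q j))"
proof (induction n arbitrary: k)
  case 0
  then have "k = 0 \<or> k = 1" by auto
  then show ?case by (auto simp: Q_def)
next
  case (Suc n)
  define i where "i = k div 2"
  have i: "i \<le> 2^n" using Suc.prems by (simp add: i_def)
  have step: "\<bar>b (real k / 2^Suc n) - b (real (2 * i) / 2^Suc n)\<bar> \<le> sqrt (Q (Suc n))"
  proof (cases "even k")
    case True
    then show ?thesis by (auto simp: i_def Q_def intro!: sum_nonneg)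
  next
    case False
    then have k: "k = Suc (2 * i)" by (simp add: i_def)
    then have "2 * i < 2^Suc n" using Suc.prems by simp
    then have "(b (real (Suc (2 * i)) / 2^Suc n) - b (real (2 * i) / 2^Suc n))\<^sup>2 \<le> Q (Suc n)"
      unfolding Q_def by (intro member_le_sum) auto
    from real_sqrt_le_mono[OF this] show ?thesis unfolding k by simp
  qed
  have "real (2 * i) / 2^Suc n = real i / 2^n" by simp
  with step Suc.IH[OF i] show ?case by simp
qed

text \<open>Cauchy--Schwarz with the geometric weights \<open>r\<^sup>j\<close> turns the sum of the square roots into a weighted sum
of the \<open>Q\<close>; continuity extends the bound from dyadic points to all points.\<close>

lemma increments_chaining_bound:
  fixes b :: "real \<Rightarrow> real" and r s :: real
  assumes cont: "continuous_on {0..1} b" and r: "0 < r" "r < 1" and s: "s \<in> {0..1}"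
  shows "ennreal ((b s - b 0)\<^sup>2)
    \<le> (\<Sum>n. ennreal (1 / (1 - r) * (1 / r)^n * (\<Sum>k<2^n. (b (real (Suc k) / 2^n) - b (real k / 2^n))\<^sup>2)))"
proof -
  define Q where "Q n = (\<Sum>k<2^n. (b (real (Suc k) / 2^n) - b (real k / 2^n))\<^sup>2)" for n :: nat
  have Q: "Q n \<ge> 0" for n unfolding Q_def by (intro sum_nonneg) auto
  define S where "S = (\<Sum>n. ennreal (1 / (1 - r) * (1 / r)^n * Q n))"
  have dyadic: "ennreal ((b (real k / 2^n) - b 0)\<^sup>2) \<le> S" if "k \<le> 2^n" for k n
  proof -
    have "(b (real k / 2^n) - b 0)\<^sup>2 \<le> (\<Sum>j\<le>n. sqrt (Q j))\<^sup>2"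
      using dyadic_increment_bound[OF that, of b] unfolding Q_def
      by (subst power2_le_iff_abs_le) (auto intro!: sum_nonneg)
    also have "(\<Sum>j\<le>n. sqrt (Q j)) = (\<Sum>j\<le>n. sqrt (r^j) * sqrt ((1 / r)^j * Q j))"
      using r by (intro sum.cong refl) (simp add: real_sqrt_mult[symmetric] power_divide)
    also have "\<dots>\<^sup>2 \<le> (\<Sum>j\<le>n. (sqrt (r^j))\<^sup>2) * (\<Sum>j\<le>n. (sqrt ((1 / r)^j * Q j))\<^sup>2)"
      by (rule Cauchy_Schwarz_ineq_sum)
    also have "\<dots> = (\<Sum>j\<le>n. r^j) * (\<Sum>j\<le>n. (1 / r)^j * Q j)" using r Q by simp
    also have "\<dots> \<le> 1 / (1 - r) * (\<Sum>j\<le>n. (1 / r)^j * Q j)"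
    proof (intro mult_right_mono sum_nonneg)
      have "(\<Sum>j\<le>n. r^j) \<le> (\<Sum>j. r^j)" using r by (intro sum_le_suminf summable_geometric) auto
      then show "(\<Sum>j\<le>n. r^j) \<le> 1 / (1 - r)" using r by (simp add: suminf_geometric)
    qed (use r Q in auto)
    finally have "ennreal ((b (real k / 2^n) - b 0)\<^sup>2) \<le> ennreal (\<Sum>j\<le>n. 1 / (1 - r) * (1 / r)^j * Q j)"
      by (intro ennreal_leI) (simp add: sum_distrib_left mult.assoc)
    also have "\<dots> = (\<Sum>j\<le>n. ennreal (1 / (1 - r) * (1 / r)^j * Q j))"
      using r Q by (intro sum_ennreal[symmetric]) auto
    also have "\<dots> \<le> S" unfolding S_def by (intro sum_le_suminf) auto
    finally show ?thesis .
  qed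
  \<comment> \<open>Dyadic approximation of \<open>s\<close> from below.\<close>
  define x where "x n = real (nat \<lfloor>s * 2^n\<rfloor>) / 2^n" for n :: nat
  have xk: "nat \<lfloor>s * 2^n\<rfloor> \<le> 2^n" for n
  proof -
    have "s * 2^n \<le> 1 * 2^n" using s by (intro mult_right_mono) auto
    from floor_mono[OF this] have "\<lfloor>s * 2^n\<rfloor> \<le> 2^n" by simp
    then show ?thesis by (simp add: nat_le_iff)
  qed
  have x01: "x n \<in> {0..1}" for n
  proof -
    have "real (nat \<lfloor>s * 2^n\<rfloor>) \<le> real (2^n)" using xk[of n] by (simp only: of_nat_le_iff)
    then show ?thesis unfolding x_def by (simp add: divide_le_eq_1)
  qed
  have "x \<longlonglongrightarrow> s"
  proof (rule tendsto_sandwich)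
    show "(\<lambda>n. s - 1 / 2^n) \<longlonglongrightarrow> s" by real_asymp
    have "s * 2^n - 1 \<le> real (nat \<lfloor>s * 2^n\<rfloor>)" "real (nat \<lfloor>s * 2^n\<rfloor>) \<le> s * 2^n" for n :: nat
      using s by (simp_all add: of_nat_nat)
    note fl = this
    have "s - 1 / 2^n \<le> x n" for n
    proof -
      have "s - 1 / 2^n = (s * 2^n - 1) / 2^n" by (simp add: diff_divide_distrib)
      also have "\<dots> \<le> x n" unfolding x_def by (rule divide_right_mono[OF fl(1)]) simp
      finally show ?thesis .
    qed
    then show "\<forall>\<^sub>F n in sequentially. s - 1 / 2^n \<le> x n" by simp
    have "x n \<le> s" for n
    proof -
      have "x n \<le> s * 2^n / 2^n" unfolding x_def by (rule divide_right_mono[OF fl(2)]) simp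
      then show ?thesis by simp
    qed
    then show "\<forall>\<^sub>F n in sequentially. x n \<le> s" by simp
  qed (rule tendsto_const)
  then have "(\<lambda>n. b (x n)) \<longlonglongrightarrow> b s"
    by (rule continuous_on_tendsto_compose[OF cont _ s]) (use x01 in simp)
  then have "(\<lambda>n. ennreal ((b (x n) - b 0)\<^sup>2)) \<longlonglongrightarrow> ennreal ((b s - b 0)\<^sup>2)"
    by (intro tendsto_ennrealI tendsto_intros)
  then have "ennreal ((b s - b 0)\<^sup>2) \<le> S"
  proof (rule LIMSEQ_le_const2)
    have "ennreal ((b (x n) - b 0)\<^sup>2) \<le> S" for n
      using dyadic[OF xk] unfolding x_def .
    then show "\<exists>N. \<forall>n\<ge>N. ennreal ((b (x n) - b 0)\<^sup>2) \<le> S" by blast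
  qed
  then show ?thesis unfolding S_def Q_def .
qed

text \<open>Level \<open>n\<close> has \<open>2\<^sup>n\<close> increments of variance \<open>(T / 2\<^sup>n)\<^bsup>2H\<^esup>\<close>, so its total variance is
\<open>T\<^bsup>2H\<^esup> r\<^bsup>2n\<^esup>\<close> with \<open>r\<^sup>2 = 2\<^bsup>1 - 2H\<^esup> < 1\<close>. Weighting level \<open>n\<close> by \<open>r\<^sup>-\<^sup>n\<close> leaves a convergent geometric series.
Because \<open>H > 1/2\<close>, second moments suffice. The measurable majorant \<open>S\<close> replaces the supremum over
uncountably many times.\<close>

lemma chaining:
  fixes B :: "real \<Rightarrow> 'w \<Rightarrow> real"
  assumes [measurable]: "\<And>t. B t \<in> borel_measurable M"
    and cont: "\<And>\<omega>. \<omega> \<in> space M \<Longrightarrow> continuous_on UNIV (\<lambda>t. B t \<omega>)"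
    and var: "\<And>s t. (\<integral>\<^sup>+\<omega>. ennreal ((B t \<omega> - B s \<omega>)\<^sup>2) \<partial>M) \<le> ennreal (\<bar>t - s\<bar> powr (2 * H))"
    and H: "1/2 < H"
  shows "\<exists>C\<ge>0. \<forall>a T. T > 0 \<longrightarrow> (\<exists>S\<in>borel_measurable M.
      (\<forall>\<omega>\<in>space M. \<forall>s\<in>{a..a + T}. ennreal ((B s \<omega> - B a \<omega>)\<^sup>2) \<le> S \<omega>) \<and>
      (\<integral>\<^sup>+\<omega>. S \<omega> \<partial>M) \<le> ennreal (C * T powr (2 * H)))"
proof -
  define r :: real where "r = 2 powr ((1 - 2 * H) / 2)"
  have r: "0 < r" "r < 1" using H by (auto simp: r_def powr_less_one)
  have rr: "r * r = 2 * (1 / 2) powr (2 * H)"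
  proof -
    have "r * r = 2 powr (1 - 2 * H)" unfolding r_def by (simp flip: powr_add)
    also have "\<dots> = 2 * (1 / 2) powr (2 * H)" by (simp add: powr_diff powr_divide)
    finally show ?thesis .
  qed
  show ?thesis
  proof (intro exI[of _ "1 / (1 - r)\<^sup>2"] conjI allI impI)
    show "0 \<le> 1 / (1 - r)\<^sup>2" by simp
    fix a T :: real assume T: "T > 0"
    define D where "D n k \<omega> = (B (a + T * (real (Suc k) / 2^n)) \<omega> - B (a + T * (real k / 2^n)) \<omega>)\<^sup>2"
      for n k :: nat and \<omega>
    define S where "S \<omega> = (\<Sum>n. ennreal (1 / (1 - r) * (1 / r)^n * (\<Sum>k<2^n. D n k \<omega>)))" for \<omega>
    have [measurable]: "D n k \<in> borel_measurable M" for n k unfolding D_def by measurable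
    have D0: "D n k \<omega> \<ge> 0" for n k \<omega> by (simp add: D_def)
    show "\<exists>S\<in>borel_measurable M.
      (\<forall>\<omega>\<in>space M. \<forall>s\<in>{a..a + T}. ennreal ((B s \<omega> - B a \<omega>)\<^sup>2) \<le> S \<omega>) \<and>
      (\<integral>\<^sup>+\<omega>. S \<omega> \<partial>M) \<le> ennreal (1 / (1 - r)\<^sup>2 * T powr (2 * H))"
    proof (rule bexI[of _ S], intro conjI ballI)
      show "S \<in> borel_measurable M" unfolding S_def by measurable
      fix \<omega> s assume \<omega>: "\<omega> \<in> space M" and s: "s \<in> {a..a + T}"
      have "continuous_on {0..1} (\<lambda>u. B (a + T * u) \<omega>)"
        by (intro continuous_on_compose2[OF cont[OF \<omega>]] continuous_intros) auto
      moreover have "(s - a) / T \<in> {0..1}" using s T by auto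
      ultimately have "ennreal ((B (a + T * ((s - a) / T)) \<omega> - B (a + T * 0) \<omega>)\<^sup>2) \<le> S \<omega>"
        unfolding S_def D_def by (rule increments_chaining_bound[OF _ r])
      then show "ennreal ((B s \<omega> - B a \<omega>)\<^sup>2) \<le> S \<omega>" using T by simp
    next
      have D_int: "(\<integral>\<^sup>+\<omega>. ennreal (D n k \<omega>) \<partial>M) \<le> ennreal (T powr (2 * H) * ((1 / 2) powr (2 * H))^n)" for n k
      proof -
        have "\<bar>a + T * (real (Suc k) / 2^n) - (a + T * (real k / 2^n))\<bar> = T * (1 / 2)^n"
          using T by (simp add: field_simps)
        then have "(\<integral>\<^sup>+\<omega>. ennreal (D n k \<omega>) \<partial>M) \<le> ennreal ((T * (1 / 2)^n) powr (2 * H))"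
          unfolding D_def using var by metis
        also have "(T * (1 / 2)^n) powr (2 * H) = T powr (2 * H) * ((1 / 2) powr (2 * H))^n"
          using T by (simp add: powr_mult powr_power powr_realpow[symmetric] powr_powr mult.commute)
        finally show ?thesis .
      qed
      have "(\<integral>\<^sup>+\<omega>. S \<omega> \<partial>M) = (\<Sum>n. \<integral>\<^sup>+\<omega>. ennreal (1 / (1 - r) * (1 / r)^n * (\<Sum>k<2^n. D n k \<omega>)) \<partial>M)"
        unfolding S_def by (intro nn_integral_suminf) measurable
      also have "\<dots> \<le> (\<Sum>n. ennreal (1 / (1 - r) * T powr (2 * H) * r^n))"
      proof (intro suminf_le allI)
        fix n :: nat
        have "(\<integral>\<^sup>+\<omega>. ennreal (1 / (1 - r) * (1 / r)^n * (\<Sum>k<2^n. D n k \<omega>)) \<partial>M)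
          = ennreal (1 / (1 - r) * (1 / r)^n) * (\<Sum>k<2^n. \<integral>\<^sup>+\<omega>. ennreal (D n k \<omega>) \<partial>M)"
        proof -
          have "ennreal (1 / (1 - r) * (1 / r)^n * (\<Sum>k<2^n. D n k \<omega>))
            = ennreal (1 / (1 - r) * (1 / r)^n) * (\<Sum>k<2^n. ennreal (D n k \<omega>))" for \<omega>
            using r D0 by (subst ennreal_mult) (auto intro!: sum_nonneg sum_ennreal[symmetric])
          then show ?thesis by (simp add: nn_integral_cmult nn_integral_sum del: times_divide_eq_left times_divide_eq_right)
        qed
        also have "\<dots> \<le> ennreal (1 / (1 - r) * (1 / r)^n) * (\<Sum>k<(2::nat)^n. ennreal (T powr (2 * H) * ((1 / 2) powr (2 * H))^n))"
          by (intro mult_left_mono sum_mono D_int) auto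
        also have "\<dots> = ennreal (1 / (1 - r) * (1 / r)^n) * ennreal (2^n * (T powr (2 * H) * ((1 / 2) powr (2 * H))^n))"
          by (simp add: ennreal_mult'' ennreal_of_nat_eq_real_of_nat flip: ennreal_power)
        also have "\<dots> = ennreal ((1 / (1 - r) * (1 / r)^n) * (2^n * (T powr (2 * H) * ((1 / 2) powr (2 * H))^n)))"
          using r by (intro ennreal_mult[symmetric]) auto
        also have "(1 / (1 - r) * (1 / r)^n) * (2^n * (T powr (2 * H) * ((1 / 2) powr (2 * H))^n))
          = 1 / (1 - r) * T powr (2 * H) * ((1 / r) * (2 * (1 / 2) powr (2 * H)))^n"
          by (simp only: power_mult_distrib mult_ac)
        also have "(1 / r) * (2 * (1 / 2) powr (2 * H)) = r" unfolding rr[symmetric] using r by simp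
        finally show "(\<integral>\<^sup>+\<omega>. ennreal (1 / (1 - r) * (1 / r)^n * (\<Sum>k<2^n. D n k \<omega>)) \<partial>M)
          \<le> ennreal (1 / (1 - r) * T powr (2 * H) * r^n)" .
      qed auto
      also have "\<dots> = ennreal (\<Sum>n. 1 / (1 - r) * T powr (2 * H) * r^n)"
        using r by (intro suminf_ennreal2 summable_mult summable_geometric) auto
      also have "(\<Sum>n. 1 / (1 - r) * T powr (2 * H) * r^n) = 1 / (1 - r)\<^sup>2 * T powr (2 * H)"
        using r by (subst suminf_mult) (auto simp: summable_geometric suminf_geometric power2_eq_square)
      finally show "(\<integral>\<^sup>+\<omega>. S \<omega> \<partial>M) \<le> ennreal (1 / (1 - r)\<^sup>2 * T powr (2 * H))" .
    qed
  qed
qed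

section \<open>The maximal ergodic inequality\<close>

text \<open>The maximum of \<open>0\<close> and the first \<open>n\<close> ergodic sums of \<open>f\<close>, in the recursive form on which Garsia's
proof of the maximal ergodic inequality rests.\<close>

primrec maximal_sum :: "('w \<Rightarrow> 'w) \<Rightarrow> ('w \<Rightarrow> real) \<Rightarrow> nat \<Rightarrow> 'w \<Rightarrow> real" where
  "maximal_sum \<tau> f 0 = (\<lambda>\<omega>. 0)"
| "maximal_sum \<tau> f (Suc n) = (\<lambda>\<omega>. max 0 (f \<omega> + maximal_sum \<tau> f n (\<tau> \<omega>)))"

context
  fixes M :: "'w measure" and \<tau> :: "'w \<Rightarrow> 'w"
  assumes M: "prob_space M" and \<tau>[measurable]: "\<tau> \<in> measurable M M" and pres: "distr M M \<tau> = M"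
begin

lemma integral_preserved:
  fixes g :: "'w \<Rightarrow> real"
  assumes "integrable M g"
  shows "integrable M (\<lambda>\<omega>. g (\<tau> \<omega>))" "(\<integral>\<omega>. g (\<tau> \<omega>) \<partial>M) = (\<integral>\<omega>. g \<omega> \<partial>M)"
proof -
  have g: "g \<in> borel_measurable M" using assms by simp
  show "integrable M (\<lambda>\<omega>. g (\<tau> \<omega>))"
    using integrable_distr_eq[OF \<tau> g] assms by (simp add: pres)
  show "(\<integral>\<omega>. g (\<tau> \<omega>) \<partial>M) = (\<integral>\<omega>. g \<omega> \<partial>M)"
    using integral_distr[OF \<tau> g] by (simp add: pres)
qed

lemma maximal_sum_integrable:
  assumes "integrable M f"
  shows "integrable M (maximal_sum \<tau> f n)"
proof (induction n)
  case (Suc n)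
  then show ?case using assms by (simp add: integral_preserved(1))
qed simp

text \<open>Garsia's argument for \<open>f = Y - c\<close>: where the maximal sum \<open>m\<close> is positive, \<open>m \<le> f + m \<circ> \<tau>\<close>, and elsewhere
\<open>m - m \<circ> \<tau> \<le> 0\<close>. Integrating \<open>m - m \<circ> \<tau>\<close>, whose mean is \<open>0\<close>, yields the inequality.\<close>

lemma maximal_ergodic:
  fixes Y :: "'w \<Rightarrow> real"
  assumes Y: "integrable M Y" "\<And>\<omega>. 0 \<le> Y \<omega>" and "c > 0"
  shows "measure M {\<omega>\<in>space M. \<exists>n. c * real n < (\<Sum>k<n. Y ((\<tau> ^^ k) \<omega>))} \<le> (\<integral>\<omega>. Y \<omega> \<partial>M) / c"
proof -
  interpret prob_space M by (rule M)
  define f where "f \<omega> = Y \<omega> - c" for \<omega>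
  have f: "integrable M f" unfolding f_def using Y by simp
  note int = maximal_sum_integrable[OF f]
  have [measurable]: "maximal_sum \<tau> f n \<in> borel_measurable M" for n using int by blast
  have pos: "maximal_sum \<tau> f n \<omega> \<ge> 0" for n \<omega> by (cases n) auto
  have mono: "maximal_sum \<tau> f n \<omega> \<le> maximal_sum \<tau> f (Suc n) \<omega>" for n \<omega>
    by (induction n arbitrary: \<omega>) (auto simp: max.coboundedI2)
  have sums: "(\<Sum>k<n. f ((\<tau> ^^ k) \<omega>)) \<le> maximal_sum \<tau> f n \<omega>" for n \<omega>
  proof (induction n arbitrary: \<omega>)
    case (Suc n)
    have "(\<Sum>k<Suc n. f ((\<tau> ^^ k) \<omega>)) = f \<omega> + (\<Sum>k<n. f ((\<tau> ^^ k) (\<tau> \<omega>)))"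
      by (subst sum.lessThan_Suc_shift) (simp add: funpow_swap1)
    also have "\<dots> \<le> f \<omega> + maximal_sum \<tau> f n (\<tau> \<omega>)" using Suc by simp
    finally show ?case by simp
  qed simp
  define E where "E n = {\<omega>\<in>space M. 0 < maximal_sum \<tau> f n \<omega>}" for n
  have E[measurable]: "E n \<in> sets M" for n unfolding E_def by measurable
  have E_bound: "c * measure M (E n) \<le> (\<integral>\<omega>. Y \<omega> \<partial>M)" for n
  proof -
    have "0 = (\<integral>\<omega>. maximal_sum \<tau> f n \<omega> - maximal_sum \<tau> f n (\<tau> \<omega>) \<partial>M)"
      using integral_preserved[OF int] int by simp
    also have "\<dots> \<le> (\<integral>\<omega>. Y \<omega> - c * indicator (E n) \<omega> \<partial>M)"
    proof (rule integral_mono)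
      show "integrable M (\<lambda>\<omega>. maximal_sum \<tau> f n \<omega> - maximal_sum \<tau> f n (\<tau> \<omega>))"
        by (intro Bochner_Integration.integrable_diff int integral_preserved)
      show "integrable M (\<lambda>\<omega>. Y \<omega> - c * indicator (E n) \<omega>)"
        using Y by (intro Bochner_Integration.integrable_diff integrable_mult_right integrable_real_indicator)
          (auto simp: emeasure_eq_measure)
      fix \<omega> assume \<omega>: "\<omega> \<in> space M"
      show "maximal_sum \<tau> f n \<omega> - maximal_sum \<tau> f n (\<tau> \<omega>) \<le> Y \<omega> - c * indicator (E n) \<omega>"
      proof (cases "\<omega> \<in> E n")
        case True
        then obtain m where m: "n = Suc m" by (cases n) (auto simp: E_def)
        have "maximal_sum \<tau> f n \<omega> = f \<omega> + maximal_sum \<tau> f m (\<tau> \<omega>)" using True by (auto simp: E_def m)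
        also have "\<dots> \<le> f \<omega> + maximal_sum \<tau> f n (\<tau> \<omega>)" using mono[of m "\<tau> \<omega>"] by (simp only: m add_left_mono)
        finally show ?thesis using True by (simp add: f_def)
      next
        case False
        then have "maximal_sum \<tau> f n \<omega> = 0" using \<omega> pos[of n \<omega>] by (auto simp: E_def)
        then show ?thesis using False pos[of n "\<tau> \<omega>"] Y(2)[of \<omega>] by simp
      qed
    qed
    also have "\<dots> = (\<integral>\<omega>. Y \<omega> \<partial>M) - c * measure M (E n)"
      using Y(1) by (subst Bochner_Integration.integral_diff) (auto simp: emeasure_eq_measure intro!: integrable_mult_right integrable_real_indicator)
    finally show ?thesis by simp
  qed
  have "incseq E"
    by (rule incseq_SucI) (use mono order_less_le_trans in \<open>fastforce simp: E_def simp del: maximal_sum.simps\<close>)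
  then have "(\<lambda>n. measure M (E n)) \<longlonglongrightarrow> measure M (\<Union>n. E n)"
    by (intro finite_Lim_measure_incseq) auto
  then have "measure M (\<Union>n. E n) \<le> (\<integral>\<omega>. Y \<omega> \<partial>M) / c"
    by (rule LIMSEQ_le_const2) (use E_bound \<open>c > 0\<close> in \<open>auto simp: field_simps\<close>)
  moreover have "{\<omega>\<in>space M. \<exists>n. c * real n < (\<Sum>k<n. Y ((\<tau> ^^ k) \<omega>))} \<subseteq> (\<Union>n. E n)"
  proof clarify
    fix \<omega> n assume "\<omega> \<in> space M" and n: "c * real n < (\<Sum>k<n. Y ((\<tau> ^^ k) \<omega>))"
    from n have "0 < (\<Sum>k<n. f ((\<tau> ^^ k) \<omega>))" by (simp add: f_def sum_subtractf mult.commute)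
    also have "\<dots> \<le> maximal_sum \<tau> f n \<omega>" by (rule sums)
    finally show "\<omega> \<in> (\<Union>n. E n)" using \<open>\<omega> \<in> space M\<close> by (auto simp: E_def)
  qed
  then have "measure M {\<omega>\<in>space M. \<exists>n. c * real n < (\<Sum>k<n. Y ((\<tau> ^^ k) \<omega>))} \<le> measure M (\<Union>n. E n)"
    by (intro finite_measure_mono) auto
  ultimately show ?thesis by simp
qed

lemma AE_bounded_averages:
  fixes Y :: "'w \<Rightarrow> real"
  assumes Y: "integrable M Y" "\<And>\<omega>. 0 \<le> Y \<omega>"
  shows "AE \<omega> in M. \<exists>c::nat. \<forall>n. (\<Sum>k<n. Y ((\<tau> ^^ k) \<omega>)) \<le> real c * real n"
proof -
  interpret prob_space M by (rule M)
  define E where "E c = {\<omega>\<in>space M. \<exists>n. real c * real n < (\<Sum>k<n. Y ((\<tau> ^^ k) \<omega>))}" for c :: nat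
  have [measurable]: "Y \<in> borel_measurable M" using Y by simp
  have [measurable]: "(\<tau> ^^ k) \<in> measurable M M" for k by (induction k) (auto simp: id_def[symmetric])
  have [measurable]: "E c \<in> sets M" for c unfolding E_def by measurable
  have "measure M (\<Inter>c. E c) \<le> 0"
  proof (rule LIMSEQ_le_const)
    show "(\<lambda>c. (\<integral>\<omega>. Y \<omega> \<partial>M) / real (Suc c)) \<longlonglongrightarrow> 0" by (rule LIMSEQ_Suc[OF lim_const_over_n])
    have "measure M (\<Inter>c. E c) \<le> (\<integral>\<omega>. Y \<omega> \<partial>M) / real (Suc c)" for c
    proof -
      have "measure M (\<Inter>c. E c) \<le> measure M (E (Suc c))" by (intro finite_measure_mono) auto
      also have "\<dots> \<le> (\<integral>\<omega>. Y \<omega> \<partial>M) / real (Suc c)"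
        unfolding E_def by (rule maximal_ergodic[OF Y]) simp
      finally show ?thesis .
    qed
    then show "\<exists>N. \<forall>c\<ge>N. measure M (\<Inter>c. E c) \<le> (\<integral>\<omega>. Y \<omega> \<partial>M) / real (Suc c)" by blast
  qed
  then have "measure M (\<Inter>c. E c) = 0" using measure_nonneg[of M] by (simp add: order_antisym)
  then have "(\<Inter>c. E c) \<in> null_sets M" by (auto simp: null_sets_def emeasure_eq_measure)
  then show ?thesis by (rule AE_I') (auto simp: E_def not_le)
qed

end

section \<open>Paths with controlled growth\<close>

definition sublinear :: "path \<Rightarrow> bool" where
  "sublinear \<omega> \<longleftrightarrow> (\<forall>\<epsilon>>0. \<exists>R. \<forall>t. R \<le> \<bar>t\<bar> \<longrightarrow> norm (\<omega> t) \<le> \<epsilon> * \<bar>t\<bar>)"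

text \<open>This functional controls the square of the Ornstein--Uhlenbeck process on a unit interval. The supremum
runs over rational times so that measurability is evident, and over both signs so that it behaves
well under every shift.\<close>

definition weighted_sup :: "path \<Rightarrow> ennreal" where
  "weighted_sup \<omega> = (SUP q\<in>\<rat>. ennreal (exp (- \<bar>q\<bar>) * (norm (\<omega> q))\<^sup>2))"

text \<open>These two conditions replace convergence of ergodic averages: the first makes the averages of the
Ornstein--Uhlenbeck processes vanish, the second keeps those of their squares bounded.\<close>

definition good_paths :: "path set" where
  "good_paths = {\<omega>\<in>C0. sublinear \<omega> \<and>
     (\<exists>c::nat. \<forall>n::nat. (\<Sum>k<n. weighted_sup (shift (- real k) \<omega>)) \<le> of_nat (c * n))}"

lemma real_le_of_rational_le:
  fixes f g :: "real \<Rightarrow> real"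
  assumes "continuous_on UNIV f" "continuous_on UNIV g" "\<And>q. q \<in> \<rat> \<Longrightarrow> f q \<le> g q"
  shows "f t \<le> g t"
proof -
  have "closed {t. f t \<le> g t}" by (intro closed_Collect_le assms)
  moreover have "\<rat> \<subseteq> {t. f t \<le> g t}" using assms(3) by auto
  ultimately have "closure \<rat> \<subseteq> {t. f t \<le> g t}" by (rule closure_minimal[rotated])
  then show ?thesis by (auto simp: Rats_closure_real)
qed

lemma le_weighted_sup:
  assumes "\<omega> \<in> C0"
  shows "ennreal (exp (- \<bar>t\<bar>) * (norm (\<omega> t))\<^sup>2) \<le> weighted_sup \<omega>"
proof (cases "weighted_sup \<omega>")
  case (real c)
  have "exp (- \<bar>t\<bar>) * (norm (\<omega> t))\<^sup>2 \<le> c"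
  proof (rule real_le_of_rational_le[where f = "\<lambda>t. exp (- \<bar>t\<bar>) * (norm (\<omega> t))\<^sup>2" and g = "\<lambda>_. c"])
    show "continuous_on UNIV (\<lambda>t. exp (- \<bar>t\<bar>) * (norm (\<omega> t))\<^sup>2)"
      using assms by (intro continuous_intros) (auto simp: C0_def)
    fix q :: real assume "q \<in> \<rat>"
    then have "ennreal (exp (- \<bar>q\<bar>) * (norm (\<omega> q))\<^sup>2) \<le> ennreal c"
      unfolding real(2)[symmetric] weighted_sup_def by (intro SUP_upper)
    then show "exp (- \<bar>q\<bar>) * (norm (\<omega> q))\<^sup>2 \<le> c" using real(1) by (simp add: ennreal_le_iff)
  qed auto
  then show ?thesis unfolding real(2) by (rule ennreal_leI)
qed simp

text \<open>A shift by \<open>r\<close> changes the weight at most by the factor \<open>exp \<bar>r\<bar>\<close>, and the value subtracted in the shift is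
itself controlled with the same factor. Therefore the condition on the averages over integer shifts is
invariant under all real shifts.\<close>

lemma weighted_sup_shift_le:
  assumes "\<omega> \<in> C0"
  shows "weighted_sup (shift r \<omega>) \<le> ennreal (4 * exp \<bar>r\<bar>) * weighted_sup \<omega>"
proof -
  have "ennreal (exp (- \<bar>q\<bar>) * (norm (shift r \<omega> q))\<^sup>2) \<le> ennreal (4 * exp \<bar>r\<bar>) * weighted_sup \<omega>" for q
  proof -
    have w: "exp (- \<bar>q\<bar>) * z \<le> exp \<bar>r\<bar> * (exp (- \<bar>u\<bar>) * z)" if "\<bar>u\<bar> \<le> \<bar>q\<bar> + \<bar>r\<bar>" "0 \<le> z" for u z
    proof -
      have "exp (- \<bar>q\<bar>) \<le> exp \<bar>r\<bar> * exp (- \<bar>u\<bar>)" using that by (simp flip: exp_add)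
      from mult_right_mono[OF this that(2)] show ?thesis by (simp add: mult.assoc)
    qed
    have "exp (- \<bar>q\<bar>) * (norm (shift r \<omega> q))\<^sup>2 \<le> exp (- \<bar>q\<bar>) * (2 * (norm (\<omega> (q + r)))\<^sup>2 + 2 * (norm (\<omega> r))\<^sup>2)"
      unfolding shift_def by (intro mult_left_mono norm_diff_power2_le) auto
    also have "\<dots> \<le> 2 * exp \<bar>r\<bar> * (exp (- \<bar>q + r\<bar>) * (norm (\<omega> (q + r)))\<^sup>2)
        + 2 * exp \<bar>r\<bar> * (exp (- \<bar>r\<bar>) * (norm (\<omega> r))\<^sup>2)"
      using w[OF abs_triangle_ineq, of "(norm (\<omega> (q + r)))\<^sup>2"] w[of r "(norm (\<omega> r))\<^sup>2"] by (simp add: algebra_simps)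
    finally have "ennreal (exp (- \<bar>q\<bar>) * (norm (shift r \<omega> q))\<^sup>2)
      \<le> ennreal (2 * exp \<bar>r\<bar> * (exp (- \<bar>q + r\<bar>) * (norm (\<omega> (q + r)))\<^sup>2)
        + 2 * exp \<bar>r\<bar> * (exp (- \<bar>r\<bar>) * (norm (\<omega> r))\<^sup>2))" by (rule ennreal_leI)
    also have "\<dots> = ennreal (2 * exp \<bar>r\<bar>) * ennreal (exp (- \<bar>q + r\<bar>) * (norm (\<omega> (q + r)))\<^sup>2)
        + ennreal (2 * exp \<bar>r\<bar>) * ennreal (exp (- \<bar>r\<bar>) * (norm (\<omega> r))\<^sup>2)"
      by (subst ennreal_plus) (auto simp: ennreal_mult)
    also have "\<dots> \<le> ennreal (2 * exp \<bar>r\<bar>) * weighted_sup \<omega> + ennreal (2 * exp \<bar>r\<bar>) * weighted_sup \<omega>"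
      by (intro add_mono mult_left_mono le_weighted_sup assms) auto
    also have "\<dots> = (ennreal (2 * exp \<bar>r\<bar>) + ennreal (2 * exp \<bar>r\<bar>)) * weighted_sup \<omega>"
      by (rule distrib_right[symmetric])
    also have "ennreal (2 * exp \<bar>r\<bar>) + ennreal (2 * exp \<bar>r\<bar>) = ennreal (4 * exp \<bar>r\<bar>)"
      by (subst ennreal_plus[symmetric]) auto
    finally show ?thesis .
  qed
  then show ?thesis by (subst weighted_sup_def) (rule SUP_least)
qed

lemma sublinear_shift:
  assumes "sublinear \<omega>"
  shows "sublinear (shift t \<omega>)"
  unfolding sublinear_def
proof (intro allI impI)
  fix \<epsilon> :: real assume "\<epsilon> > 0"
  then have "\<epsilon> / 2 > 0" by simp
  then obtain R where R: "\<And>s. R \<le> \<bar>s\<bar> \<Longrightarrow> norm (\<omega> s) \<le> \<epsilon> / 2 * \<bar>s\<bar>"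
    using assms unfolding sublinear_def by blast
  define R' where "R' = \<bar>R\<bar> + \<bar>t\<bar> + (\<epsilon> / 2 * \<bar>t\<bar> + norm (\<omega> t)) / (\<epsilon> / 2)"
  have "norm (shift t \<omega> s) \<le> \<epsilon> * \<bar>s\<bar>" if s: "R' \<le> \<bar>s\<bar>" for s
  proof -
    have nn: "0 \<le> (\<epsilon> / 2 * \<bar>t\<bar> + norm (\<omega> t)) / (\<epsilon> / 2)" using \<open>\<epsilon> > 0\<close> by simp
    then have "R \<le> \<bar>s + t\<bar>" "(\<epsilon> / 2 * \<bar>t\<bar> + norm (\<omega> t)) / (\<epsilon> / 2) \<le> \<bar>s\<bar>"
      using s unfolding R'_def by linarith+
    then have 1: "norm (\<omega> (s + t)) \<le> \<epsilon> / 2 * \<bar>s + t\<bar>" and 2: "\<epsilon> / 2 * \<bar>t\<bar> + norm (\<omega> t) \<le> \<bar>s\<bar> * (\<epsilon> / 2)"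
      using R \<open>\<epsilon> / 2 > 0\<close> by (auto simp only: pos_divide_le_eq)
    have "\<epsilon> / 2 * \<bar>s + t\<bar> \<le> \<epsilon> / 2 * (\<bar>s\<bar> + \<bar>t\<bar>)" using \<open>\<epsilon> > 0\<close> by (intro mult_left_mono) auto
    with 1 2 norm_triangle_ineq4[of "\<omega> (s + t)" "\<omega> t"] show ?thesis
      unfolding shift_def by (simp add: algebra_simps)
  qed
  then show "\<exists>R. \<forall>s. R \<le> \<bar>s\<bar> \<longrightarrow> norm (shift t \<omega> s) \<le> \<epsilon> * \<bar>s\<bar>" by blast
qed

lemma shift_good_paths:
  assumes "\<omega> \<in> good_paths"
  shows "shift t \<omega> \<in> good_paths"
proof -
  have \<omega>: "\<omega> \<in> C0" "sublinear \<omega>" using assms by (auto simp: good_paths_def)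
  obtain c :: nat where c: "\<And>n. (\<Sum>k<n. weighted_sup (shift (- real k) \<omega>)) \<le> of_nat (c * n)"
    using assms by (auto simp: good_paths_def)
  \<comment> \<open>A natural upper bound of the factor in \<open>weighted_sup_shift_le\<close>.\<close>
  define a where "a = nat \<lceil>4 * exp \<bar>t\<bar>\<rceil>"
  have a: "ennreal (4 * exp \<bar>t\<bar>) \<le> of_nat a"
    unfolding a_def ennreal_of_nat_eq_real_of_nat by (intro ennreal_leI real_nat_ceiling_ge)
  have "(\<Sum>k<n. weighted_sup (shift (- real k) (shift t \<omega>))) \<le> of_nat (a * c * n)" for n
  proof -
    have "(\<Sum>k<n. weighted_sup (shift (- real k) (shift t \<omega>)))
      = (\<Sum>k<n. weighted_sup (shift t (shift (- real k) \<omega>)))"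
      by (simp add: shift_shift add.commute)
    also have "\<dots> \<le> (\<Sum>k<n. of_nat a * weighted_sup (shift (- real k) \<omega>))"
      by (intro sum_mono order_trans[OF weighted_sup_shift_le] mult_right_mono a shift_in_C0 \<omega>) auto
    also have "\<dots> \<le> of_nat a * of_nat (c * n)"
      unfolding sum_distrib_left[symmetric] by (intro mult_left_mono c) auto
    finally show ?thesis by (simp add: mult.assoc)
  qed
  then have "\<exists>c::nat. \<forall>n. (\<Sum>k<n. weighted_sup (shift (- real k) (shift t \<omega>))) \<le> of_nat (c * n)"
    by blast
  then show ?thesis unfolding good_paths_def using \<omega> by (simp add: shift_in_C0 sublinear_shift)
qed

text \<open>Countably many conditions on rational times describe sublinearity on continuous paths; the constant
\<open>m\<close> inside the maximum absorbs the compact time interval on which nothing is required.\<close>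

lemma sublinear_iff_rational:
  assumes "\<omega> \<in> C0"
  shows "sublinear \<omega> \<longleftrightarrow> (\<forall>n::nat. \<exists>m::nat. \<forall>q\<in>\<rat>. norm (\<omega> q) \<le> max (real m) (\<bar>q\<bar> / real (Suc n)))"
proof
  assume sub: "sublinear \<omega>"
  show "\<forall>n::nat. \<exists>m::nat. \<forall>q\<in>\<rat>. norm (\<omega> q) \<le> max (real m) (\<bar>q\<bar> / real (Suc n))"
  proof
    fix n :: nat
    have "1 / real (Suc n) > 0" by simp
    then obtain R where R: "\<And>t. R \<le> \<bar>t\<bar> \<Longrightarrow> norm (\<omega> t) \<le> 1 / real (Suc n) * \<bar>t\<bar>"
      using sub unfolding sublinear_def by blast
    have "bounded (\<omega> ` {- \<bar>R\<bar>..\<bar>R\<bar>})"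
      using assms by (intro compact_imp_bounded compact_continuous_image) (auto simp: C0_def intro: continuous_on_subset)
    then obtain b where b: "\<And>t. t \<in> {- \<bar>R\<bar>..\<bar>R\<bar>} \<Longrightarrow> norm (\<omega> t) \<le> b" unfolding bounded_iff by blast
    obtain m :: nat where m: "b \<le> real m" using real_arch_simple by blast
    have "norm (\<omega> q) \<le> max (real m) (\<bar>q\<bar> / real (Suc n))" for q
    proof (cases "R \<le> \<bar>q\<bar>")
      case True then show ?thesis using R[of q] by simp
    next
      case False
      then have "q \<in> {- \<bar>R\<bar>..\<bar>R\<bar>}" by auto
      from b[OF this] m show ?thesis by simp
    qed
    then show "\<exists>m::nat. \<forall>q\<in>\<rat>. norm (\<omega> q) \<le> max (real m) (\<bar>q\<bar> / real (Suc n))" by blast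
  qed
next
  assume *: "\<forall>n::nat. \<exists>m::nat. \<forall>q\<in>\<rat>. norm (\<omega> q) \<le> max (real m) (\<bar>q\<bar> / real (Suc n))"
  show "sublinear \<omega>" unfolding sublinear_def
  proof (intro allI impI)
    fix \<epsilon> :: real assume "\<epsilon> > 0"
    obtain n :: nat where n: "1 / real (Suc n) < \<epsilon>"
      using reals_Archimedean[OF \<open>\<epsilon> > 0\<close>] by (auto simp: inverse_eq_divide)
    obtain m :: nat where m: "\<And>q. q \<in> \<rat> \<Longrightarrow> norm (\<omega> q) \<le> max (real m) (\<bar>q\<bar> / real (Suc n))" using * by blast
    have all: "norm (\<omega> t) \<le> max (real m) (\<bar>t\<bar> / real (Suc n))" for t
      using assms by (intro real_le_of_rational_le[OF _ _ m] continuous_intros) (auto simp: C0_def)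
    show "\<exists>R. \<forall>t. R \<le> \<bar>t\<bar> \<longrightarrow> norm (\<omega> t) \<le> \<epsilon> * \<bar>t\<bar>"
    proof (intro exI[of _ "real m / \<epsilon>"] allI impI)
      fix t assume "real m / \<epsilon> \<le> \<bar>t\<bar>"
      then have "real m \<le> \<epsilon> * \<bar>t\<bar>" using \<open>\<epsilon> > 0\<close> by (simp add: pos_divide_le_eq mult.commute)
      moreover have "\<bar>t\<bar> / real (Suc n) \<le> \<epsilon> * \<bar>t\<bar>"
        using mult_right_mono[OF less_imp_le[OF n], of "\<bar>t\<bar>"] by simp
      ultimately show "norm (\<omega> t) \<le> \<epsilon> * \<bar>t\<bar>" using all[of t] by linarith
    qed
  qed
qed

context
  fixes P :: "path measure" and H1 H2 :: real
  assumes law: "fbm_pair_law H1 H2 P" and H: "1/2 < H1" "H1 < 1" "1/2 < H2" "H2 < 1"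
begin

lemma weighted_sup_measurable: "weighted_sup \<in> borel_measurable P"
proof -
  note [measurable] = eval_measurable[OF law]
  show ?thesis unfolding weighted_sup_def[abs_def]
    by (intro borel_measurable_SUP countable_rat) measurable
qed

lemma good_paths_sets: "good_paths \<in> sets P"
proof -
  have [measurable]: "(\<lambda>\<omega>. weighted_sup (shift t \<omega>)) \<in> borel_measurable P" for t
    by (rule measurable_compose[OF shift_measurable[OF law] weighted_sup_measurable])
  have eval: "{\<omega>\<in>space P. norm (\<omega> q) \<le> c} \<in> sets P" for q c
    by (rule borel_measurable_le[OF measurable_compose[OF eval_measurable[OF law] borel_measurable_norm] borel_measurable_const])
  have "good_paths = {\<omega>\<in>space P. (\<forall>n::nat. \<exists>m::nat. \<forall>q\<in>\<rat>. norm (\<omega> q) \<le> max (real m) (\<bar>q\<bar> / real (Suc n))) \<and>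
     (\<exists>c::nat. \<forall>n::nat. (\<Sum>k<n. weighted_sup (shift (- real k) \<omega>)) \<le> of_nat (c * n))}"
    unfolding good_paths_def space_P[OF law] by (auto simp: sublinear_iff_rational)
  also have "\<dots> \<in> sets P"
  proof (rule sets.sets_Collect_conj)
    have "{\<omega>\<in>space P. \<forall>q\<in>\<rat>. norm (\<omega> q) \<le> b q} \<in> sets P" for b
    proof -
      have "{\<omega>\<in>space P. \<forall>q\<in>\<rat>. norm (\<omega> q) \<le> b q} = (\<Inter>q\<in>\<rat>. {\<omega>\<in>space P. norm (\<omega> q) \<le> b q})"
        using Rats_0 by blast
      also have "\<dots> \<in> sets P"
        using eval Rats_0 by (intro sets.countable_INT' countable_rat) blast+
      finally show ?thesis .
    qed
    then show "{\<omega>\<in>space P. \<forall>n::nat. \<exists>m::nat. \<forall>q\<in>\<rat>. norm (\<omega> q) \<le> max (real m) (\<bar>q\<bar> / real (Suc n))} \<in> sets P"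
      by (intro sets.sets_Collect_countable_All sets.sets_Collect_countable_Ex)
    show "{\<omega>\<in>space P. \<exists>c::nat. \<forall>n::nat. (\<Sum>k<n. weighted_sup (shift (- real k) \<omega>)) \<le> of_nat (c * n)} \<in> sets P"
      by measurable
  qed
  finally show ?thesis .
qed

text \<open>Chaining from the left end point of \<open>[-T, T]\<close>, applied to both coordinates; the value at the left end
point is eliminated by comparison with time \<open>0\<close>, where the path vanishes.\<close>

lemma path_sup_bound:
  "\<exists>C\<ge>0. \<exists>h. 0 < h \<and> h < 1 \<and> (\<forall>T\<ge>1. \<exists>S\<in>borel_measurable P.
      (\<forall>\<omega>\<in>C0. \<forall>s\<in>{-T..T}. ennreal ((norm (\<omega> s))\<^sup>2) \<le> S \<omega>) \<and>
      (\<integral>\<^sup>+\<omega>. S \<omega> \<partial>P) \<le> ennreal (C * T powr (2 * h)))"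
proof -
  define h where "h = max H1 H2"
  have h: "0 < h" "h < 1" using H by (auto simp: h_def)
  have one: "\<exists>C\<ge>0. \<forall>T\<ge>1. \<exists>S\<in>borel_measurable P.
      (\<forall>\<omega>\<in>C0. \<forall>s\<in>{-T..T}. ennreal ((B s \<omega>)\<^sup>2) \<le> S \<omega>) \<and>
      (\<integral>\<^sup>+\<omega>. S \<omega> \<partial>P) \<le> ennreal (C * T powr (2 * h))"
    if fbm: "fractional_brownian_motion H P B" and H: "1/2 < H" "H \<le> h" and B0: "\<And>\<omega>. \<omega> \<in> C0 \<Longrightarrow> B 0 \<omega> = 0"
    for B H
  proof -
    note [measurable] = fbm_measurable[OF fbm]
    have "\<exists>C\<ge>0. \<forall>a T. T > 0 \<longrightarrow> (\<exists>S\<in>borel_measurable P.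
      (\<forall>\<omega>\<in>space P. \<forall>s\<in>{a..a + T}. ennreal ((B s \<omega> - B a \<omega>)\<^sup>2) \<le> S \<omega>) \<and>
      (\<integral>\<^sup>+\<omega>. S \<omega> \<partial>P) \<le> ennreal (C * T powr (2 * H)))"
      by (rule chaining)
        (use fbm H in \<open>auto simp: fbm_increment_variance[OF fbm] fractional_brownian_motion_def\<close>)
    then obtain C where C: "C \<ge> 0" and S: "\<And>a T. T > 0 \<Longrightarrow> (\<exists>S\<in>borel_measurable P.
      (\<forall>\<omega>\<in>space P. \<forall>s\<in>{a..a + T}. ennreal ((B s \<omega> - B a \<omega>)\<^sup>2) \<le> S \<omega>) \<and>
      (\<integral>\<^sup>+\<omega>. S \<omega> \<partial>P) \<le> ennreal (C * T powr (2 * H)))" by blast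
    show ?thesis
    proof (intro exI[of _ "16 * C"] conjI allI impI)
      fix T :: real assume T: "T \<ge> 1"
      then have "2 * T > 0" by simp
      from S[OF this, of "- T"] obtain S where S[measurable]: "S \<in> borel_measurable P"
        and S_bound: "\<And>\<omega> s. \<omega> \<in> C0 \<Longrightarrow> s \<in> {-T..T} \<Longrightarrow> ennreal ((B s \<omega> - B (-T) \<omega>)\<^sup>2) \<le> S \<omega>"
        and S_int: "(\<integral>\<^sup>+\<omega>. S \<omega> \<partial>P) \<le> ennreal (C * (2 * T) powr (2 * H))"
        by (auto simp: space_P[OF law])
      show "\<exists>S\<in>borel_measurable P. (\<forall>\<omega>\<in>C0. \<forall>s\<in>{-T..T}. ennreal ((B s \<omega>)\<^sup>2) \<le> S \<omega>) \<and>
        (\<integral>\<^sup>+\<omega>. S \<omega> \<partial>P) \<le> ennreal (16 * C * T powr (2 * h))"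
      proof (rule bexI[of _ "\<lambda>\<omega>. ennreal 4 * S \<omega>"], intro conjI ballI)
        fix \<omega> s assume \<omega>: "\<omega> \<in> C0" and s: "s \<in> {-T..T}"
        have "(B s \<omega>)\<^sup>2 = ((B s \<omega> - B (-T) \<omega>) - (B 0 \<omega> - B (-T) \<omega>))\<^sup>2" using B0[OF \<omega>] by simp
        also have "\<dots> \<le> 2 * (B s \<omega> - B (-T) \<omega>)\<^sup>2 + 2 * (B 0 \<omega> - B (-T) \<omega>)\<^sup>2"
          using norm_diff_power2_le[of "B s \<omega> - B (-T) \<omega>" "B 0 \<omega> - B (-T) \<omega>"] by simp
        finally have "ennreal ((B s \<omega>)\<^sup>2) \<le> ennreal (2 * (B s \<omega> - B (-T) \<omega>)\<^sup>2 + 2 * (B 0 \<omega> - B (-T) \<omega>)\<^sup>2)"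
          by (rule ennreal_leI)
        also have "\<dots> = ennreal 2 * ennreal ((B s \<omega> - B (-T) \<omega>)\<^sup>2) + ennreal 2 * ennreal ((B 0 \<omega> - B (-T) \<omega>)\<^sup>2)"
          by (subst ennreal_plus) (auto simp: ennreal_mult)
        also have "\<dots> \<le> ennreal 2 * S \<omega> + ennreal 2 * S \<omega>"
          using s T by (intro add_mono mult_left_mono S_bound \<omega>) auto
        also have "\<dots> = ennreal 4 * S \<omega>" by (simp flip: distrib_right)
        finally show "ennreal ((B s \<omega>)\<^sup>2) \<le> ennreal 4 * S \<omega>" .
      next
        have "(2 * T) powr (2 * H) = 2 powr (2 * H) * T powr (2 * H)" using T by (simp add: powr_mult)
        also have "\<dots> \<le> 2 powr 2 * T powr (2 * h)"
          using T H h by (intro mult_mono powr_mono) auto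
        finally have "C * (2 * T) powr (2 * H) \<le> C * (4 * T powr (2 * h))"
          using C by (intro mult_left_mono) (auto simp: powr_numeral)
        then have "ennreal (C * (2 * T) powr (2 * H)) \<le> ennreal (C * (4 * T powr (2 * h)))" by (rule ennreal_leI)
        with S_int have "(\<integral>\<^sup>+\<omega>. S \<omega> \<partial>P) \<le> ennreal (C * (4 * T powr (2 * h)))" by (rule order_trans)
        then have "(\<integral>\<^sup>+\<omega>. ennreal 4 * S \<omega> \<partial>P) \<le> ennreal 4 * ennreal (C * (4 * T powr (2 * h)))"
          by (subst nn_integral_cmult) (auto intro!: mult_left_mono)
        also have "\<dots> = ennreal (16 * C * T powr (2 * h))" using C by (subst ennreal_mult[symmetric]) auto
        finally show "(\<integral>\<^sup>+\<omega>. ennreal 4 * S \<omega> \<partial>P) \<le> ennreal (16 * C * T powr (2 * h))" .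
      qed simp
    qed (use C in auto)
  qed
  have zero: "fst (\<omega> 0) = 0" "snd (\<omega> 0) = 0" if "\<omega> \<in> C0" for \<omega> using that by (auto simp: C0_def)
  obtain C1 where C1: "C1 \<ge> 0" "\<And>T. T \<ge> 1 \<Longrightarrow> \<exists>S\<in>borel_measurable P.
      (\<forall>\<omega>\<in>C0. \<forall>s\<in>{-T..T}. ennreal ((fst (\<omega> s))\<^sup>2) \<le> S \<omega>) \<and>
      (\<integral>\<^sup>+\<omega>. S \<omega> \<partial>P) \<le> ennreal (C1 * T powr (2 * h))"
    using one[OF fbm_fst[OF law] H(1)] zero by (auto simp: h_def)
  obtain C2 where C2: "C2 \<ge> 0" "\<And>T. T \<ge> 1 \<Longrightarrow> \<exists>S\<in>borel_measurable P.
      (\<forall>\<omega>\<in>C0. \<forall>s\<in>{-T..T}. ennreal ((snd (\<omega> s))\<^sup>2) \<le> S \<omega>) \<and>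
      (\<integral>\<^sup>+\<omega>. S \<omega> \<partial>P) \<le> ennreal (C2 * T powr (2 * h))"
    using one[OF fbm_snd[OF law] H(3)] zero by (auto simp: h_def)
  have "\<exists>S\<in>borel_measurable P.
      (\<forall>\<omega>\<in>C0. \<forall>s\<in>{-T..T}. ennreal ((norm (\<omega> s))\<^sup>2) \<le> S \<omega>) \<and>
      (\<integral>\<^sup>+\<omega>. S \<omega> \<partial>P) \<le> ennreal ((C1 + C2) * T powr (2 * h))" if T: "T \<ge> 1" for T
  proof -
    obtain S1 where [measurable]: "S1 \<in> borel_measurable P"
      and S1: "\<And>\<omega> s. \<omega> \<in> C0 \<Longrightarrow> s \<in> {-T..T} \<Longrightarrow> ennreal ((fst (\<omega> s))\<^sup>2) \<le> S1 \<omega>"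
        "(\<integral>\<^sup>+\<omega>. S1 \<omega> \<partial>P) \<le> ennreal (C1 * T powr (2 * h))" using C1(2)[OF T] by blast
    obtain S2 where [measurable]: "S2 \<in> borel_measurable P"
      and S2: "\<And>\<omega> s. \<omega> \<in> C0 \<Longrightarrow> s \<in> {-T..T} \<Longrightarrow> ennreal ((snd (\<omega> s))\<^sup>2) \<le> S2 \<omega>"
        "(\<integral>\<^sup>+\<omega>. S2 \<omega> \<partial>P) \<le> ennreal (C2 * T powr (2 * h))" using C2(2)[OF T] by blast
    show ?thesis
    proof (rule bexI[of _ "\<lambda>\<omega>. S1 \<omega> + S2 \<omega>"], intro conjI ballI)
      fix \<omega> s assume "\<omega> \<in> C0" "s \<in> {-T..T}"
      have "(norm (\<omega> s))\<^sup>2 = (fst (\<omega> s))\<^sup>2 + (snd (\<omega> s))\<^sup>2" by (simp add: norm_prod_def)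
      then show "ennreal ((norm (\<omega> s))\<^sup>2) \<le> S1 \<omega> + S2 \<omega>"
        using S1(1) S2(1) \<open>\<omega> \<in> C0\<close> \<open>s \<in> {-T..T}\<close> by (simp add: ennreal_plus add_mono)
    next
      have "(\<integral>\<^sup>+\<omega>. S1 \<omega> + S2 \<omega> \<partial>P) = (\<integral>\<^sup>+\<omega>. S1 \<omega> \<partial>P) + (\<integral>\<^sup>+\<omega>. S2 \<omega> \<partial>P)" by (rule nn_integral_add) auto
      also have "\<dots> \<le> ennreal (C1 * T powr (2 * h)) + ennreal (C2 * T powr (2 * h))" by (intro add_mono S1 S2)
      also have "\<dots> = ennreal ((C1 + C2) * T powr (2 * h))"
        using C1 C2 by (subst ennreal_plus[symmetric]) (auto simp: algebra_simps)
      finally show "(\<integral>\<^sup>+\<omega>. S1 \<omega> + S2 \<omega> \<partial>P) \<le> ennreal ((C1 + C2) * T powr (2 * h))" .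
    qed simp
  qed
  then show ?thesis using h C1 C2 by (intro exI[of _ "C1 + C2"] conjI exI[of _ h]) auto
qed

lemma AE_C0: "AE \<omega> in P. \<omega> \<in> C0"
  by (rule AE_I2) (simp add: space_P[OF law])

lemma path_sup_series:
  assumes T: "\<And>k::nat. T k \<ge> 1" and a: "\<And>k. 0 \<le> a k"
    and sum: "\<And>h. 0 < h \<Longrightarrow> h < 1 \<Longrightarrow> \<exists>A \<rho>. 0 \<le> A \<and> 0 \<le> \<rho> \<and> \<rho> < 1 \<and> (\<forall>k. a k * T k powr (2 * h) \<le> A * \<rho>^k)"
  obtains S where "\<And>k. S k \<in> borel_measurable P"
    "\<And>k \<omega> s. \<omega> \<in> C0 \<Longrightarrow> \<bar>s\<bar> \<le> T k \<Longrightarrow> ennreal ((norm (\<omega> s))\<^sup>2) \<le> S k \<omega>"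
    "(\<integral>\<^sup>+\<omega>. (\<Sum>k. ennreal (a k) * S k \<omega>) \<partial>P) < \<infinity>"
proof -
  obtain C h where C: "C \<ge> 0" "0 < h" "h < 1" and ex: "\<And>T. T \<ge> 1 \<Longrightarrow> \<exists>S\<in>borel_measurable P.
      (\<forall>\<omega>\<in>C0. \<forall>s\<in>{-T..T}. ennreal ((norm (\<omega> s))\<^sup>2) \<le> S \<omega>) \<and>
      (\<integral>\<^sup>+\<omega>. S \<omega> \<partial>P) \<le> ennreal (C * T powr (2 * h))"
    using path_sup_bound by blast
  from ex[OF T] obtain S where S[measurable]: "\<And>k. S k \<in> borel_measurable P"
    and bound: "\<And>k \<omega> s. \<omega> \<in> C0 \<Longrightarrow> s \<in> {-T k..T k} \<Longrightarrow> ennreal ((norm (\<omega> s))\<^sup>2) \<le> S k \<omega>"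
    and int: "\<And>k. (\<integral>\<^sup>+\<omega>. S k \<omega> \<partial>P) \<le> ennreal (C * T k powr (2 * h))" by metis
  obtain A \<rho> where A: "0 \<le> A" and \<rho>: "0 \<le> \<rho>" "\<rho> < 1" and dom: "\<And>k. a k * T k powr (2 * h) \<le> A * \<rho>^k"
    using sum[OF C(2,3)] by blast
  have "(\<integral>\<^sup>+\<omega>. (\<Sum>k. ennreal (a k) * S k \<omega>) \<partial>P) = (\<Sum>k. ennreal (a k) * (\<integral>\<^sup>+\<omega>. S k \<omega> \<partial>P))"
    by (simp add: nn_integral_suminf nn_integral_cmult)
  also have "\<dots> \<le> (\<Sum>k. ennreal (C * A * \<rho>^k))"
  proof (intro suminf_le allI)
    fix k
    have "ennreal (a k) * (\<integral>\<^sup>+\<omega>. S k \<omega> \<partial>P) \<le> ennreal (a k) * ennreal (C * T k powr (2 * h))"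
      by (intro mult_left_mono int) auto
    also have "\<dots> = ennreal (C * (a k * T k powr (2 * h)))"
      using C a by (subst ennreal_mult[symmetric]) (auto simp: mult_ac)
    also have "\<dots> \<le> ennreal (C * (A * \<rho>^k))" using C by (intro ennreal_leI mult_left_mono dom) auto
    finally show "ennreal (a k) * (\<integral>\<^sup>+\<omega>. S k \<omega> \<partial>P) \<le> ennreal (C * A * \<rho>^k)" by (simp add: mult.assoc)
  qed auto
  also have "\<dots> = ennreal (\<Sum>k. C * A * \<rho>^k)"
    using C A \<rho> by (intro suminf_ennreal2 summable_mult summable_geometric) auto
  also have "\<dots> < \<infinity>" by simp
  finally have fin: "(\<integral>\<^sup>+\<omega>. (\<Sum>k. ennreal (a k) * S k \<omega>) \<partial>P) < \<infinity>" .
  show ?thesis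
  proof (rule that[OF S _ fin])
    fix k \<omega> s assume "\<omega> \<in> C0" "\<bar>s\<bar> \<le> T k"
    then show "ennreal ((norm (\<omega> s))\<^sup>2) \<le> S k \<omega>" by (intro bound) auto
  qed
qed

text \<open>The expected square of the supremum over \<open>[-2\<^sup>k, 2\<^sup>k]\<close> is of order \<open>2\<^bsup>2hk\<^esup>\<close> with \<open>h < 1\<close>. Divided by \<open>4\<^sup>k\<close>
it is summable in \<open>k\<close>, so that almost surely the supremum is \<open>o(2\<^sup>k)\<close>.\<close>

lemma AE_sublinear: "AE \<omega> in P. sublinear \<omega>"
proof -
  obtain S where [measurable]: "\<And>k. S k \<in> borel_measurable P"
    and S: "\<And>k \<omega> s. \<omega> \<in> C0 \<Longrightarrow> \<bar>s\<bar> \<le> 2^k \<Longrightarrow> ennreal ((norm (\<omega> s))\<^sup>2) \<le> S k \<omega>"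
    and S_int: "(\<integral>\<^sup>+\<omega>. (\<Sum>k. ennreal ((1 / 4)^k) * S k \<omega>) \<partial>P) < \<infinity>"
  proof (rule path_sup_series[of "\<lambda>k. 2^k" "\<lambda>k. (1 / 4)^k"])
    fix h :: real assume h: "0 < h" "h < 1"
    define \<rho> :: real where "\<rho> = (1 / 4) * 2 powr (2 * h)"
    have "2 powr (2 * h) < 2 powr (2::real)" using h by (intro powr_less_mono) auto
    then have "0 \<le> \<rho>" "\<rho> < 1" by (simp_all add: \<rho>_def powr_numeral)
    moreover have "(1 / 4)^k * (2^k) powr (2 * h) \<le> 1 * \<rho>^k" for k :: nat
    proof -
      have "(2^k) powr (2 * h) = (2 powr (2 * h))^k"
        by (simp add: powr_realpow[symmetric] powr_powr mult.commute powr_power)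
      then show ?thesis unfolding \<rho>_def by (simp only: power_mult_distrib)
    qed
    ultimately show "\<exists>A \<rho>. 0 \<le> A \<and> 0 \<le> \<rho> \<and> \<rho> < 1 \<and> (\<forall>k. (1 / 4)^k * (2^k) powr (2 * h) \<le> A * \<rho>^k)"
      by (intro exI[of _ 1] exI[of _ \<rho>]) auto
  qed auto
  define Z where "Z \<omega> = (\<Sum>k. ennreal ((1 / 4)^k) * S k \<omega>)" for \<omega>
  have [measurable]: "Z \<in> borel_measurable P" unfolding Z_def by measurable
  have "(\<integral>\<^sup>+\<omega>. Z \<omega> \<partial>P) \<noteq> \<infinity>" using S_int by (simp add: Z_def)
  then have "AE \<omega> in P. Z \<omega> \<noteq> \<infinity>" by (intro nn_integral_PInf_AE) auto
  then show ?thesis using AE_C0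
  proof eventually_elim
    case (elim \<omega>)
    obtain z where z: "z \<ge> 0" "Z \<omega> = ennreal z" using elim(1) by (cases "Z \<omega>") auto
    have bound: "ennreal ((1 / 4)^k) * S k \<omega> \<le> Z \<omega>" for k
      unfolding Z_def using sum_le_suminf[of "\<lambda>k. ennreal ((1 / 4)^k) * S k \<omega>" "{k}"] by auto
    have "\<forall>k. \<exists>s\<ge>0. S k \<omega> = ennreal s"
    proof
      fix k
      have "S k \<omega> \<noteq> \<infinity>" using bound[of k] z by (auto simp: ennreal_mult_top top_unique)
      then show "\<exists>s\<ge>0. S k \<omega> = ennreal s" by (cases "S k \<omega>") auto
    qed
    then obtain s where s: "\<And>k. s k \<ge> 0" "\<And>k. S k \<omega> = ennreal (s k)" by metis
    have "(\<Sum>k. ennreal ((1 / 4)^k * s k)) = ennreal z"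
      using z s by (simp add: Z_def ennreal_mult)
    then have "summable (\<lambda>k. (1 / 4)^k * s k)"
      using s(1) by (intro summable_suminf_not_top) auto
    then have lim: "(\<lambda>k. (1 / 4)^k * s k) \<longlonglongrightarrow> 0" by (rule summable_LIMSEQ_zero)
    show "sublinear \<omega>" unfolding sublinear_def
    proof (intro allI impI)
      fix \<epsilon> :: real assume "\<epsilon> > 0"
      have "\<forall>\<^sub>F k in sequentially. (1 / 4)^k * s k < (\<epsilon> / 2)\<^sup>2"
        using order_tendstoD(2)[OF lim, of "(\<epsilon> / 2)\<^sup>2"] \<open>\<epsilon> > 0\<close> by simp
      then obtain k0 where k0: "\<And>k. k \<ge> k0 \<Longrightarrow> (1 / 4)^k * s k < (\<epsilon> / 2)\<^sup>2"
        by (auto simp: eventually_sequentially)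
      show "\<exists>R. \<forall>t. R \<le> \<bar>t\<bar> \<longrightarrow> norm (\<omega> t) \<le> \<epsilon> * \<bar>t\<bar>"
      proof (intro exI[of _ "2^k0"] allI impI)
        fix t :: real assume t: "2^k0 \<le> \<bar>t\<bar>"
        \<comment> \<open>By minimality \<open>2^k \<le> 2 * \<bar>t\<bar>\<close>, so the bound at scale \<open>2^k\<close> loses only a factor 2.\<close>
        define k where "k = (LEAST k. \<bar>t\<bar> \<le> 2^k)"
        obtain k1 where "\<bar>t\<bar> < 2^k1" using real_arch_pow[of 2 "\<bar>t\<bar>"] by auto
        then have "\<bar>t\<bar> \<le> 2^k1" by (rule less_imp_le)
        then have k: "\<bar>t\<bar> \<le> 2^k" unfolding k_def by (rule LeastI)
        have "(2::real)^k0 \<le> 2^k" using t k by linarith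
        then have "k0 \<le> k" by (subst (asm) power_increasing_iff) auto
        have kt: "(2::real)^k \<le> 2 * \<bar>t\<bar>"
        proof (cases k)
          case 0
          have "(1::real) \<le> 2^k0" by simp
          then show ?thesis using t unfolding 0 power_0 by linarith
        next
          case (Suc j)
          then have "\<not> \<bar>t\<bar> \<le> 2^j" using not_less_Least[of j "\<lambda>k. \<bar>t\<bar> \<le> 2^k"] by (simp add: k_def)
          then show ?thesis by (simp add: Suc)
        qed
        have "ennreal ((norm (\<omega> t))\<^sup>2) \<le> ennreal (s k)"
          using S[OF elim(2) k] unfolding s(2) .
        then have "(norm (\<omega> t))\<^sup>2 \<le> s k" using s(1) by (simp add: ennreal_le_iff)
        also have "\<dots> \<le> (\<epsilon> / 2)\<^sup>2 * 4^k"
          using k0[OF \<open>k0 \<le> k\<close>] by (simp add: field_simps)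
        also have "\<dots> = (\<epsilon> / 2 * 2^k)\<^sup>2"
        proof -
          have "(4::real)^k = (2^k)\<^sup>2" by (simp add: power2_eq_square flip: power_mult_distrib)
          then show ?thesis by (simp only: power_mult_distrib)
        qed
        finally have "norm (\<omega> t) \<le> \<epsilon> / 2 * 2^k" by (rule power2_le_imp_le) (use \<open>\<epsilon> > 0\<close> in simp)
        also have "\<dots> \<le> \<epsilon> / 2 * (2 * \<bar>t\<bar>)" using kt \<open>\<epsilon> > 0\<close> by (intro mult_left_mono) auto
        finally show "norm (\<omega> t) \<le> \<epsilon> * \<bar>t\<bar>" by simp
      qed
    qed
  qed
qed

text \<open>Decomposing into unit shells, the exponential weight beats the polynomial growth of the expected
squared supremum.\<close>

lemma weighted_sup_integral_finite: "(\<integral>\<^sup>+\<omega>. weighted_sup \<omega> \<partial>P) < \<infinity>"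
proof -
  obtain S where [measurable]: "\<And>k. S k \<in> borel_measurable P"
    and S: "\<And>k \<omega> s. \<omega> \<in> C0 \<Longrightarrow> \<bar>s\<bar> \<le> real (Suc k) \<Longrightarrow> ennreal ((norm (\<omega> s))\<^sup>2) \<le> S k \<omega>"
    and S_int: "(\<integral>\<^sup>+\<omega>. (\<Sum>k. ennreal (exp (- real k)) * S k \<omega>) \<partial>P) < \<infinity>"
  proof (rule path_sup_series[of "\<lambda>k. real (Suc k)" "\<lambda>k. exp (- real k)"])
    fix h :: real assume h: "0 < h" "h < 1"
    define \<rho> :: real where "\<rho> = exp (- 1 / 2)"
    have \<rho>: "0 \<le> \<rho>" "\<rho> < 1" by (auto simp: \<rho>_def)
    have "exp (- real k) * real (Suc k) powr (2 * h) \<le> 16 * exp (1 / 2) * \<rho>^k" for k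
    proof -
      have "real (Suc k) powr (2 * h) \<le> real (Suc k) powr 2" using h by (intro powr_mono) auto
      also have "\<dots> = (real (Suc k))\<^sup>2" by (simp add: powr_numeral)
      also have "\<dots> \<le> (4 * exp (real (Suc k) / 4))\<^sup>2"
      proof (rule power_mono)
        have "x \<le> 4 * exp (x / 4)" for x :: real
          using exp_ge_add_one_self[of "x / 4"] by linarith
        then show "real (Suc k) \<le> 4 * exp (real (Suc k) / 4)" .
      qed simp
      also have "\<dots> = 16 * exp (real (Suc k) / 2)"
        by (simp add: power_mult_distrib power2_eq_square flip: exp_add)
      finally have "exp (- real k) * real (Suc k) powr (2 * h) \<le> exp (- real k) * (16 * exp (real (Suc k) / 2))"
        by (intro mult_left_mono) auto
      also have "\<dots> = 16 * (exp (- real k) * exp (real (Suc k) / 2))" by simp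
      also have "exp (- real k) * exp (real (Suc k) / 2) = exp (1 / 2) * \<rho>^k"
        unfolding \<rho>_def exp_of_nat_mult[symmetric] exp_add[symmetric] by (simp add: field_simps)
      finally show ?thesis by (simp only: mult.assoc)
    qed
    with \<rho> show "\<exists>A \<rho>. 0 \<le> A \<and> 0 \<le> \<rho> \<and> \<rho> < 1 \<and>
        (\<forall>k. exp (- real k) * real (Suc k) powr (2 * h) \<le> A * \<rho>^k)"
      by (intro exI[of _ "16 * exp (1 / 2)"] exI[of _ \<rho>]) auto
  qed auto
  define Z where "Z \<omega> = (\<Sum>k. ennreal (exp (- real k)) * S k \<omega>)" for \<omega>
  have "(\<integral>\<^sup>+\<omega>. weighted_sup \<omega> \<partial>P) \<le> (\<integral>\<^sup>+\<omega>. Z \<omega> \<partial>P)"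
  proof (rule nn_integral_mono)
    fix \<omega> assume "\<omega> \<in> space P"
    then have \<omega>: "\<omega> \<in> C0" by (simp add: space_P[OF law])
    show "weighted_sup \<omega> \<le> Z \<omega>" unfolding weighted_sup_def
    proof (rule SUP_least)
      fix q :: real
      define k where "k = nat \<lfloor>\<bar>q\<bar>\<rfloor>"
      have k: "real k \<le> \<bar>q\<bar>" "\<bar>q\<bar> \<le> real (Suc k)" by (auto simp: k_def) linarith
      have "ennreal (exp (- \<bar>q\<bar>) * (norm (\<omega> q))\<^sup>2) \<le> ennreal (exp (- real k) * (norm (\<omega> q))\<^sup>2)"
        using k by (intro ennreal_leI mult_right_mono) auto
      also have "\<dots> = ennreal (exp (- real k)) * ennreal ((norm (\<omega> q))\<^sup>2)" by (simp add: ennreal_mult)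
      also have "\<dots> \<le> ennreal (exp (- real k)) * S k \<omega>"
        using k by (intro mult_left_mono S[OF \<omega>]) auto
      also have "\<dots> \<le> Z \<omega>"
        unfolding Z_def using sum_le_suminf[of "\<lambda>k. ennreal (exp (- real k)) * S k \<omega>" "{k}"] by auto
      finally show "ennreal (exp (- \<bar>q\<bar>) * (norm (\<omega> q))\<^sup>2) \<le> Z \<omega>" .
    qed
  qed
  also have "\<dots> < \<infinity>" using S_int by (simp add: Z_def)
  finally show ?thesis .
qed

lemma AE_weighted_sup_averages:
  "AE \<omega> in P. \<exists>c::nat. \<forall>n::nat. (\<Sum>k<n. weighted_sup (shift (- real k) \<omega>)) \<le> of_nat (c * n)"
proof -
  \<comment> \<open>The ergodic inequality is about real functions; finiteness along the whole orbit is checked separately.\<close>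
  define Y where "Y \<omega> = enn2real (weighted_sup \<omega>)" for \<omega>
  note [measurable] = weighted_sup_measurable
  have [measurable]: "Y \<in> borel_measurable P" unfolding Y_def[abs_def] by measurable
  have "ennreal (Y \<omega>) \<le> weighted_sup \<omega>" for \<omega>
    unfolding Y_def by (cases "weighted_sup \<omega>") auto
  then have "(\<integral>\<^sup>+\<omega>. ennreal (Y \<omega>) \<partial>P) \<le> (\<integral>\<^sup>+\<omega>. weighted_sup \<omega> \<partial>P)" by (intro nn_integral_mono)
  also note weighted_sup_integral_finite
  finally have Y: "integrable P Y" by (intro integrableI_nonneg) (auto simp: Y_def)
  have fin0: "AE \<omega> in P. weighted_sup \<omega> \<noteq> \<infinity>"
    using weighted_sup_integral_finite by (intro nn_integral_PInf_AE) auto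
  have "AE \<omega> in P. weighted_sup (shift t \<omega>) \<noteq> \<infinity>" for t
  proof (rule AE_distrD[OF shift_measurable[OF law, of t]])
    show "AE \<omega> in distr P P (shift t). weighted_sup \<omega> \<noteq> \<infinity>"
      unfolding shift_preserves_law[OF law] by (rule fin0)
  qed
  then have "AE \<omega> in P. \<forall>k::nat. weighted_sup (shift (- real k) \<omega>) \<noteq> \<infinity>" by (simp add: AE_all_countable)
  moreover have "AE \<omega> in P. \<exists>c::nat. \<forall>n. (\<Sum>k<n. Y ((shift (-1) ^^ k) \<omega>)) \<le> real c * real n"
    by (rule AE_bounded_averages[OF P_prob_space[OF law] shift_measurable[OF law] shift_preserves_law[OF law] Y])
      (simp add: Y_def)
  ultimately show ?thesis using AE_C0
  proof eventually_elim
    case (elim \<omega>)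
    then obtain c :: nat where c: "\<And>n. (\<Sum>k<n. Y ((shift (-1) ^^ k) \<omega>)) \<le> real c * real n" by blast
    have "(\<Sum>k<n. weighted_sup (shift (- real k) \<omega>)) \<le> of_nat (c * n)" for n
    proof -
      have "weighted_sup (shift (- real k) \<omega>) = ennreal (Y ((shift (-1) ^^ k) \<omega>))" for k
        using elim(1,3) by (simp add: Y_def funpow_shift less_top)
      then have "(\<Sum>k<n. weighted_sup (shift (- real k) \<omega>)) = ennreal (\<Sum>k<n. Y ((shift (-1) ^^ k) \<omega>))"
        by (simp add: Y_def sum_ennreal)
      also have "\<dots> \<le> ennreal (real c * real n)" by (intro ennreal_leI c)
      finally show ?thesis unfolding ennreal_of_nat_eq_real_of_nat of_nat_mult .
    qed
    then show ?case by blast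
  qed
qed

lemma invariant_full_good_paths: "invariant_full P good_paths"
  unfolding invariant_full_def
proof (intro conjI allI)
  interpret prob_space P by (rule P_prob_space[OF law])
  show "good_paths \<in> sets P" by (rule good_paths_sets)
  have "AE \<omega> in P. \<omega> \<in> good_paths"
    using AE_C0 AE_sublinear AE_weighted_sup_averages by eventually_elim (simp add: good_paths_def)
  then show "measure P good_paths = 1" using prob_eq_1[OF good_paths_sets] by simp
  fix t
  show "shift t ` good_paths = good_paths"
  proof (intro equalityI subsetI)
    fix \<omega> assume \<omega>: "\<omega> \<in> good_paths"
    then have "\<omega> = shift t (shift (- t) \<omega>)" by (simp add: shift_shift shift_zero good_paths_def)
    then show "\<omega> \<in> shift t ` good_paths" using shift_good_paths[OF \<omega>] by blast
  qed (use shift_good_paths in blast)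
qed

end

section \<open>From path properties to synchronization\<close>

text \<open>Up to a constant factor, a bound for both Ornstein--Uhlenbeck processes on the \<open>k\<close>-th backward unit
interval.\<close>

definition path_envelope :: "path \<Rightarrow> nat \<Rightarrow> real" where
  "path_envelope \<omega> k = sqrt (enn2real (weighted_sup (shift (- real k) \<omega>)))"

lemma weighted_sup_shift_finite:
  assumes "\<omega> \<in> good_paths"
  shows "weighted_sup (shift (- real k) \<omega>) < \<infinity>"
proof -
  obtain c :: nat where c: "\<And>n. (\<Sum>k<n. weighted_sup (shift (- real k) \<omega>)) \<le> of_nat (c * n)"
    using assms by (auto simp: good_paths_def)
  have "weighted_sup (shift (- real k) \<omega>) \<le> (\<Sum>k<Suc k. weighted_sup (shift (- real k) \<omega>))"
    by (intro member_le_sum) auto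
  also have "\<dots> \<le> of_nat (c * Suc k)" by (rule c)
  also have "\<dots> < \<infinity>" unfolding ennreal_of_nat_eq_real_of_nat by simp
  finally show ?thesis .
qed

lemma path_envelope_bound:
  assumes \<omega>: "\<omega> \<in> good_paths" and "s \<le> 0"
  shows "exp (s / 2) * norm (\<omega> (s + - real k) - \<omega> (- real k)) \<le> path_envelope \<omega> k"
proof -
  define w where "w = weighted_sup (shift (- real k) \<omega>)"
  have "shift (- real k) \<omega> \<in> C0" using shift_in_C0 \<omega> by (simp add: good_paths_def)
  from le_weighted_sup[OF this, of s]
  have "ennreal (exp s * (norm (\<omega> (s + - real k) - \<omega> (- real k)))\<^sup>2) \<le> w"
    using \<open>s \<le> 0\<close> by (simp add: w_def shift_def)
  also have "w = ennreal (enn2real w)"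
    using weighted_sup_shift_finite[OF \<omega>, of k] by (simp add: w_def less_top)
  finally have "exp s * (norm (\<omega> (s + - real k) - \<omega> (- real k)))\<^sup>2 \<le> enn2real w"
    by (simp add: ennreal_le_iff)
  moreover have "exp s = (exp (s / 2))\<^sup>2" by (simp add: power2_eq_square flip: exp_add)
  ultimately have "(exp (s / 2) * norm (\<omega> (s + - real k) - \<omega> (- real k)))\<^sup>2 \<le> enn2real w"
    by (simp only: power_mult_distrib)
  then show ?thesis unfolding path_envelope_def w_def by (rule real_le_rsqrt)
qed

lemma path_envelope_average:
  assumes "\<omega> \<in> good_paths"
  obtains c where "c \<ge> 0" "\<And>n. (\<Sum>k<n. (path_envelope \<omega> k)\<^sup>2) \<le> c * real n"
proof -
  obtain c :: nat where c: "\<And>n. (\<Sum>k<n. weighted_sup (shift (- real k) \<omega>)) \<le> of_nat (c * n)"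
    using assms by (auto simp: good_paths_def)
  have "(\<Sum>k<n. (path_envelope \<omega> k)\<^sup>2) \<le> real c * real n" for n
  proof -
    have "ennreal (\<Sum>k<n. (path_envelope \<omega> k)\<^sup>2) = (\<Sum>k<n. ennreal ((path_envelope \<omega> k)\<^sup>2))"
      by (simp add: sum_ennreal)
    also have "\<dots> = (\<Sum>k<n. weighted_sup (shift (- real k) \<omega>))"
      using weighted_sup_shift_finite[OF assms] by (simp add: path_envelope_def less_top)
    also have "\<dots> \<le> ennreal (real c * real n)" using c[of n] by (simp add: ennreal_of_nat_eq_real_of_nat)
    finally show ?thesis by (simp add: ennreal_le_iff)
  qed
  then show ?thesis using that[of "real c"] by simp
qed

lemma good_path_component:
  fixes p :: "real \<times> real \<Rightarrow> real"
  assumes \<omega>: "\<omega> \<in> good_paths" and p: "bounded_linear p" "\<And>x. \<bar>p x\<bar> \<le> norm x"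
  shows "\<exists>N. (\<forall>t. (N has_real_derivative ou (\<lambda>s. p (\<omega> s)) t) (at t)) \<and> slowly_growing N \<and>
    slowly_growing (ou (\<lambda>s. p (\<omega> s))) \<and> continuous_on UNIV (ou (\<lambda>s. p (\<omega> s))) \<and>
    (\<forall>k t. - real k - 1 \<le> t \<and> t \<le> - real k \<longrightarrow> \<bar>ou (\<lambda>s. p (\<omega> s)) t\<bar> \<le> 6 * path_envelope \<omega> k)"
proof -
  define B where "B s = p (\<omega> s)" for s
  have \<omega>C0: "continuous_on UNIV \<omega>" and sub\<omega>: "sublinear \<omega>" using \<omega> by (auto simp: good_paths_def C0_def)
  have cont: "continuous_on UNIV B"
    unfolding B_def using bounded_linear.continuous_on[OF p(1) \<omega>C0] .
  have sub: "((\<lambda>t. B t / t) \<longlongrightarrow> 0) at_bot"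
  proof (rule tendstoI)
    fix e :: real assume "e > 0"
    then have "e / 2 > 0" by simp
    then obtain R where R: "\<And>t. R \<le> \<bar>t\<bar> \<Longrightarrow> norm (\<omega> t) \<le> e / 2 * \<bar>t\<bar>"
      using sub\<omega> unfolding sublinear_def by blast
    show "\<forall>\<^sub>F t in at_bot. dist (B t / t) 0 < e"
      using eventually_le_at_bot[of "min (- R) (- 1)"]
    proof eventually_elim
      case (elim t)
      then have "R \<le> \<bar>t\<bar>" and t: "0 < \<bar>t\<bar>" by auto
      have "\<bar>B t\<bar> \<le> norm (\<omega> t)" unfolding B_def by (rule p(2))
      also have "\<dots> \<le> e / 2 * \<bar>t\<bar>" by (rule R) fact
      also have "\<dots> < e * \<bar>t\<bar>" using t \<open>e > 0\<close> by simp
      finally have "\<bar>B t\<bar> / \<bar>t\<bar> < e" using t by (simp only: pos_divide_less_eq)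
      then show ?case by (simp add: dist_real_def)
    qed
  qed
  obtain N where N: "\<And>t. (N has_real_derivative ou B t) (at t)" and ou_eq: "\<And>t. ou B t = B t - N t"
    and expN: "((\<lambda>t. exp t * N t) \<longlongrightarrow> 0) at_bot"
    using ou_decomposition[OF cont sub] by blast
  have contN: "continuous_on UNIV N" using N by (intro DERIV_continuous_on) (auto intro: has_field_derivative_at_within)
  have subN: "((\<lambda>t. N t / t) \<longlongrightarrow> 0) at_bot" by (rule ou_average_sublinear[OF N ou_eq expN sub])
  have ou_fun: "ou B = (\<lambda>t. B t - N t)" using ou_eq by blast
  have "slowly_growing N" by (rule slowly_growing_of_sublinear[OF contN subN])
  moreover have cont_ou: "continuous_on UNIV (ou B)" unfolding ou_fun by (intro continuous_intros cont contN)
  moreover have "slowly_growing (ou B)"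
  proof (rule slowly_growing_of_sublinear[OF cont_ou])
    show "((\<lambda>t. ou B t / t) \<longlongrightarrow> 0) at_bot"
      using tendsto_diff[OF sub subN] by (simp add: ou_fun diff_divide_distrib)
  qed
  moreover have "\<bar>ou B t\<bar> \<le> 6 * path_envelope \<omega> k" if "- real k - 1 \<le> t" "t \<le> - real k" for k t
  proof (rule ou_abs_le_weighted_sup[OF N ou_eq expN _ that])
    fix s :: real assume s: "s \<le> 0"
    have "B (s + - real k) - B (- real k) = p (\<omega> (s + - real k) - \<omega> (- real k))"
      unfolding B_def by (rule linear_diff[OF bounded_linear.linear[OF p(1)], symmetric])
    then have "exp (s / 2) * \<bar>B (s + - real k) - B (- real k)\<bar> \<le> exp (s / 2) * norm (\<omega> (s + - real k) - \<omega> (- real k))"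
      using p(2) by (simp only:) (rule mult_left_mono, auto)
    also have "\<dots> \<le> path_envelope \<omega> k" by (rule path_envelope_bound[OF \<omega> s])
    finally show "exp (s / 2) * \<bar>B (s + - real k) - B (- real k)\<bar> \<le> path_envelope \<omega> k" .
  qed
  ultimately show ?thesis using N unfolding B_def by blast
qed

text \<open>\<open>Q\<close> is an antiderivative of the squared difference of the rates. Its increment over \<open>[-k - 1, -k]\<close> is at most a
multiple of \<open>(path_envelope \<omega> k)\<^sup>2\<close>, and these squares have bounded averages.\<close>

lemma good_path_noise:
  assumes \<omega>: "\<omega> \<in> good_paths"
  shows "\<exists>N1 N2 Q K. (\<forall>t. (N1 has_real_derivative ou1 \<omega> t) (at t)) \<and> (\<forall>t. (N2 has_real_derivative ou2 \<omega> t) (at t)) \<and>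
    slowly_growing (ou1 \<omega>) \<and> slowly_growing (ou2 \<omega>) \<and> slowly_growing N1 \<and> slowly_growing N2 \<and>
    (\<forall>t. (Q has_real_derivative (a1 * ou1 \<omega> t - a2 * ou2 \<omega> t)\<^sup>2) (at t)) \<and>
    (\<forall>t\<le>0. Q 0 - Q t \<le> K * (1 - t))"
proof -
  have fst: "\<bar>fst x\<bar> \<le> norm x" and snd: "\<bar>snd x\<bar> \<le> norm x" for x :: "real \<times> real"
    using norm_fst_le[of "fst x" "snd x"] norm_snd_le[of "snd x" "fst x"] by auto
  obtain N1 where N1: "\<forall>t. (N1 has_real_derivative ou1 \<omega> t) (at t)" "slowly_growing N1"
      "slowly_growing (ou1 \<omega>)" "continuous_on UNIV (ou1 \<omega>)"
    and O1: "\<And>k t. - real k - 1 \<le> t \<Longrightarrow> t \<le> - real k \<Longrightarrow> \<bar>ou1 \<omega> t\<bar> \<le> 6 * path_envelope \<omega> k"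
    using good_path_component[OF \<omega> bounded_linear_fst fst] unfolding ou1_def by blast
  obtain N2 where N2: "\<forall>t. (N2 has_real_derivative ou2 \<omega> t) (at t)" "slowly_growing N2"
      "slowly_growing (ou2 \<omega>)" "continuous_on UNIV (ou2 \<omega>)"
    and O2: "\<And>k t. - real k - 1 \<le> t \<Longrightarrow> t \<le> - real k \<Longrightarrow> \<bar>ou2 \<omega> t\<bar> \<le> 6 * path_envelope \<omega> k"
    using good_path_component[OF \<omega> bounded_linear_snd snd] unfolding ou2_def by blast
  define d where "d t = a1 * ou1 \<omega> t - a2 * ou2 \<omega> t" for t
  have "continuous_on UNIV (\<lambda>t. (d t)\<^sup>2)" unfolding d_def by (intro continuous_intros N1 N2)
  then obtain Q where Q: "\<And>t. (Q has_real_derivative (d t)\<^sup>2) (at t)" using antiderivative_exists by blast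
  obtain c where c: "c \<ge> 0" "\<And>n. (\<Sum>k<n. (path_envelope \<omega> k)\<^sup>2) \<le> c * real n"
    using path_envelope_average[OF \<omega>] by blast
  define A where "A = ((\<bar>a1\<bar> + \<bar>a2\<bar>) * 6)\<^sup>2"
  have step: "Q (- real k) - Q (- real (Suc k)) \<le> A * (path_envelope \<omega> k)\<^sup>2" for k
  proof -
    have "Q (- real k) - Q (- real (Suc k)) \<le> A * (path_envelope \<omega> k)\<^sup>2 * (- real k) - A * (path_envelope \<omega> k)\<^sup>2 * (- real (Suc k))"
    proof (rule increment_le_of_derivative_le)
      fix t assume t: "- real (Suc k) \<le> t" "t \<le> - real k"
      show "(Q has_real_derivative (d t)\<^sup>2) (at t)" by (rule Q)
      show "((\<lambda>t. A * (path_envelope \<omega> k)\<^sup>2 * t) has_real_derivative A * (path_envelope \<omega> k)\<^sup>2) (at t)"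
        by (auto intro!: derivative_eq_intros)
      have "\<bar>d t\<bar> \<le> \<bar>a1\<bar> * \<bar>ou1 \<omega> t\<bar> + \<bar>a2\<bar> * \<bar>ou2 \<omega> t\<bar>"
        unfolding d_def abs_mult[symmetric] by (rule abs_triangle_ineq4)
      also have "\<dots> \<le> \<bar>a1\<bar> * (6 * path_envelope \<omega> k) + \<bar>a2\<bar> * (6 * path_envelope \<omega> k)"
        using t by (intro add_mono mult_left_mono O1 O2) auto
      also have "\<dots> = (\<bar>a1\<bar> + \<bar>a2\<bar>) * 6 * path_envelope \<omega> k" by (simp add: algebra_simps)
      finally have "\<bar>d t\<bar>\<^sup>2 \<le> ((\<bar>a1\<bar> + \<bar>a2\<bar>) * 6 * path_envelope \<omega> k)\<^sup>2" by (intro power_mono) auto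
      then show "(d t)\<^sup>2 \<le> A * (path_envelope \<omega> k)\<^sup>2" unfolding A_def power_mult_distrib by simp
    qed simp
    then show ?thesis by (simp add: algebra_simps)
  qed
  have "Q 0 - Q t \<le> A * c * (1 - t)" if "t \<le> 0" for t
  proof -
    define n where "n = nat \<lceil>- t\<rceil>"
    have n: "- real n \<le> t" "real n \<le> 1 - t" using that by (auto simp: n_def) linarith+
    have "Q 0 - Q (- real n) = (\<Sum>k<n. Q (- real k) - Q (- real (Suc k)))"
      using sum_lessThan_telescope'[of "\<lambda>k. Q (- real k)" n] by simp
    also have "\<dots> \<le> (\<Sum>k<n. A * (path_envelope \<omega> k)\<^sup>2)" by (intro sum_mono step)
    also have "\<dots> \<le> A * (c * real n)"
      unfolding sum_distrib_left[symmetric] by (intro mult_left_mono c(2)) (simp add: A_def)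
    also have "\<dots> \<le> A * (c * (1 - t))" using n c by (intro mult_left_mono) (auto simp: A_def)
    finally have "Q 0 - Q (- real n) \<le> A * c * (1 - t)" by (simp add: mult.assoc)
    moreover have "Q (- real n) \<le> Q t"
      by (rule DERIV_nonneg_imp_nondecreasing[OF n(1)]) (use Q zero_le_power2 in blast)
    ultimately show ?thesis by linarith
  qed
  then show ?thesis using N1 N2 Q unfolding d_def by blast
qed

lemma tempered_eventually_le_exp:
  fixes x :: "real \<Rightarrow> 'a::real_normed_vector"
  assumes lim: "((\<lambda>t. ln (max 1 (norm (x t))) / \<bar>t\<bar>) \<longlongrightarrow> 0) at_bot" and "\<epsilon> > 0"
  shows "\<forall>\<^sub>F s in at_bot. norm (x s) \<le> exp (- \<epsilon> * s)"
  using order_tendstoD(2)[OF lim \<open>\<epsilon> > 0\<close>] eventually_le_at_bot[of "-1"]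
proof eventually_elim
  case (elim s)
  have "0 < \<bar>s\<bar>" using elim(2) by simp
  then have "ln (max 1 (norm (x s))) < \<epsilon> * \<bar>s\<bar>" using elim(1) by (simp only: pos_divide_less_eq)
  then have "exp (ln (max 1 (norm (x s)))) \<le> exp (\<epsilon> * \<bar>s\<bar>)" by (simp only: exp_le_cancel_iff less_imp_le)
  then have "max 1 (norm (x s)) \<le> exp (\<epsilon> * \<bar>s\<bar>)" by (subst (asm) exp_ln) auto
  then show ?case using elim(2) by simp
qed

text \<open>The pathwise theorem: recurrence of \<open>W\<close> on the exponential scale is common to tempered solutions and to
almost all paths of an arbitrary stationary solution.\<close>

lemma synchronizes_if_recurrent:
  fixes f g :: "'a::euclidean_space \<Rightarrow> 'a"
  assumes \<omega>: "\<omega> \<in> good_paths"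
    and fg: "linear_growth f" "linear_growth g" "dissipative_lipschitz f" "dissipative_lipschitz g"
    and UV: "\<And>\<kappa> t. \<kappa> \<ge> 1 \<Longrightarrow> ((\<lambda>t. (U \<kappa> (shift t \<omega>), V \<kappa> (shift t \<omega>))) has_vector_derivative
        coupled_field f g a1 a2 b1 b2 \<kappa> \<omega> t (U \<kappa> (shift t \<omega>), V \<kappa> (shift t \<omega>))) (at t)"
    and UV_tempered: "\<And>\<kappa>. \<kappa> \<ge> 1 \<Longrightarrow>
        ((\<lambda>t. ln (max 1 (norm (U \<kappa> (shift t \<omega>), V \<kappa> (shift t \<omega>)))) / \<bar>t\<bar>) \<longlongrightarrow> 0) at_bot"
    and W: "\<And>t. ((\<lambda>t. W (shift t \<omega>)) has_vector_derivative
        averaged_field f g a1 a2 b1 b2 \<omega> t (W (shift t \<omega>))) (at t)"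
    and W_recurrent: "\<And>\<epsilon>. \<epsilon> > 0 \<Longrightarrow> \<exists>\<^sub>F s in at_bot. norm (W (shift s \<omega>)) \<le> exp (- \<epsilon> * s)"
  shows "synchronizes U V W \<omega>"
proof -
  obtain L1 where L1: "L1 > 0" "\<And>x y. (x - y) \<bullet> (f x - f y) \<le> - L1 * (norm (x - y))\<^sup>2"
    using fg(3) unfolding dissipative_lipschitz_def by blast
  obtain L2 where L2: "L2 > 0" "\<And>x y. (x - y) \<bullet> (g x - g y) \<le> - L2 * (norm (x - y))\<^sup>2"
    using fg(4) unfolding dissipative_lipschitz_def by blast
  define L where "L = min L1 L2"
  have weaken: "- l * (norm z)\<^sup>2 \<le> - L * (norm z)\<^sup>2" if "L \<le> l" for l and z :: 'a
    using that by (intro mult_right_mono) auto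
  have dissf: "(x - y) \<bullet> (f x - f y) \<le> - L * (norm (x - y))\<^sup>2" for x y
    using L1(2)[of x y] weaken[of L1 "x - y"] by (simp add: L_def)
  have dissg: "(x - y) \<bullet> (g x - g y) \<le> - L * (norm (x - y))\<^sup>2" for x y
    using L2(2)[of x y] weaken[of L2 "x - y"] by (simp add: L_def)
  obtain C1 c1 where C1: "C1 \<ge> 0" "c1 \<ge> 0"
    "\<And>z x. (norm (component_field f a1 b1 z x))\<^sup>2 \<le> C1 * (1 + (norm x)\<^sup>2) * exp (c1 * \<bar>z\<bar>)"
    using component_field_growth[OF fg(1)] by blast
  obtain C2 c2 where C2: "C2 \<ge> 0" "c2 \<ge> 0"
    "\<And>z x. (norm (component_field g a2 b2 z x))\<^sup>2 \<le> C2 * (1 + (norm x)\<^sup>2) * exp (c2 * \<bar>z\<bar>)"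
    using component_field_growth[OF fg(2)] by blast
  have enlarge: "C * (1 + (norm x)\<^sup>2) * exp (c * \<bar>z\<bar>) \<le> (C1 + C2) * (1 + (norm x)\<^sup>2) * exp ((c1 + c2) * \<bar>z\<bar>)"
    if "0 \<le> C" "C \<le> C1 + C2" "c \<le> c1 + c2" for C c z and x :: 'a
    using that C1 C2 by (intro mult_mono) (auto intro: mult_right_mono)
  obtain N1 N2 Q K where noise: "\<forall>t. (N1 has_real_derivative ou1 \<omega> t) (at t)" "\<forall>t. (N2 has_real_derivative ou2 \<omega> t) (at t)"
    "slowly_growing (ou1 \<omega>)" "slowly_growing (ou2 \<omega>)" "slowly_growing N1" "slowly_growing N2"
    "\<forall>t. (Q has_real_derivative (a1 * ou1 \<omega> t - a2 * ou2 \<omega> t)\<^sup>2) (at t)"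
    "\<forall>t\<le>0. Q 0 - Q t \<le> K * (1 - t)"
    using good_path_noise[OF \<omega>] by blast
  interpret synchronization_data "component_field f a1 b1" "component_field g a2 b2" "ou1 \<omega>" "ou2 \<omega>"
    N1 N2 Q a1 a2 L "C1 + C2" "c1 + c2" K
  proof
    show "L > 0" using L1 L2 by (simp add: L_def)
    show "(norm (component_field f a1 b1 z x))\<^sup>2 \<le> (C1 + C2) * (1 + (norm x)\<^sup>2) * exp ((c1 + c2) * \<bar>z\<bar>)" for z x
      by (rule order_trans[OF C1(3) enlarge]) (use C1 C2 in auto)
    show "(norm (component_field g a2 b2 z x))\<^sup>2 \<le> (C1 + C2) * (1 + (norm x)\<^sup>2) * exp ((c1 + c2) * \<bar>z\<bar>)" for z x
      by (rule order_trans[OF C2(3) enlarge]) (use C1 C2 in auto)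
  qed (use C1 C2 noise component_field_dissipative[OF dissf] component_field_dissipative[OF dissg] in auto)
  have W': "((\<lambda>t. W (shift t \<omega>)) has_vector_derivative (1/2) *\<^sub>R
      (component_field f a1 b1 (ou1 \<omega> t) (W (shift t \<omega>)) + component_field g a2 b2 (ou2 \<omega> t) (W (shift t \<omega>)))) (at t)" for t
    using W[of t] by (simp add: averaged_field_def component_field_def algebra_simps)
  have U': "((\<lambda>t. U \<kappa> (shift t \<omega>)) has_vector_derivative component_field f a1 b1 (ou1 \<omega> t) (U \<kappa> (shift t \<omega>))
      + \<kappa> *\<^sub>R (V \<kappa> (shift t \<omega>) - U \<kappa> (shift t \<omega>))) (at t)" if "\<kappa> \<ge> 1" for \<kappa> t
    using bounded_linear.has_vector_derivative[OF bounded_linear_fst UV[OF that, of t]]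
    by (simp add: coupled_field_def component_field_def)
  have V': "((\<lambda>t. V \<kappa> (shift t \<omega>)) has_vector_derivative component_field g a2 b2 (ou2 \<omega> t) (V \<kappa> (shift t \<omega>))
      + \<kappa> *\<^sub>R (U \<kappa> (shift t \<omega>) - V \<kappa> (shift t \<omega>))) (at t)" if "\<kappa> \<ge> 1" for \<kappa> t
    using bounded_linear.has_vector_derivative[OF bounded_linear_snd UV[OF that, of t]]
    by (simp add: coupled_field_def component_field_def)
  have temp: "\<forall>\<^sub>F s in at_bot. norm (U \<kappa> (shift s \<omega>), V \<kappa> (shift s \<omega>)) \<le> exp (- \<epsilon> * s)"
    if "\<kappa> \<ge> 1" "\<epsilon> > 0" for \<kappa> \<epsilon>
    using tempered_eventually_le_exp[OF UV_tempered[OF that(1)] that(2)] .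
  show ?thesis unfolding synchronizes_def
  proof (intro allI uniform_limitI)
    fix T1 T2 e :: real assume "e > 0"
    obtain M \<kappa>0 where rate: "\<And>\<kappa> t. \<kappa> \<ge> \<kappa>0 \<Longrightarrow> t \<in> {T1..T2} \<Longrightarrow>
      (norm (U \<kappa> (shift t \<omega>) - W (shift t \<omega>)))\<^sup>2 + (norm (V \<kappa> (shift t \<omega>) - W (shift t \<omega>)))\<^sup>2 \<le> M / \<kappa>"
      using synchronization_rate[OF W' W_recurrent U' V' temp] by blast
    have "\<forall>\<^sub>F \<kappa> in at_top. M / \<kappa> < e\<^sup>2"
    proof -
      have "((\<lambda>\<kappa>. M / \<kappa>) \<longlongrightarrow> 0) at_top" by (intro tendsto_divide_0[OF tendsto_const] filterlim_at_top_imp_at_infinity filterlim_ident)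
      from order_tendstoD(2)[OF this, of "e\<^sup>2"] \<open>e > 0\<close> show ?thesis by simp
    qed
    then show "\<forall>\<^sub>F \<kappa> in at_top. \<forall>t\<in>{T1..T2}. dist (U \<kappa> (shift t \<omega>), V \<kappa> (shift t \<omega>)) (W (shift t \<omega>), W (shift t \<omega>)) < e"
      using eventually_ge_at_top[of \<kappa>0]
    proof eventually_elim
      case (elim \<kappa>)
      show ?case
      proof
        fix t assume "t \<in> {T1..T2}"
        from rate[OF elim(2) this] elim(1)
        have "(norm (U \<kappa> (shift t \<omega>) - W (shift t \<omega>)))\<^sup>2 + (norm (V \<kappa> (shift t \<omega>) - W (shift t \<omega>)))\<^sup>2 < e\<^sup>2" by simp
        then have "sqrt ((norm (U \<kappa> (shift t \<omega>) - W (shift t \<omega>)))\<^sup>2 + (norm (V \<kappa> (shift t \<omega>) - W (shift t \<omega>)))\<^sup>2) < e"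
          using \<open>e > 0\<close> by (intro real_less_lsqrt) auto
        then show "dist (U \<kappa> (shift t \<omega>), V \<kappa> (shift t \<omega>)) (W (shift t \<omega>), W (shift t \<omega>)) < e"
          by (simp add: dist_norm norm_Pair)
      qed
    qed
  qed
qed


section \<open>Recurrence and synchronization\<close>

definition recurrent_paths :: "path set \<Rightarrow> (path \<Rightarrow> 'a::real_normed_vector) \<Rightarrow> path set" where
  "recurrent_paths \<Omega> W = {\<omega>\<in>\<Omega>. \<exists>K::nat. \<exists>\<^sub>F s in at_bot. norm (W (shift s \<omega>)) < real K}"

lemma recurrent_pathsD:
  assumes "\<omega> \<in> recurrent_paths \<Omega> W" "\<epsilon> > 0"
  shows "\<exists>\<^sub>F s in at_bot. norm (W (shift s \<omega>)) \<le> exp (- \<epsilon> * s)"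
proof -
  obtain K :: nat where K: "\<exists>\<^sub>F s in at_bot. norm (W (shift s \<omega>)) < real K"
    using assms(1) by (auto simp: recurrent_paths_def)
  have "filterlim (\<lambda>s. exp (- \<epsilon> * s)) at_top at_bot" using assms(2) by real_asymp
  then have "\<forall>\<^sub>F s in at_bot. real K \<le> exp (- \<epsilon> * s)" by (auto simp: filterlim_at_top)
  from frequently_eventually_conj[OF K this] show ?thesis
    by (rule frequently_elim1) auto
qed

text \<open>A continuous function below \<open>c\<close> at some point is below \<open>c\<close> at a rational point nearby, which makes
recurrence a countable condition and hence measurable.\<close>

lemma frequently_at_bot_iff_rational:
  fixes h :: "real \<Rightarrow> real"
  assumes "continuous_on UNIV h"
  shows "(\<exists>\<^sub>F s in at_bot. h s < c) \<longleftrightarrow> (\<forall>n::nat. \<exists>q\<in>{q\<in>\<rat>. q < - real n}. h q < c)"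
proof
  assume freq: "\<exists>\<^sub>F s in at_bot. h s < c"
  show "\<forall>n::nat. \<exists>q\<in>{q\<in>\<rat>. q < - real n}. h q < c"
  proof
    fix n :: nat
    have "\<forall>\<^sub>F s in at_bot. s \<le> - real n - 1" by (rule eventually_le_at_bot)
    from frequently_eventually_conj[OF freq this] obtain s where s: "h s < c" "s < - real n"
      by (auto dest!: frequently_ex)
    have "open {s. h s < c}" by (intro open_Collect_less assms continuous_on_const)
    then have "open ({s. h s < c} \<inter> {..<- real n})" by (intro open_Int open_lessThan)
    moreover have "s \<in> {s. h s < c} \<inter> {..<- real n}" using s by simp
    moreover have "s \<in> closure \<rat>" by (simp add: Rats_closure_real)
    ultimately obtain q where "q \<in> \<rat>" "q \<in> {s. h s < c} \<inter> {..<- real n}"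
      using closure_iff_nhds_not_empty[of s \<rat>] by blast
    then show "\<exists>q\<in>{q\<in>\<rat>. q < - real n}. h q < c" by blast
  qed
next
  assume *: "\<forall>n::nat. \<exists>q\<in>{q\<in>\<rat>. q < - real n}. h q < c"
  show "\<exists>\<^sub>F s in at_bot. h s < c"
    unfolding frequently_def eventually_at_bot_linorder
  proof
    assume "\<exists>N. \<forall>s\<le>N. \<not> h s < c"
    then obtain N where N: "\<And>s. s \<le> N \<Longrightarrow> \<not> h s < c" by blast
    obtain n :: nat where n: "- N \<le> real n" using real_arch_simple by blast
    obtain q where "q < - real n" "h q < c" using * by blast
    then show False using N[of q] n by simp
  qed
qed

lemma frequently_at_bot_translate:
  fixes Q :: "real \<Rightarrow> bool"
  assumes "\<exists>\<^sub>F s in at_bot. Q s"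
  shows "\<exists>\<^sub>F s in at_bot. Q (s + t)"
proof -
  have "\<exists>s\<le>N. Q (s + t)" for N
  proof -
    obtain r where "r \<le> N + t" "Q r"
      using assms unfolding frequently_def eventually_at_bot_linorder by blast
    then show ?thesis by (intro exI[of _ "r - t"]) simp
  qed
  then show ?thesis unfolding frequently_def eventually_at_bot_linorder by blast
qed

lemma invariant_full_shift_iff:
  assumes "invariant_full P \<Omega>" "\<Omega> \<subseteq> C0" "\<omega> \<in> C0"
  shows "shift t \<omega> \<in> \<Omega> \<longleftrightarrow> \<omega> \<in> \<Omega>"
proof -
  have inv: "shift s \<omega>' \<in> \<Omega>" if "\<omega>' \<in> \<Omega>" for s \<omega>'
    using assms(1) that unfolding invariant_full_def by blast
  have "\<omega> = shift (- t) (shift t \<omega>)" using assms(3) by (simp add: shift_shift shift_zero)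
  then show ?thesis using inv by metis
qed

text \<open>Poincare recurrence in its simplest form. The events \<open>norm (W (shift (- n) \<omega>)) < K\<close> all have the
probability of \<open>norm (W \<omega>) < K\<close>, hence infinitely many of them occur with at least this probability,
which tends to \<open>1\<close> as \<open>K\<close> grows.\<close>

lemma invariant_full_recurrent_paths:
  fixes W :: "path \<Rightarrow> 'a::euclidean_space"
  assumes law: "fbm_pair_law H1 H2 P" and \<Omega>: "invariant_full P \<Omega>"
    and W: "W \<in> borel_measurable (restrict_space P \<Omega>)"
    and cont: "\<And>\<omega>. \<omega> \<in> \<Omega> \<Longrightarrow> continuous_on UNIV (\<lambda>t. W (shift t \<omega>))"
  shows "invariant_full P (recurrent_paths \<Omega> W)"
proof -
  interpret prob_space P by (rule P_prob_space[OF law])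
  have \<Omega>s[measurable]: "\<Omega> \<in> sets P" and \<Omega>1: "measure P \<Omega> = 1" using \<Omega> by (auto simp: invariant_full_def)
  have \<Omega>C0: "\<Omega> \<subseteq> C0" using sets.sets_into_space[OF \<Omega>s] by (simp add: space_P[OF law])
  have iff: "shift t \<omega> \<in> \<Omega> \<longleftrightarrow> \<omega> \<in> \<Omega>" if "\<omega> \<in> C0" for t \<omega>
    by (rule invariant_full_shift_iff[OF \<Omega> \<Omega>C0 that])
  define D where "D K = {\<omega>\<in>\<Omega>. norm (W \<omega>) < real K}" for K :: nat
  define A where "A q K = {\<omega>\<in>\<Omega>. norm (W (shift q \<omega>)) < real K}" for q :: real and K :: nat
  have D: "D K \<in> sets P" for K
  proof -
    have "{\<omega>\<in>space (restrict_space P \<Omega>). norm (W \<omega>) < real K} \<in> sets (restrict_space P \<Omega>)"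
      by (rule borel_measurable_less[OF measurable_compose[OF W borel_measurable_norm] borel_measurable_const])
    moreover have "space (restrict_space P \<Omega>) = \<Omega>" using \<Omega>C0 by (auto simp: space_restrict_space space_P[OF law])
    ultimately show ?thesis unfolding D_def by (simp add: sets_restrict_space_iff)
  qed
  have A_vimage: "A q K = shift q -` D K \<inter> space P" for q K
    using iff \<Omega>C0 by (auto simp: A_def D_def space_P[OF law])
  have A: "A q K \<in> sets P" for q K
    unfolding A_vimage by (rule measurable_sets[OF shift_measurable[OF law] D])
  have A_measure: "measure P (A q K) = measure P (D K)" for q K
  proof -
    have "measure P (D K) = measure (distr P P (shift q)) (D K)" by (simp add: shift_preserves_law[OF law])
    also have "\<dots> = measure P (A q K)"
      unfolding A_vimage by (rule measure_distr[OF shift_measurable[OF law] D])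
    finally show ?thesis by simp
  qed
  define R where "R K = (\<Inter>n::nat. \<Union>q\<in>{q\<in>\<rat>. q < - real n}. A q K)" for K
  have cQ: "countable {q\<in>\<rat>. q < c}" for c :: real by (rule countable_subset[OF _ countable_rat]) auto
  have R_sets: "R K \<in> sets P" for K
  proof -
    have "(\<Union>q\<in>{q\<in>\<rat>. q < - real n}. A q K) \<in> sets P" for n
      by (rule sets.countable_UN'[OF cQ]) (use A in auto)
    then show ?thesis unfolding R_def by (intro sets.countable_INT) auto
  qed
  have recurrent: "recurrent_paths \<Omega> W = (\<Union>K. R K)"
  proof -
    have "(\<exists>\<^sub>F s in at_bot. norm (W (shift s \<omega>)) < real K) \<longleftrightarrow> \<omega> \<in> R K" if "\<omega> \<in> \<Omega>" for \<omega> K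
    proof -
      have "continuous_on UNIV (\<lambda>s. norm (W (shift s \<omega>)))" by (intro continuous_on_norm cont that)
      from frequently_at_bot_iff_rational[OF this] show ?thesis using that by (simp add: R_def A_def)
    qed
    moreover have "\<omega> \<in> \<Omega>" if "\<omega> \<in> R K" for \<omega> K using that by (auto simp: R_def A_def)
    ultimately show ?thesis unfolding recurrent_paths_def by blast
  qed
  show ?thesis unfolding invariant_full_def
  proof (intro conjI allI)
    show rec_sets: "recurrent_paths \<Omega> W \<in> sets P" unfolding recurrent using R_sets by auto
    have R_prob: "measure P (D K) \<le> measure P (R K)" for K
    proof -
      \<comment> \<open>The decreasing events whose intersection is the limit superior of the \<open>A (- real m) K\<close>.\<close>
      define E where "E n = (\<Union>m\<in>{n..}. A (- real m) K)" for n :: nat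
      have E: "E n \<in> sets P" for n unfolding E_def by (intro sets.countable_UN') (use A in auto)
      have "decseq E" unfolding decseq_def E_def by (intro allI impI UN_mono) auto
      then have "(\<lambda>n. measure P (E n)) \<longlonglongrightarrow> measure P (\<Inter>n. E n)"
        using E by (intro finite_Lim_measure_decseq) auto
      moreover have "measure P (D K) \<le> measure P (E n)" for n
      proof -
        have "A (- real n) K \<subseteq> E n" unfolding E_def by auto
        then show ?thesis using finite_measure_mono[OF _ E] A_measure by metis
      qed
      ultimately have "measure P (D K) \<le> measure P (\<Inter>n. E n)" by (intro LIMSEQ_le_const) auto
      also have "\<dots> \<le> measure P (R K)"
      proof (rule finite_measure_mono[OF _ R_sets])
        have "E (Suc n) \<subseteq> (\<Union>q\<in>{q\<in>\<rat>. q < - real n}. A q K)" for n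
        proof
          fix \<omega> assume "\<omega> \<in> E (Suc n)"
          then obtain m where "m \<ge> Suc n" "\<omega> \<in> A (- real m) K" by (auto simp: E_def)
          then show "\<omega> \<in> (\<Union>q\<in>{q\<in>\<rat>. q < - real n}. A q K)" by (intro UN_I[of "- real m"]) auto
        qed
        then show "(\<Inter>n. E n) \<subseteq> R K" unfolding R_def by blast
      qed
      finally show ?thesis .
    qed
    have "(\<lambda>K. measure P (D K)) \<longlonglongrightarrow> measure P (\<Union>K. D K)"
      using D by (intro finite_Lim_measure_incseq) (auto simp: incseq_def D_def)
    moreover have "(\<Union>K. D K) = \<Omega>" using reals_Archimedean2 by (auto simp: D_def)
    ultimately have "(\<lambda>K. measure P (D K)) \<longlonglongrightarrow> 1" by (simp add: \<Omega>1)
    moreover have "measure P (D K) \<le> measure P (recurrent_paths \<Omega> W)" for K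
    proof -
      have "measure P (R K) \<le> measure P (recurrent_paths \<Omega> W)"
        by (rule finite_measure_mono[OF _ rec_sets]) (auto simp: recurrent)
      with R_prob[of K] show ?thesis by simp
    qed
    ultimately have "1 \<le> measure P (recurrent_paths \<Omega> W)" by (intro LIMSEQ_le_const2) auto
    then show "measure P (recurrent_paths \<Omega> W) = 1" by (intro order_antisym prob_le_1)
    have sub: "shift t \<omega> \<in> recurrent_paths \<Omega> W" if rec: "\<omega> \<in> recurrent_paths \<Omega> W" for t \<omega>
    proof -
      obtain K :: nat where K: "\<exists>\<^sub>F s in at_bot. norm (W (shift s \<omega>)) < real K" and "\<omega> \<in> \<Omega>"
        using rec by (auto simp: recurrent_paths_def)
      then have "shift t \<omega> \<in> \<Omega>" using iff \<Omega>C0 by blast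
      moreover have "\<exists>\<^sub>F s in at_bot. norm (W (shift s (shift t \<omega>))) < real K"
        using frequently_at_bot_translate[OF K, of t] by (simp add: shift_shift)
      ultimately show ?thesis by (auto simp: recurrent_paths_def)
    qed
    fix t
    show "shift t ` recurrent_paths \<Omega> W = recurrent_paths \<Omega> W"
    proof (intro equalityI subsetI)
      fix \<omega> assume \<omega>: "\<omega> \<in> recurrent_paths \<Omega> W"
      then have "\<omega> \<in> C0" using \<Omega>C0 by (auto simp: recurrent_paths_def)
      then have "\<omega> = shift t (shift (- t) \<omega>)" by (simp add: shift_shift shift_zero)
      then show "\<omega> \<in> shift t ` recurrent_paths \<Omega> W" using sub[OF \<omega>] by blast
    qed (use sub in blast)
  qed
qed

theorem corollary6p1:
  fixes P :: "path measure" and H1 H2 :: real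
  assumes "1/2 < H1" "H1 < 1" "1/2 < H2" "H2 < 1"
    and "fbm_pair_law H1 H2 P"
  shows "\<exists>\<Omega>0. invariant_full P \<Omega>0 \<and>
    (\<forall>\<Omega>. invariant_full P \<Omega> \<and> \<Omega> \<subseteq> \<Omega>0 \<longrightarrow>
      (\<forall>(f :: real ^ 'd \<Rightarrow> real ^ 'd) g a1 a2 b1 b2 \<phi> U V W.
         linear_growth f \<and> linear_growth g \<and>
         dissipative_lipschitz f \<and> dissipative_lipschitz g \<and>
         integrability_condition f g \<and>
         a1 \<noteq> 0 \<and> a2 \<noteq> 0 \<and>
         (\<forall>\<kappa>\<ge>1.
            random_dynamical_system P \<Omega> (\<phi> \<kappa>) \<and>
            generated_by \<Omega> (coupled_field f g a1 a2 b1 b2 \<kappa>) (\<phi> \<kappa>) \<and>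
            random_attractor P \<Omega> (\<phi> \<kappa>) (\<lambda>\<omega>. {(U \<kappa> \<omega>, V \<kappa> \<omega>)}) \<and>
            stationary_solution P \<Omega> (coupled_field f g a1 a2 b1 b2 \<kappa>) (\<lambda>\<omega>. (U \<kappa> \<omega>, V \<kappa> \<omega>))) \<and>
         stationary_solution P \<Omega> (averaged_field f g a1 a2 b1 b2) W
         \<longrightarrow>
         (\<exists>\<Omega>1\<subseteq>\<Omega>. invariant_full P \<Omega>1 \<and> (\<forall>\<omega>\<in>\<Omega>1. synchronizes U V W \<omega>)) \<and>
         (tempered \<Omega> (\<lambda>\<omega>. {W \<omega>}) \<longrightarrow> (\<forall>\<omega>\<in>\<Omega>. synchronizes U V W \<omega>))))"
proof (rule exI[of _ good_paths], rule conjI, goal_cases)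
  case 1
  show ?case by (rule invariant_full_good_paths[OF assms(5,1-4)])
next
  case 2
  show ?case
  proof (intro allI impI, elim conjE)
    fix \<Omega> and f g :: "real ^ 'd \<Rightarrow> real ^ 'd" and a1 a2 b1 b2 \<phi> U V W
    assume \<Omega>: "invariant_full P \<Omega>" "\<Omega> \<subseteq> good_paths"
      and fg: "linear_growth f" "linear_growth g" "dissipative_lipschitz f" "dissipative_lipschitz g"
      and UV: "\<forall>\<kappa>\<ge>1.
              random_dynamical_system P \<Omega> (\<phi> \<kappa>) \<and>
              generated_by \<Omega> (coupled_field f g a1 a2 b1 b2 \<kappa>) (\<phi> \<kappa>) \<and>
              random_attractor P \<Omega> (\<phi> \<kappa>) (\<lambda>\<omega>. {(U \<kappa> \<omega>, V \<kappa> \<omega>)}) \<and>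
              stationary_solution P \<Omega> (coupled_field f g a1 a2 b1 b2 \<kappa>) (\<lambda>\<omega>. (U \<kappa> \<omega>, V \<kappa> \<omega>))"
      and W: "stationary_solution P \<Omega> (averaged_field f g a1 a2 b1 b2) W"
    have sync: "synchronizes U V W \<omega>"
      if \<omega>: "\<omega> \<in> \<Omega>" and rec: "\<And>\<epsilon>. \<epsilon> > 0 \<Longrightarrow> \<exists>\<^sub>F s in at_bot. norm (W (shift s \<omega>)) \<le> exp (- \<epsilon> * s)" for \<omega>
    proof (rule synchronizes_if_recurrent[OF _ fg])
      show "\<omega> \<in> good_paths" using \<omega> \<Omega> by blast
      show "((\<lambda>t. (U \<kappa> (shift t \<omega>), V \<kappa> (shift t \<omega>))) has_vector_derivative
          coupled_field f g a1 a2 b1 b2 \<kappa> \<omega> t (U \<kappa> (shift t \<omega>), V \<kappa> (shift t \<omega>))) (at t)" if "\<kappa> \<ge> 1" for \<kappa> t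
        using UV that \<omega> unfolding stationary_solution_def by blast
      show "((\<lambda>t. ln (max 1 (norm (U \<kappa> (shift t \<omega>), V \<kappa> (shift t \<omega>)))) / \<bar>t\<bar>) \<longlongrightarrow> 0) at_bot" if "\<kappa> \<ge> 1" for \<kappa>
        using UV that \<omega> unfolding random_attractor_def tempered_def by simp
      show "((\<lambda>t. W (shift t \<omega>)) has_vector_derivative averaged_field f g a1 a2 b1 b2 \<omega> t (W (shift t \<omega>))) (at t)" for t
        using W \<omega> unfolding stationary_solution_def by blast
    qed (rule rec)
    have cont: "continuous_on UNIV (\<lambda>t. W (shift t \<omega>))" if "\<omega> \<in> \<Omega>" for \<omega>
      using W that unfolding stationary_solution_def
      by (intro continuous_at_imp_continuous_on ballI has_vector_derivative_continuous) blast
    have "\<exists>\<Omega>1\<subseteq>\<Omega>. invariant_full P \<Omega>1 \<and> (\<forall>\<omega>\<in>\<Omega>1. synchronizes U V W \<omega>)"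
    proof (intro exI[of _ "recurrent_paths \<Omega> W"] conjI ballI)
      show "recurrent_paths \<Omega> W \<subseteq> \<Omega>" by (auto simp: recurrent_paths_def)
      then show "synchronizes U V W \<omega>" if "\<omega> \<in> recurrent_paths \<Omega> W" for \<omega>
        using that recurrent_pathsD[OF that] by (intro sync) auto
      show "invariant_full P (recurrent_paths \<Omega> W)"
        using W cont unfolding stationary_solution_def
        by (intro invariant_full_recurrent_paths[OF assms(5) \<Omega>(1)]) auto
    qed
    moreover have "\<forall>\<omega>\<in>\<Omega>. synchronizes U V W \<omega>" if temp: "tempered \<Omega> (\<lambda>\<omega>. {W \<omega>})"
    proof
      fix \<omega> assume \<omega>: "\<omega> \<in> \<Omega>"
      have "((\<lambda>t. ln (max 1 (norm (W (shift t \<omega>)))) / \<bar>t\<bar>) \<longlongrightarrow> 0) at_bot"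
        using temp \<omega> unfolding tempered_def by simp
      then show "synchronizes U V W \<omega>"
        by (intro sync[OF \<omega>] eventually_frequently tempered_eventually_le_exp) auto
    qed
    ultimately show "(\<exists>\<Omega>1\<subseteq>\<Omega>. invariant_full P \<Omega>1 \<and> (\<forall>\<omega>\<in>\<Omega>1. synchronizes U V W \<omega>)) \<and>
           (tempered \<Omega> (\<lambda>\<omega>. {W \<omega>}) \<longrightarrow> (\<forall>\<omega>\<in>\<Omega>. synchronizes U V W \<omega>))" by blast
  qed
qed

end
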